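(* Let $f$, its model functions $f(\cdot;\bar x)$ and the Legendre function $h$ satisfy the Objective, Model, Relative-Error, Definability and Local Strong Convexity Assumptions listed in the context. Let $(x_k)_{k\in\mathbb{N}}$ be generated by Model BPG with $\tau_k\to\tau$ for some $\tau>0$, and suppose that every limit point of $(x_k)$ lies in $\operatorname{int}\operatorname{dom}h$. Then $(x_k)_{k\in\mathbb{N}}$ converges to a critical point of $f$, i.e. to a point $x$ with $0\in\partial f(x)$.
   Context: Notation. $\overline{\mathbb{R}}=\mathbb{R}\cup\{+\infty\}$; lsc = lower semicontinuous. $\widehat\partial$, $\partial$, $\partial^\infty$ denote the Fréchet (regular), limiting and horizon subdifferentials in the sense of Rockafellar--Wets; "regular" means subdifferentially regular in their sense; $N_C$ is the limiting normal cone of $C$. $\operatorname{crit}f=\{x:0\in\partial f(x)\}$. For a function $(x,y)\mapsto f(x;y)$, $\partial_x f(x;y),\partial^\infty_x f(x;y)$ are taken in the first variable with $y$ fixed (similarly $\partial_y$), and $\partial f(x;y),\partial^\infty f(x;y)$ are taken jointly in $(x,y)$. Legendre function: a proper lsc convex $h:\mathbb{R}^N\to\overline{\mathbb{R}}$ that is differentiable on $\operatorname{int}\operatorname{dom}h$, with $\|\nabla h(x_k)\|\to\infty$ for every sequence in $\operatorname{int}\operatorname{dom}h$ converging to a boundary point of $\operatorname{dom}h$, and strictly convex on $\operatorname{int}\operatorname{dom}h$. Bregman distance: $D_h(x,y)=h(x)-h(y)-\langle\nabla h(y),x-y\rangle$ for $x\in\operatorname{dom}h$, $y\in\operatorname{int}\operatorname{dom}h$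 (and $+\infty$ otherwise). Growth function: a differentiable $\omega:\mathbb{R}_+\to\mathbb{R}_+$ with $\omega(0)=\omega'_+(0)=0$. Model function for $f$ around $\bar x\in\operatorname{dom}f$: a function $f(\cdot;\bar x):\mathbb{R}^N\to\overline{\mathbb{R}}$ with $\operatorname{dom}f(\cdot;\bar x)=\operatorname{dom}f$ for which there is a growth function $\omega_{\bar x}$ with $|f(x)-f(x;\bar x)|\le\omega_{\bar x}(\|x-\bar x\|)$ for all $x\in\operatorname{dom}f$. A model function $f(\cdot;\bar x)$ is given for every $\bar x\in\operatorname{dom}f$. Objective Assumption: $f:\mathbb{R}^N\to\overline{\mathbb{R}}$ is proper, lsc and coercive ($f(x)\to\infty$ as $\|x\|\to\infty$). Model Assumption: $h$ is a Legendre function that is $\mathcal C^2$ on $\operatorname{int}\operatorname{dom}h$; $\operatorname{dom}f\cap\operatorname{int}\operatorname{dom}h\ne\emptyset$; $\operatorname{crit}f\cap\operatorname{int}\operatorname{dom}h\neq\emptyset$; and (i) $\operatorname{dom}f\subset\operatorname{cl}\operatorname{dom}h$ and there are $\bar L>0$, $\underline L\in\mathbb{R}$ such that for all $\bar x\in\operatorname{dom}f\cap\operatorname{int}\operatorname{dom}h$ and all $x\in\operatorname{dom}f\cap\operatorname{dom}h$: $-\underline L D_h(x,\bar x)\le f(x)-f(x;\bar x)\le\bar L D_h(x,\bar x)$ (MAP property); (ii) for all $\bar x\in\operatorname{dom}f\cap\operatorname{int}\operatorname{dom}h$ and $x\in\operatorname{dom}f\cap\operatorname{dom}h$: $\partial^\infty_x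 f(x;\bar x)\cap(-N_{\operatorname{dom}h}(x))=\{0\}$; (iii) for all $x,y\in\operatorname{dom}f$: $(0,v)\in\partial^\infty f(x;y)$ implies $v=0$, and $(v,0)\in\partial^\infty f(x;y)$ implies $v=0$; moreover $f(\cdot;\cdot)$ is regular at every $(x,y)\in\operatorname{dom}f\times\operatorname{dom}f$; (iv) $(x,\bar x)\mapsto f(x;\bar x)$ is proper, lsc, and continuous on $\operatorname{dom}f\times\operatorname{dom}f$. Relative-Error Assumption: (i) for every bounded $B\subset\operatorname{dom}f$ there is $c>0$ with $\inf_{v\in\partial_y f(x;y)}\|v\|\le c\|x-y\|$ for all $x,y\in B$; (ii) $h$ has bounded second derivative on every bounded subset of $\operatorname{int}\operatorname{dom}h$; (iii) for bounded sequences $(u_k),(v_k)$ in $\operatorname{int}\operatorname{dom}h$: $D_h(u_k,v_k)\to0\iff\|u_k-v_k\|\to0$. Definability Assumption: for some o-minimal structure $\mathcal O$ on $(\mathbb{R},+,\cdot)$, the functions $(x,\bar x)\mapsto f(x;\bar x)$ with domain $\operatorname{dom}f\times\operatorname{dom}f$ and $(x,\bar x)\mapsto h(\bar x)+\langle\nabla h(\bar x),x-\bar x\rangle$ with domain $\operatorname{dom}h\times\operatorname{int}\operatorname{dom}h$ are definable in $\mathcal O$. Local Strong Convexity Assumption: for every compact convex $B\subset\operatorname{int}\operatorname{dom}h$ there is $\sigma_B>0$ with $D_h(x,y)\ge\frac{\sigma_B}{2}\|x-y\|^2$ for all $x,y\in B$. Model BPG: choose $x_0=x_1\in\operatorname{dom}f\cap\operatorname{int}\operatorname{dom}h$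 and $0<\underline\tau<\bar\tau<1/\bar L$; for each $k\ge1$ choose $\tau_k\in[\underline\tau,\bar\tau]$ and $x_{k+1}\in\operatorname{Argmin}_{x\in\mathbb{R}^N}\{f(x;x_k)+\frac1{\tau_k}D_h(x,x_k)\}$. *)

theory Defs
  imports "HOL-Analysis.Analysis"
begin

section \<open>Extended-valued functions\<close>

text \<open>The range of the functions below is meant to be the reals together with \<open>+\<infinity>\<close>. They are typed
  with \<^typ>\<open>ereal\<close>, and the value \<open>-\<infinity>\<close> is excluded by the properness assumptions.\<close>

definition edom :: "('a \<Rightarrow> ereal) \<Rightarrow> 'a set" where
  "edom f = {x. f x < \<infinity>}"

definition proper :: "('a \<Rightarrow> ereal) \<Rightarrow> bool" where
  "proper f \<longleftrightarrow> (\<forall>x. f x \<noteq> -\<infinity>) \<and> edom f \<noteq> {}"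

definition lsc :: "('a::topological_space \<Rightarrow> ereal) \<Rightarrow> bool" where
  "lsc f \<longleftrightarrow> (\<forall>x. f x \<le> Liminf (at x) f)"

definition epi :: "('a \<Rightarrow> ereal) \<Rightarrow> ('a \<times> real) set" where
  "epi f = {(x, t). f x \<le> ereal t}"

text \<open>The set of minimizers is empty for the function that is identically \<open>+\<infinity>\<close>
  (convention of Rockafellar and Wets).\<close>

definition Argmin :: "('a \<Rightarrow> ereal) \<Rightarrow> 'a set" where
  "Argmin f = {x. f x < \<infinity> \<and> (\<forall>y. f x \<le> f y)}"

section \<open>Normal cones and subdifferentials (Rockafellar--Wets)\<close>

definition regular_normal_cone :: "'a::euclidean_space set \<Rightarrow> 'a \<Rightarrow> 'a set" where
  "regular_normal_cone C x =
     {v. x \<in> C \<and> Limsup (at x within C) (\<lambda>z. ereal ((v \<bullet> (z - x)) / norm (z - x))) \<le> 0}"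

definition normal_cone :: "'a::euclidean_space set \<Rightarrow> 'a \<Rightarrow> 'a set" where
  "normal_cone C x =
     {v. x \<in> C \<and> (\<exists>xs vs. (\<forall>k. xs k \<in> C \<and> vs k \<in> regular_normal_cone C (xs k))
            \<and> xs \<longlonglongrightarrow> x \<and> vs \<longlonglongrightarrow> v)}"

definition regular_subdiff :: "('a::euclidean_space \<Rightarrow> ereal) \<Rightarrow> 'a \<Rightarrow> 'a set" where
  "regular_subdiff f x =
     {v. \<bar>f x\<bar> \<noteq> \<infinity> \<and>
         0 \<le> Liminf (at x) (\<lambda>z. (f z - f x - ereal (v \<bullet> (z - x))) / ereal (norm (z - x)))}"

text \<open>Both limits are taken along \<open>f\<close>-attentively convergent sequences.\<close>

definition subdiff :: "('a::euclidean_space \<Rightarrow> ereal) \<Rightarrow> 'a \<Rightarrow> 'a set" where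
  "subdiff f x =
     {v. \<bar>f x\<bar> \<noteq> \<infinity> \<and>
         (\<exists>xs vs. xs \<longlonglongrightarrow> x \<and> (\<lambda>k. f (xs k)) \<longlonglongrightarrow> f x
            \<and> (\<forall>k. vs k \<in> regular_subdiff f (xs k)) \<and> vs \<longlonglongrightarrow> v)}"

definition horizon_subdiff :: "('a::euclidean_space \<Rightarrow> ereal) \<Rightarrow> 'a \<Rightarrow> 'a set" where
  "horizon_subdiff f x =
     {v. \<bar>f x\<bar> \<noteq> \<infinity> \<and>
         (\<exists>xs vs (r :: nat \<Rightarrow> real). xs \<longlonglongrightarrow> x \<and> (\<lambda>k. f (xs k)) \<longlonglongrightarrow> f x
            \<and> (\<forall>k. vs k \<in> regular_subdiff f (xs k))
            \<and> (\<forall>k. r k > 0) \<and> r \<longlonglongrightarrow> 0 \<and> (\<lambda>k. r k *\<^sub>R vs k) \<longlonglongrightarrow> v)}"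

definition crit :: "('a::euclidean_space \<Rightarrow> ereal) \<Rightarrow> 'a set" where
  "crit f = {x. 0 \<in> subdiff f x}"

definition clarke_regular_at :: "'a::euclidean_space set \<Rightarrow> 'a \<Rightarrow> bool" where
  "clarke_regular_at C x \<longleftrightarrow>
     x \<in> C \<and> (\<exists>e>0. closed (C \<inter> cball x e)) \<and> normal_cone C x = regular_normal_cone C x"

definition subdiff_regular_at :: "('a::euclidean_space \<Rightarrow> ereal) \<Rightarrow> 'a \<Rightarrow> bool" where
  "subdiff_regular_at f x \<longleftrightarrow>
     \<bar>f x\<bar> \<noteq> \<infinity> \<and> clarke_regular_at (epi f) (x, real_of_ereal (f x))"

section \<open>Legendre functions and Bregman distances\<close>

text \<open>Only used at interior points of the domain, near which \<open>h\<close> is finite.\<close>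

definition egrad :: "('a::euclidean_space \<Rightarrow> ereal) \<Rightarrow> 'a \<Rightarrow> 'a" where
  "egrad h y = (THE g. GDERIV (\<lambda>z. real_of_ereal (h z)) y :> g)"

definition legendre :: "('a::euclidean_space \<Rightarrow> ereal) \<Rightarrow> bool" where
  "legendre h \<longleftrightarrow>
     proper h \<and> lsc h \<and> convex (epi h)
     \<and> (\<forall>y\<in>interior (edom h). (\<lambda>z. real_of_ereal (h z)) differentiable (at y))
     \<and> (\<forall>xs x. (\<forall>k. xs k \<in> interior (edom h)) \<and> xs \<longlonglongrightarrow> x \<and> x \<in> frontier (edom h)
           \<longrightarrow> filterlim (\<lambda>k. norm (egrad h (xs k))) at_top sequentially)
     \<and> (\<forall>x\<in>interior (edom h). \<forall>y\<in>interior (edom h). \<forall>t::real. x \<noteq> y \<and> 0 < t \<and> t < 1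
           \<longrightarrow> h ((1 - t) *\<^sub>R x + t *\<^sub>R y) < ereal (1 - t) * h x + ereal t * h y)"

definition bregman :: "('a::euclidean_space \<Rightarrow> ereal) \<Rightarrow> 'a \<Rightarrow> 'a \<Rightarrow> ereal" where
  "bregman h x y =
     (if x \<in> edom h \<and> y \<in> interior (edom h)
      then h x - h y - ereal (egrad h y \<bullet> (x - y)) else \<infinity>)"

definition C2_on_interior :: "('a::euclidean_space \<Rightarrow> ereal) \<Rightarrow> bool" where
  "C2_on_interior h \<longleftrightarrow>
     (\<forall>y\<in>interior (edom h). (\<lambda>z. real_of_ereal (h z)) differentiable (at y))
     \<and> (\<exists>H :: 'a \<Rightarrow> 'a \<Rightarrow>\<^sub>L 'a. continuous_on (interior (edom h)) H
           \<and> (\<forall>y\<in>interior (edom h). (egrad h has_derivative blinfun_apply (H y)) (at y)))"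

section \<open>Model functions\<close>

definition growth_function :: "(real \<Rightarrow> real) \<Rightarrow> bool" where
  "growth_function \<omega> \<longleftrightarrow>
     (\<forall>t\<ge>0. 0 \<le> \<omega> t) \<and> \<omega> differentiable_on {0..}
     \<and> \<omega> 0 = 0 \<and> (\<omega> has_real_derivative 0) (at 0 within {0..})"

definition model_function :: "('a::euclidean_space \<Rightarrow> ereal) \<Rightarrow> 'a \<Rightarrow> ('a \<Rightarrow> ereal) \<Rightarrow> bool" where
  "model_function f xb g \<longleftrightarrow>
     (\<forall>x. g x \<noteq> -\<infinity>) \<and> edom g = edom f
     \<and> (\<exists>\<omega>. growth_function \<omega> \<and>
           (\<forall>x\<in>edom f. \<bar>f x - g x\<bar> \<le> ereal (\<omega> (norm (x - xb)))))"

text \<open>A family of models is a curried function \<open>m\<close>, where \<open>m x y\<close> is the value at \<open>x\<close> of the model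
  around \<open>y\<close>. Models are given only around points of the domain of \<open>f\<close>; as a function of both
  arguments the family is extended by \<open>+\<infinity>\<close>, so that its domain is \<open>edom f \<times> edom f\<close>.\<close>

definition joint_model ::
  "('a \<Rightarrow> ereal) \<Rightarrow> ('a \<Rightarrow> 'a \<Rightarrow> ereal) \<Rightarrow> 'a \<times> 'a \<Rightarrow> ereal" where
  "joint_model f m = (\<lambda>(x, y). if y \<in> edom f then m x y else \<infinity>)"

section \<open>O-minimal structures\<close>

text \<open>Points of the \<open>n\<close>-dimensional space are lists of length \<open>n\<close>; \<open>S n\<close> is the collection of
  definable subsets of that space. For the real line, \<^const>\<open>is_interval\<close> covers points and all
  bounded and unbounded intervals.\<close>

definition o_minimal :: "(nat \<Rightarrow> real list set set) \<Rightarrow> bool" where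
  "o_minimal S \<longleftrightarrow>
     (\<forall>n. S n \<subseteq> Pow {xs. length xs = n} \<and> {} \<in> S n
        \<and> (\<forall>A\<in>S n. {xs. length xs = n} - A \<in> S n)
        \<and> (\<forall>A\<in>S n. \<forall>B\<in>S n. A \<union> B \<in> S n))
     \<and> (\<forall>n. \<forall>A\<in>S n. {t # xs |t xs. xs \<in> A} \<in> S (Suc n) \<and> {xs @ [t] |t xs. xs \<in> A} \<in> S (Suc n))
     \<and> (\<forall>n. \<forall>A\<in>S (Suc n). butlast ` A \<in> S n)
     \<and> (\<forall>n. \<forall>i<n. \<forall>j<n. {xs. length xs = n \<and> xs ! i = xs ! j} \<in> S n)
     \<and> {[x, y, x + y] |x y. True} \<in> S 3
     \<and> {[x, y, x * y] |x y. True} \<in> S 3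
     \<and> (\<forall>A :: real set. (\<lambda>t. [t]) ` A \<in> S 1 \<longleftrightarrow>
           (\<exists>I. finite I \<and> (\<forall>J\<in>I. is_interval J) \<and> A = \<Union>I))"

text \<open>Sets in a Euclidean space are read through their coordinates. The order in which the basis is
  listed is immaterial, since the sets of an o-minimal structure are stable under permutation of
  coordinates.\<close>

definition definable_set ::
  "(nat \<Rightarrow> real list set set) \<Rightarrow> 'a::euclidean_space set \<Rightarrow> bool" where
  "definable_set S A \<longleftrightarrow>
     (\<exists>bs. distinct bs \<and> set bs = Basis \<and> (\<lambda>x. map (\<lambda>b. x \<bullet> b) bs) ` A \<in> S DIM('a))"

definition definable_fun ::
  "(nat \<Rightarrow> real list set set) \<Rightarrow> 'a::euclidean_space set \<Rightarrow> ('a \<Rightarrow> ereal) \<Rightarrow> bool" where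
  "definable_fun S D g \<longleftrightarrow> definable_set S {(z, t :: real). z \<in> D \<and> g z = ereal t}"

section \<open>Standing assumptions\<close>

definition objective_assumption :: "('a::euclidean_space \<Rightarrow> ereal) \<Rightarrow> bool" where
  "objective_assumption f \<longleftrightarrow> proper f \<and> lsc f \<and> (f \<longlongrightarrow> \<infinity>) at_infinity"

text \<open>The constants \<open>Lb\<close> (upper) and \<open>Lu\<close> (lower) are parameters because the admissible step sizes of
  the algorithm depend on \<open>Lb\<close>.\<close>

definition MAP_property ::
  "('a::euclidean_space \<Rightarrow> ereal) \<Rightarrow> ('a \<Rightarrow> 'a \<Rightarrow> ereal) \<Rightarrow> ('a \<Rightarrow> ereal) \<Rightarrow> real \<Rightarrow> real \<Rightarrow> bool" where
  "MAP_property f m h Lb Lu \<longleftrightarrow>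
     (\<forall>xb\<in>edom f \<inter> interior (edom h). \<forall>x\<in>edom f \<inter> edom h.
        ereal (- Lu) * bregman h x xb \<le> f x - m x xb \<and> f x - m x xb \<le> ereal Lb * bregman h x xb)"

definition model_assumption ::
  "('a::euclidean_space \<Rightarrow> ereal) \<Rightarrow> ('a \<Rightarrow> 'a \<Rightarrow> ereal) \<Rightarrow> ('a \<Rightarrow> ereal) \<Rightarrow> real \<Rightarrow> real \<Rightarrow> bool" where
  "model_assumption f m h Lb Lu \<longleftrightarrow>
     legendre h \<and> C2_on_interior h
     \<and> edom f \<inter> interior (edom h) \<noteq> {} \<and> crit f \<inter> interior (edom h) \<noteq> {}
     \<and> edom f \<subseteq> closure (edom h) \<and> Lb > 0 \<and> MAP_property f m h Lb Lu
     \<and> (\<forall>xb\<in>edom f \<inter> interior (edom h). \<forall>x\<in>edom f \<inter> edom h.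
          horizon_subdiff (\<lambda>z. m z xb) x \<inter> uminus ` normal_cone (edom h) x = {0})
     \<and> (\<forall>x\<in>edom f. \<forall>y\<in>edom f.
          (\<forall>v. (0, v) \<in> horizon_subdiff (joint_model f m) (x, y) \<longrightarrow> v = 0)
          \<and> (\<forall>v. (v, 0) \<in> horizon_subdiff (joint_model f m) (x, y) \<longrightarrow> v = 0)
          \<and> subdiff_regular_at (joint_model f m) (x, y))
     \<and> proper (joint_model f m) \<and> lsc (joint_model f m)
     \<and> continuous_on (edom f \<times> edom f) (joint_model f m)"

text \<open>In the first condition the infimum is taken in \<^typ>\<open>ereal\<close>, so that it is \<open>+\<infinity>\<close> for an empty
  partial subdifferential.\<close>

definition relative_error_assumption ::
  "('a::euclidean_space \<Rightarrow> ereal) \<Rightarrow> ('a \<Rightarrow> 'a \<Rightarrow> ereal) \<Rightarrow> ('a \<Rightarrow> ereal) \<Rightarrow> bool" where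
  "relative_error_assumption f m h \<longleftrightarrow>
     (\<forall>B. bounded B \<and> B \<subseteq> edom f \<longrightarrow>
        (\<exists>c>0. \<forall>x\<in>B. \<forall>y\<in>B.
           (INF v\<in>subdiff (\<lambda>z. joint_model f m (x, z)) y. ereal (norm v)) \<le> ereal (c * norm (x - y))))
     \<and> (\<forall>B. bounded B \<and> B \<subseteq> interior (edom h) \<longrightarrow>
        (\<exists>M. \<forall>y\<in>B. onorm (frechet_derivative (egrad h) (at y)) \<le> M))
     \<and> (\<forall>u v :: nat \<Rightarrow> 'a.
        range u \<subseteq> interior (edom h) \<and> range v \<subseteq> interior (edom h)
        \<and> bounded (range u) \<and> bounded (range v) \<longrightarrow>
        ((\<lambda>k. bregman h (u k) (v k)) \<longlonglongrightarrow> 0 \<longleftrightarrow> (\<lambda>k. norm (u k - v k)) \<longlonglongrightarrow> 0))"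

definition definability_assumption ::
  "('a::euclidean_space \<Rightarrow> ereal) \<Rightarrow> ('a \<Rightarrow> 'a \<Rightarrow> ereal) \<Rightarrow> ('a \<Rightarrow> ereal) \<Rightarrow> bool" where
  "definability_assumption f m h \<longleftrightarrow>
     (\<exists>S. o_minimal S
        \<and> definable_fun S (edom f \<times> edom f) (joint_model f m)
        \<and> definable_fun S (edom h \<times> interior (edom h))
            (\<lambda>(x, y). h y + ereal (egrad h y \<bullet> (x - y))))"

definition local_strong_convexity_assumption :: "('a::euclidean_space \<Rightarrow> ereal) \<Rightarrow> bool" where
  "local_strong_convexity_assumption h \<longleftrightarrow>
     (\<forall>B. compact B \<and> convex B \<and> B \<subseteq> interior (edom h) \<longrightarrow>
        (\<exists>\<sigma>>0. \<forall>x\<in>B. \<forall>y\<in>B. ereal (\<sigma> / 2 * (norm (x - y))\<^sup>2) \<le> bregman h x y))"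

section \<open>The algorithm\<close>

definition model_BPG ::
  "('a::euclidean_space \<Rightarrow> ereal) \<Rightarrow> ('a \<Rightarrow> 'a \<Rightarrow> ereal) \<Rightarrow> ('a \<Rightarrow> ereal) \<Rightarrow> real
    \<Rightarrow> (nat \<Rightarrow> real) \<Rightarrow> (nat \<Rightarrow> 'a) \<Rightarrow> bool" where
  "model_BPG f m h Lb \<tau> x \<longleftrightarrow>
     x 0 = x 1 \<and> x 1 \<in> edom f \<inter> interior (edom h)
     \<and> (\<exists>\<tau>l \<tau>u. 0 < \<tau>l \<and> \<tau>l < \<tau>u \<and> \<tau>u < 1 / Lb \<and> (\<forall>k\<ge>1. \<tau> k \<in> {\<tau>l..\<tau>u}))
     \<and> (\<forall>k\<ge>1. x (Suc k) \<in> Argmin (\<lambda>z. m z (x k) + ereal (1 / \<tau> k) * bregman h z (x k)))"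

end

theory Submission
  imports Defs
begin

text \<open>The Lyapunov function is \<open>f\<close> itself. First, the condition on the horizon subdifferential of the joint
  model excludes boundary points of \<open>dom f\<close> inside \<open>dom f\<close>, so \<open>dom f\<close> is open and hence contained in
  \<open>int dom h\<close>. The upper MAP bound gives \<open>f(x\<^sub>k) - f(x\<^bsub>k+1\<^esub>) \<ge> \<alpha> d\<^sub>k\<^sup>2\<close> with \<open>d\<^sub>k = |x\<^bsub>k+1\<^esub> - x\<^sub>k|\<close>. The lower MAP
  bound and the optimality of \<open>x\<^bsub>k+1\<^esub>\<close> give \<open>f(x) \<ge> f(x\<^bsub>k+1\<^esub>) - Q d\<^sub>k\<^sup>2 - P |x - x\<^bsub>k+1\<^esub>|\<^sup>2\<close> near \<open>x\<^bsub>k+1\<^esub>\<close>, so a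
  proximal step from \<open>x\<^bsub>k+1\<^esub>\<close> yields a point \<open>w\<^sub>k\<close> at distance \<open>O(d\<^sub>k)\<close> with a regular subgradient of \<open>f\<close> of
  size \<open>O(d\<^sub>k)\<close> and \<open>f(x\<^bsub>k+1\<^esub>) - O(d\<^sub>k\<^sup>2) \<le> f(w\<^sub>k) \<le> f(x\<^bsub>k+1\<^esub>)\<close>.

  The Kurdyka--Lojasiewicz inequality for the slopes of a definable function on a bounded set is obtained from
  a definable curve \<open>z(t)\<close> of almost minimal slope \<open>\<gamma>(t)\<close> on the level \<open>c + t\<close>. Its coordinates are monotone for
  small \<open>t > 0\<close>, so the curve has finite length, and the calmness inequality at \<open>z(t)\<close>, applied to earlier
  points of the curve itself, bounds \<open>t - s\<close> by \<open>\<gamma>(t)\<close> times the length between \<open>s\<close> and \<open>t\<close>. No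
  differentiability of the curve and no stratification is needed.\<close>

section \<open>O-minimal structures: coordinates\<close>

text \<open>The optimality of an iterate concerns the model around the previous one, and the MAP
  bounds compare values only. Together they give a quadratic minorant of \<open>f\<close> with an
  error of order \<open>d\<^sub>k\<^sup>2\<close>, which is not a subgradient; the proximal step
  turns it into one. Its cost is a loss of value: \<open>f(w\<^sub>k)\<close> can reach or pass
  below the limit of the values, where no Kurdyka--Lojasiewicz inequality is available. The length
  estimate therefore separates small losses, where the inequality is applied at
  \<open>w\<^sub>k\<close>, from large ones, which force a geometric decrease of the value gap.

  Openness of the domain lets all this happen on balls of one fixed radius: the initial sublevel set
  is compact, so it and its convex hull keep a positive distance from the complements of
  \<open>dom f\<close> and \<open>int dom h\<close>.

  The infimum of the slopes on a level may be unattained or zero. Adding \<open>t\<^sup>2\<close>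
  makes selection possible and the bound positive; the finite length of the curve is then used to
  show that the infimum itself dominates \<open>t\<^sup>2\<close>.\<close>

text \<open>\<open>level S n P\<close>: the predicate \<open>P\<close> on valuations of the variables \<open>0, 1, 2, \<dots>\<close> depends only on the first
  \<open>n\<close> of them and defines a set of \<open>S n\<close>.\<close>

definition level :: "(nat \<Rightarrow> real list set set) \<Rightarrow> nat \<Rightarrow> ((nat \<Rightarrow> real) \<Rightarrow> bool) \<Rightarrow> bool" where
  "level S n P \<longleftrightarrow> (\<exists>A\<in>S n. \<forall>e. P e \<longleftrightarrow> map e [0..<n] \<in> A)"

lemma map_upd_snoc: "map (e(n := t)) [0..<Suc n] = map e [0..<n] @ [t]"
  by simp

locale o_minimal_structure =
  fixes S :: "nat \<Rightarrow> real list set set"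
  assumes o_minimal: "o_minimal S"
begin

lemmas o_minimal_conjs = o_minimal[unfolded o_minimal_def]

lemma boolean_S:
  "S n \<subseteq> Pow {xs. length xs = n} \<and> {} \<in> S n \<and> (\<forall>A\<in>S n. {xs. length xs = n} - A \<in> S n)
    \<and> (\<forall>A\<in>S n. \<forall>B\<in>S n. A \<union> B \<in> S n)"
  by (rule o_minimal_conjs[THEN conjunct1, THEN spec])

lemma length_S: "A \<in> S n \<Longrightarrow> xs \<in> A \<Longrightarrow> length xs = n"
  using boolean_S[of n] by auto

lemma empty_S: "{} \<in> S n"
  using boolean_S[of n] by auto

lemma compl_S: "A \<in> S n \<Longrightarrow> {xs. length xs = n} - A \<in> S n"
  using boolean_S[of n] by auto

lemma Un_S: "A \<in> S n \<Longrightarrow> B \<in> S n \<Longrightarrow> A \<union> B \<in> S n"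
  using boolean_S[of n] by auto

lemma Cons_S: "A \<in> S n \<Longrightarrow> {t # xs |t xs. xs \<in> A} \<in> S (Suc n)"
  using o_minimal_conjs[THEN conjunct2, THEN conjunct1] by simp

lemma butlast_S: "A \<in> S (Suc n) \<Longrightarrow> butlast ` A \<in> S n"
  using o_minimal_conjs[THEN conjunct2, THEN conjunct2, THEN conjunct1] by simp

lemma diagonal_S: "i < n \<Longrightarrow> j < n \<Longrightarrow> {xs. length xs = n \<and> xs ! i = xs ! j} \<in> S n"
  using o_minimal_conjs[THEN conjunct2, THEN conjunct2, THEN conjunct2, THEN conjunct1] by simp

lemma add_S: "{[x, y, x + y] |x y. True} \<in> S 3"
  by (rule o_minimal_conjs[THEN conjunct2, THEN conjunct2, THEN conjunct2, THEN conjunct2, THEN conjunct1])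

lemma mult_S: "{[x, y, x * y] |x y. True} \<in> S 3"
  by (rule o_minimal_conjs[THEN conjunct2, THEN conjunct2, THEN conjunct2, THEN conjunct2, THEN conjunct2,
        THEN conjunct1])

lemma S_1: "(\<lambda>t. [t]) ` A \<in> S 1 \<longleftrightarrow> (\<exists>I. finite I \<and> (\<forall>J\<in>I. is_interval J) \<and> A = \<Union>I)"
  by (rule o_minimal_conjs[THEN conjunct2, THEN conjunct2, THEN conjunct2, THEN conjunct2, THEN conjunct2,
        THEN conjunct2, THEN spec])

section \<open>Boolean combinations\<close>

lemma level_not:
  assumes "level S n P"
  shows "level S n (\<lambda>e. \<not> P e)"
proof -
  obtain A where A: "A \<in> S n" "\<forall>e. P e \<longleftrightarrow> map e [0..<n] \<in> A"
    using assms unfolding level_def by (elim bexE)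
  show ?thesis unfolding level_def by (rule bexI[OF _ compl_S[OF A(1)]]) (simp add: A(2))
qed

lemma level_or:
  assumes "level S n P" "level S n Q"
  shows "level S n (\<lambda>e. P e \<or> Q e)"
proof -
  obtain A B where AB: "A \<in> S n" "\<forall>e. P e \<longleftrightarrow> map e [0..<n] \<in> A"
      "B \<in> S n" "\<forall>e. Q e \<longleftrightarrow> map e [0..<n] \<in> B"
    using assms unfolding level_def by (elim bexE)
  show ?thesis unfolding level_def by (rule bexI[OF _ Un_S[OF AB(1,3)]]) (simp add: AB(2,4))
qed

lemma level_and: "level S n P \<Longrightarrow> level S n Q \<Longrightarrow> level S n (\<lambda>e. P e \<and> Q e)"
  using level_not[OF level_or[OF level_not level_not], of n P Q] by simp

lemma level_True: "level S n (\<lambda>e. True)"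
  using level_not[of n "\<lambda>e. False"] empty_S[of n] unfolding level_def by auto

lemma level_all_less:
  fixes k :: nat
  assumes "\<And>i. i < k \<Longrightarrow> level S n (P i)"
  shows "level S n (\<lambda>e. \<forall>i<k. P i e)"
  using assms
proof (induction k)
  case 0
  then show ?case by (simp add: level_True)
next
  case (Suc k)
  have "level S n (\<lambda>e. (\<forall>i<k. P i e) \<and> P k e)"
    by (rule level_and[OF Suc.IH Suc.prems]) (auto intro: Suc.prems)
  moreover have "(\<forall>i<Suc k. P i e) \<longleftrightarrow> (\<forall>i<k. P i e) \<and> P k e" for e
    by (auto simp: less_Suc_eq)
  ultimately show ?case by simp
qed

section \<open>Cylinders, projections and substitution of variables\<close>

lemma level_eq: "i < n \<Longrightarrow> j < n \<Longrightarrow> level S n (\<lambda>e. e i = e j)"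
  unfolding level_def by (rule bexI[of _ "{xs. length xs = n \<and> xs ! i = xs ! j}"]) (auto intro: diagonal_S)

text \<open>A cylinder over \<open>A\<close> with \<open>n\<close> free leading coordinates: each
  step of the induction puts one coordinate in front.\<close>

lemma level_prefix:
  assumes A: "A \<in> S k"
  shows "level S (n + k) (\<lambda>e. map (\<lambda>i. e (n + i)) [0..<k] \<in> A)"
proof -
  have drop_S: "{zs. length zs = n + k \<and> drop n zs \<in> A} \<in> S (n + k)"
  proof (induction n)
    case 0
    have "{zs. length zs = k \<and> zs \<in> A} = A"
      using length_S[OF A] by auto
    then show ?case using A by simp
  next
    case (Suc n)
    have "zs \<in> {zs. length zs = Suc n + k \<and> drop (Suc n) zs \<in> A}
        \<longleftrightarrow> zs \<in> {t # zs |t zs. zs \<in> {zs. length zs = n + k \<and> drop n zs \<in> A}}" for zs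
      by (cases zs) simp_all
    then have "{zs. length zs = Suc n + k \<and> drop (Suc n) zs \<in> A}
        = {t # zs |t zs. zs \<in> {zs. length zs = n + k \<and> drop n zs \<in> A}}"
      by (rule set_eqI)
    then show ?case using Cons_S[OF Suc] by simp
  qed
  have "drop n (map e [0..<n + k]) = map (\<lambda>i. e (n + i)) [0..<k]" for e :: "nat \<Rightarrow> real"
    by (rule nth_equalityI) auto
  then show ?thesis
    unfolding level_def by (intro bexI[OF _ drop_S]) simp
qed

text \<open>Existential quantification over the last \<open>k\<close> variables, one
  \<open>butlast\<close> at a time. The quantifier runs over whole valuations that agree with
  \<open>e\<close> on the first \<open>n\<close> variables, which avoids naming the quantified
  ones.\<close>

lemma level_ex: "level S (n + k) P \<Longrightarrow> level S n (\<lambda>e. \<exists>e'. (\<forall>j<n. e' j = e j) \<and> P e')"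
proof (induction k arbitrary: P)
  case 0
  then obtain A where A: "A \<in> S n" "\<And>e. P e \<longleftrightarrow> map e [0..<n] \<in> A"
    unfolding level_def by auto
  have "(\<exists>e'. (\<forall>j<n. e' j = e j) \<and> P e') \<longleftrightarrow> map e [0..<n] \<in> A" for e
  proof -
    have "map e' [0..<n] = map e [0..<n]" if "\<forall>j<n. e' j = e j" for e'
      using that by simp
    then show ?thesis unfolding A(2) by metis
  qed
  then show ?case unfolding level_def using A(1) by (intro bexI[rotated]) auto
next
  case (Suc k)
  then obtain A where A: "A \<in> S (Suc (n + k))" "\<And>e. P e \<longleftrightarrow> map e [0..<Suc (n + k)] \<in> A"
    unfolding level_def by auto
  define Q where "Q = (\<lambda>e. map e [0..<n + k] \<in> butlast ` A)"
  have "level S (n + k) Q"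
    unfolding level_def Q_def using butlast_S[OF A(1)] by (intro bexI[rotated]) auto
  note IH = Suc.IH[OF this]
  have Q: "Q e \<longleftrightarrow> (\<exists>t. P (e(n + k := t)))" for e
  proof
    assume "Q e"
    then obtain xs where xs: "xs \<in> A" "map e [0..<n + k] = butlast xs" unfolding Q_def by blast
    then have l: "length xs = Suc (n + k)" using A length_S by blast
    then have "xs = butlast xs @ [last xs]" by (metis append_butlast_last_id list.size(3) nat.distinct(1))
    then have "xs = map (e(n + k := last xs)) [0..<Suc (n + k)]"
      using xs(2) by (metis map_upd_snoc)
    then show "\<exists>t. P (e(n + k := t))" using A(2) xs(1) by metis
  next
    assume "\<exists>t. P (e(n + k := t))"
    then obtain t where "map (e(n + k := t)) [0..<Suc (n + k)] \<in> A" using A by blast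
    moreover have "butlast (map (e(n + k := t)) [0..<Suc (n + k)]) = map e [0..<n + k]"
      by (simp only: map_upd_snoc butlast_snoc)
    ultimately show "Q e" unfolding Q_def by (metis image_eqI)
  qed
  have "(\<exists>e'. (\<forall>j<n. e' j = e j) \<and> Q e') \<longleftrightarrow> (\<exists>e'. (\<forall>j<n. e' j = e j) \<and> P e')" for e
  proof
    assume "\<exists>e'. (\<forall>j<n. e' j = e j) \<and> Q e'"
    then obtain e' t where "\<forall>j<n. e' j = e j" "P (e'(n + k := t))" using Q by blast
    then show "\<exists>e'. (\<forall>j<n. e' j = e j) \<and> P e'"
      by (intro exI[of _ "e'(n + k := t)"]) auto
  next
    assume "\<exists>e'. (\<forall>j<n. e' j = e j) \<and> P e'"
    then obtain e' where e: "\<forall>j<n. e' j = e j" "P e'" by blast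
    then have "P (e'(n + k := e' (n + k)))" by simp
    then show "\<exists>e'. (\<forall>j<n. e' j = e j) \<and> Q e'" using e Q by blast
  qed
  then show ?case using IH by presburger
qed

lemma level_cong:
  assumes "level S k P" "\<And>i. i < k \<Longrightarrow> e i = e' i"
  shows "P e = P e'"
proof -
  obtain A where A: "\<forall>e. P e \<longleftrightarrow> map e [0..<k] \<in> A"
    using assms(1) unfolding level_def by (elim bexE)
  moreover have "map e [0..<k] = map e' [0..<k]"
    using assms(2) by simp
  ultimately show ?thesis by metis
qed

lemma level_shift: "level S k P \<Longrightarrow> level S (n + k) (\<lambda>e. P (\<lambda>i. e (n + i)))"
proof -
  assume "level S k P"
  then obtain A where "A \<in> S k" "\<And>e. P e \<longleftrightarrow> map e [0..<k] \<in> A" unfolding level_def by blast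
  then show ?thesis using level_prefix[of A k n] by simp
qed

text \<open>Substitution of terms: \<open>k\<close> fresh variables behind the first
  \<open>n\<close> are equated with the values \<open>g i e\<close>, \<open>P\<close> is asserted of
  them, and they are projected away. Condition \<open>cong\<close> keeps the terms independent of
  the fresh variables.\<close>

lemma level_subst_fun:
  assumes P: "level S k P"
    and g: "\<And>i. i < k \<Longrightarrow> level S (n + k) (\<lambda>e. e (n + i) = g i e)"
    and cong: "\<And>i e e'. i < k \<Longrightarrow> (\<And>j. j < n \<Longrightarrow> e j = e' j) \<Longrightarrow> g i e = g i e'"
  shows "level S n (\<lambda>e. P (\<lambda>i. g i e))"
proof -
  have "level S (n + k) (\<lambda>e. (\<forall>i<k. e (n + i) = g i e) \<and> P (\<lambda>i. e (n + i)))"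
    by (rule level_and[OF level_all_less[OF g] level_shift[OF P]])
  from level_ex[OF this]
  have *: "level S n (\<lambda>e. \<exists>e'. (\<forall>j<n. e' j = e j) \<and> (\<forall>i<k. e' (n + i) = g i e') \<and> P (\<lambda>i. e' (n + i)))" .
  have "(\<exists>e'. (\<forall>j<n. e' j = e j) \<and> (\<forall>i<k. e' (n + i) = g i e') \<and> P (\<lambda>i. e' (n + i)))
      \<longleftrightarrow> P (\<lambda>i. g i e)" for e
  proof
    assume "\<exists>e'. (\<forall>j<n. e' j = e j) \<and> (\<forall>i<k. e' (n + i) = g i e') \<and> P (\<lambda>i. e' (n + i))"
    then obtain e' where e': "\<forall>j<n. e' j = e j" "\<forall>i<k. e' (n + i) = g i e'" "P (\<lambda>i. e' (n + i))" by blast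
    have "P (\<lambda>i. e' (n + i)) = P (\<lambda>i. g i e)"
    proof (rule level_cong[OF P])
      show "e' (n + i) = g i e" if "i < k" for i
        using e'(2) cong[OF that, of e' e] e'(1) that by simp
    qed
    then show "P (\<lambda>i. g i e)" using e' by simp
  next
    assume R: "P (\<lambda>i. g i e)"
    define e' where "e' = (\<lambda>j. if j < n then e j else g (j - n) e)"
    have c: "g i e' = g i e" if "i < k" for i
      by (rule cong[OF that]) (simp add: e'_def)
    have "P (\<lambda>i. e' (n + i)) = P (\<lambda>i. g i e)"
      by (rule level_cong[OF P]) (simp add: e'_def)
    then have "(\<forall>j<n. e' j = e j) \<and> (\<forall>i<k. e' (n + i) = g i e') \<and> P (\<lambda>i. e' (n + i))"
      using R c by (simp add: e'_def)
    then show "\<exists>e'. (\<forall>j<n. e' j = e j) \<and> (\<forall>i<k. e' (n + i) = g i e') \<and> P (\<lambda>i. e' (n + i))" by blast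
  qed
  then show ?thesis using * by simp
qed

lemma level_subst:
  assumes "level S k P" "\<And>i. i < k \<Longrightarrow> \<sigma> i < n"
  shows "level S n (\<lambda>e. P (\<lambda>i. e (\<sigma> i)))"
proof (rule level_subst_fun[OF assms(1), of n "\<lambda>i e. e (\<sigma> i)"])
  show "level S (n + k) (\<lambda>e. e (n + i) = e (\<sigma> i))" if "i < k" for i
    using level_eq[of "n + i" "n + k" "\<sigma> i"] assms(2)[OF that] that by simp
qed (simp add: assms(2))

section \<open>Arithmetic relations between variables\<close>

lemma level_add: "i < n \<Longrightarrow> j < n \<Longrightarrow> l < n \<Longrightarrow> level S n (\<lambda>e. e l = e i + e j)"
proof -
  assume a: "i < n" "j < n" "l < n"
  have "level S 3 (\<lambda>e. e 2 = e 0 + e 1)"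
    unfolding level_def by (rule bexI[OF _ add_S]) (auto simp: numeral_3_eq_3 numeral_2_eq_2)
  from level_subst[OF this, of "\<lambda>q. if q = 0 then i else if q = 1 then j else l" n] a
  show ?thesis by (simp split: if_splits)
qed

lemma level_mult: "i < n \<Longrightarrow> j < n \<Longrightarrow> l < n \<Longrightarrow> level S n (\<lambda>e. e l = e i * e j)"
proof -
  assume a: "i < n" "j < n" "l < n"
  have "level S 3 (\<lambda>e. e 2 = e 0 * e 1)"
    unfolding level_def by (rule bexI[OF _ mult_S]) (auto simp: numeral_3_eq_3 numeral_2_eq_2)
  from level_subst[OF this, of "\<lambda>q. if q = 0 then i else if q = 1 then j else l" n] a
  show ?thesis by (simp split: if_splits)
qed

lemma level_const: "i < n \<Longrightarrow> level S n (\<lambda>e. e i = c)"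
proof -
  assume a: "i < n"
  have "(\<lambda>t. [t]) ` {c} \<in> S 1"
    unfolding S_1 by (intro exI[of _ "{{c}}"]) (auto simp: is_interval_1)
  then have "level S 1 (\<lambda>e. e 0 = c)"
    unfolding level_def by (rule bexI[rotated]) auto
  from level_subst[OF this, of "\<lambda>q. i" n] a show ?thesis by simp
qed

lemma level_linear: "m \<le> n \<Longrightarrow> l < n \<Longrightarrow> level S n (\<lambda>e. e l = (\<Sum>j<m. c j * e j))"
proof (induction m arbitrary: n l)
  case 0
  then show ?case using level_const by simp
next
  case (Suc m)
  \<comment> \<open>Three fresh variables: the partial sum, the coefficient \<open>c m\<close>, and
    its product with \<open>e m\<close>.\<close>
  have "level S (n + 3) (\<lambda>e. e n = (\<Sum>j<m. c j * e j) \<and> e (n + 1) = c m \<and> e (n + 2) = e (n + 1) * e m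
      \<and> e l = e n + e (n + 2))"
    by (rule level_and[OF Suc.IH level_and[OF level_const level_and[OF level_mult level_add]]])
      (use Suc.prems in auto)
  from level_ex[OF this]
  have *: "level S n (\<lambda>e. \<exists>e'. (\<forall>j<n. e' j = e j) \<and> e' n = (\<Sum>j<m. c j * e' j) \<and> e' (n + 1) = c m
      \<and> e' (n + 2) = e' (n + 1) * e' m \<and> e' l = e' n + e' (n + 2))" .
  have "(\<exists>e'. (\<forall>j<n. e' j = e j) \<and> e' n = (\<Sum>j<m. c j * e' j) \<and> e' (n + 1) = c m
      \<and> e' (n + 2) = e' (n + 1) * e' m \<and> e' l = e' n + e' (n + 2)) \<longleftrightarrow> e l = (\<Sum>j<Suc m. c j * e j)" for e
  proof
    assume "\<exists>e'. (\<forall>j<n. e' j = e j) \<and> e' n = (\<Sum>j<m. c j * e' j) \<and> e' (n + 1) = c m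
      \<and> e' (n + 2) = e' (n + 1) * e' m \<and> e' l = e' n + e' (n + 2)"
    then show "e l = (\<Sum>j<Suc m. c j * e j)" using Suc.prems by auto
  next
    assume "e l = (\<Sum>j<Suc m. c j * e j)"
    then show "\<exists>e'. (\<forall>j<n. e' j = e j) \<and> e' n = (\<Sum>j<m. c j * e' j) \<and> e' (n + 1) = c m
      \<and> e' (n + 2) = e' (n + 1) * e' m \<and> e' l = e' n + e' (n + 2)"
      using Suc.prems
      by (intro exI[of _ "\<lambda>j. if j < n then e j else if j = n then (\<Sum>j<m. c j * e j)
          else if j = n + 1 then c m else c m * e m"]) auto
  qed
  then show ?case using * by simp
qed

end

section \<open>Definable sets and functions on Euclidean spaces\<close>

text \<open>For a listing of the basis this inverts the coordinate map of
  \<open>definable_set\<close>. It turns membership in a subset of a Euclidean space into a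
  predicate on valuations.\<close>

definition vec_of :: "'a::real_vector list \<Rightarrow> (nat \<Rightarrow> real) \<Rightarrow> 'a" where
  "vec_of bs e = (\<Sum>i<length bs. e i *\<^sub>R bs ! i)"

definition basis_list :: "'a::euclidean_space list \<Rightarrow> bool" where
  "basis_list bs \<longleftrightarrow> distinct bs \<and> set bs = Basis"

lemma length_basis_list:
  fixes bs :: "'a::euclidean_space list"
  shows "basis_list bs \<Longrightarrow> length bs = DIM('a)"
  unfolding basis_list_def by (metis distinct_card)

lemma basis_list_inner:
  "basis_list bs \<Longrightarrow> i < length bs \<Longrightarrow> j < length bs \<Longrightarrow> bs ! i \<bullet> bs ! j = (if i = j then 1 else 0)"
  unfolding basis_list_def by (metis inner_Basis nth_eq_iff_index_eq nth_mem)

lemma vec_of_inner: 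
  assumes "basis_list bs" "j < length bs" 
  shows "vec_of bs e \<bullet> bs ! j = e j"
proof -
  have "vec_of bs e \<bullet> bs ! j = (\<Sum>i<length bs. e i * (bs ! i \<bullet> bs ! j))"
    by (simp add: vec_of_def inner_sum_left)
  also have "\<dots> = (\<Sum>i<length bs. if i = j then e i else 0)"
    by (rule sum.cong) (auto simp: basis_list_inner assms)
  also have "\<dots> = e j" using assms by simp
  finally show ?thesis .
qed

lemma vec_of_eqI:
  assumes "basis_list bs" "\<And>j. j < length bs \<Longrightarrow> x \<bullet> bs ! j = e j"
  shows "vec_of bs e = x"
proof (rule euclidean_eqI)
  fix b :: 'a assume "b \<in> Basis"
  then obtain j where "j < length bs" "b = bs ! j"
    using assms(1) unfolding basis_list_def by (metis in_set_conv_nth)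
  then show "vec_of bs e \<bullet> b = x \<bullet> b" using vec_of_inner assms by metis
qed

lemma vec_of_map_iff:
  assumes "basis_list bs"
  shows "vec_of bs e \<in> A \<longleftrightarrow> map e [0..<length bs] \<in> (\<lambda>x. map (\<lambda>b. x \<bullet> b) bs) ` A"
proof -
  have *: "map (\<lambda>b. vec_of bs e \<bullet> b) bs = map e [0..<length bs]" for e
    by (rule nth_equalityI) (auto simp: vec_of_inner assms)
  show ?thesis
  proof
    assume "vec_of bs e \<in> A"
    then show "map e [0..<length bs] \<in> (\<lambda>x. map (\<lambda>b. x \<bullet> b) bs) ` A"
      using * by (metis imageI)
  next
    assume "map e [0..<length bs] \<in> (\<lambda>x. map (\<lambda>b. x \<bullet> b) bs) ` A"
    then obtain x where x: "x \<in> A" "map e [0..<length bs] = map (\<lambda>b. x \<bullet> b) bs" by blast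
    have "vec_of bs e = x"
    proof (rule vec_of_eqI[OF assms])
      fix j assume "j < length bs"
      then show "x \<bullet> bs ! j = e j" using arg_cong[OF x(2), of "\<lambda>l. l ! j"] by simp
    qed
    then show "vec_of bs e \<in> A" using x by simp
  qed
qed

context o_minimal_structure
begin

abbreviation dset :: "'a::euclidean_space set \<Rightarrow> bool" where "dset \<equiv> definable_set S"

lemma level_vec_of_iff:
  fixes A :: "'a::euclidean_space set"
  assumes "basis_list bs"
  shows "level S DIM('a) (\<lambda>e. vec_of bs e \<in> A) \<longleftrightarrow> (\<lambda>x. map (\<lambda>b. x \<bullet> b) bs) ` A \<in> S DIM('a)"
proof
  assume "level S DIM('a) (\<lambda>e. vec_of bs e \<in> A)"
  then obtain B where B: "B \<in> S DIM('a)" "\<forall>e. vec_of bs e \<in> A \<longleftrightarrow> map e [0..<DIM('a)] \<in> B"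
    unfolding level_def by (elim bexE)
  have "B = (\<lambda>x. map (\<lambda>b. x \<bullet> b) bs) ` A" (is "_ = ?C")
  proof (rule set_eqI)
    fix xs
    show "xs \<in> B \<longleftrightarrow> xs \<in> ?C"
    proof (cases "length xs = DIM('a)")
      case True
      then have "xs = map (\<lambda>i. xs ! i) [0..<DIM('a)]" by (metis map_nth)
      then show ?thesis using B(2) vec_of_map_iff[OF assms, of "\<lambda>i. xs ! i" A] length_basis_list[OF assms]
        by metis
    next
      case False
      then show ?thesis using length_S[OF B(1)] length_basis_list[OF assms] by auto
    qed
  qed
  then show "?C \<in> S DIM('a)" using B(1) by simp
next
  assume "(\<lambda>x. map (\<lambda>b. x \<bullet> b) bs) ` A \<in> S DIM('a)"
  then show "level S DIM('a) (\<lambda>e. vec_of bs e \<in> A)"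
    unfolding level_def by (rule bexI[rotated]) (simp add: vec_of_map_iff[OF assms] length_basis_list[OF assms])
qed

lemma dset_level:
  "dset A \<longleftrightarrow> (\<exists>bs. basis_list bs \<and> level S DIM('a) (\<lambda>e. vec_of bs e \<in> A))" for A :: "'a::euclidean_space set"
  unfolding definable_set_def using level_vec_of_iff unfolding basis_list_def by metis

text \<open>The coordinates of \<open>f x\<close> along \<open>cs\<close> are linear forms in those
  of \<open>x\<close> along \<open>bs\<close>. The list \<open>bs\<close> is arbitrary, while
  \<open>cs\<close> is the one provided by the definability of \<open>A\<close>.\<close>

lemma level_linear_vimage:
  fixes f :: "'a::euclidean_space \<Rightarrow> 'b::euclidean_space"
  assumes "dset A" "linear f" and bs: "basis_list bs"
  shows "level S DIM('a) (\<lambda>e. f (vec_of bs e) \<in> A)"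
proof -
  obtain cs where cs: "basis_list cs" "level S DIM('b) (\<lambda>e. vec_of cs e \<in> A)"
    using assms(1) unfolding dset_level by (elim exE conjE)
  define g where "g = (\<lambda>i e. \<Sum>j<DIM('a). (f (bs ! j) \<bullet> cs ! i) * e j)"
  have "f (vec_of bs e) \<bullet> cs ! i = g i e" for e i
    by (simp add: vec_of_def linear_sum[OF assms(2)] linear_scale[OF assms(2)] inner_sum_left g_def
        length_basis_list[OF bs] mult.commute)
  then have eq: "vec_of cs (\<lambda>i. g i e) = f (vec_of bs e)" for e
    by (intro vec_of_eqI[OF cs(1)])
  have "level S DIM('a) (\<lambda>e. vec_of cs (\<lambda>i. g i e) \<in> A)"
  proof (rule level_subst_fun[OF cs(2)])
    show "level S (DIM('a) + DIM('b)) (\<lambda>e. e (DIM('a) + i) = g i e)" if "i < DIM('b)" for i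
      unfolding g_def by (rule level_linear) (use that in auto)
    show "g i e = g i e'" if "\<And>j. j < DIM('a) \<Longrightarrow> e j = e' j" for i e e'
      unfolding g_def by (rule sum.cong) (auto simp: that)
  qed
  then show ?thesis by (simp add: eq)
qed

lemma ex_basis_list: "\<exists>bs :: 'a::euclidean_space list. basis_list bs"
  unfolding basis_list_def using finite_distinct_list[OF finite_Basis] by metis

text \<open>The identity as a change of coordinates: definability along one listing of the basis
  gives it along all, so two definable sets can be combined along a common listing.\<close>

lemma level_dset: "dset A \<Longrightarrow> basis_list bs \<Longrightarrow> level S DIM('a) (\<lambda>e. vec_of bs e \<in> A)"
  for A :: "'a::euclidean_space set"
  using level_linear_vimage[of A "\<lambda>x. x" bs] by (simp add: linear_id[unfolded id_def])

lemma dset_vimage: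
  fixes f :: "'a::euclidean_space \<Rightarrow> 'b::euclidean_space"
  assumes "dset A" "linear f"
  shows "dset {x. f x \<in> A}"
proof -
  obtain bs :: "'a list" where bs: "basis_list bs" using ex_basis_list by blast
  have "level S DIM('a) (\<lambda>e. vec_of bs e \<in> {x. f x \<in> A})"
    using level_linear_vimage[OF assms bs] by simp
  with bs show ?thesis unfolding dset_level by (intro exI[of _ bs] conjI)
qed

lemma dset_not:
  fixes P :: "'a::euclidean_space \<Rightarrow> bool"
  assumes "dset {x. P x}"
  shows "dset {x. \<not> P x}"
proof -
  obtain bs :: "'a list" where bs: "basis_list bs" using ex_basis_list by blast
  have "level S DIM('a) (\<lambda>e. vec_of bs e \<in> {x. \<not> P x})"
    using level_not[OF level_dset[OF assms bs]] by simp
  with bs show ?thesis unfolding dset_level by (intro exI[of _ bs] conjI)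
qed

lemma dset_conj:
  fixes P Q :: "'a::euclidean_space \<Rightarrow> bool"
  assumes "dset {x. P x}" "dset {x. Q x}"
  shows "dset {x. P x \<and> Q x}"
proof -
  obtain bs :: "'a list" where bs: "basis_list bs" using ex_basis_list by blast
  have "level S DIM('a) (\<lambda>e. vec_of bs e \<in> {x. P x \<and> Q x})"
    using level_and[OF level_dset[OF assms(1) bs] level_dset[OF assms(2) bs]] by simp
  with bs show ?thesis unfolding dset_level by (intro exI[of _ bs] conjI)
qed

lemma dset_disj:
  fixes P Q :: "'a::euclidean_space \<Rightarrow> bool"
  assumes "dset {x. P x}" "dset {x. Q x}"
  shows "dset {x. P x \<or> Q x}"
  using dset_not[OF dset_conj[OF dset_not[OF assms(1)] dset_not[OF assms(2)]]] by simp

lemma dset_imp: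
  fixes P Q :: "'a::euclidean_space \<Rightarrow> bool"
  assumes "dset {x. P x}" "dset {x. Q x}"
  shows "dset {x. P x \<longrightarrow> Q x}"
  using dset_disj[OF dset_not[OF assms(1)] assms(2)] by simp

lemma dset_fst_image:
  fixes A :: "('a::euclidean_space \<times> 'b::euclidean_space) set"
  assumes "dset A"
  shows "dset (fst ` A)"
proof -
  obtain bs :: "'a list" and cs :: "'b list" where bs: "basis_list bs" and cs: "basis_list cs"
    using ex_basis_list by metis
  note len = length_basis_list[OF bs] length_basis_list[OF cs]
  \<comment> \<open>Listing the basis of the first factor first makes \<open>fst\<close> the
    elimination of the last \<open>DIM('b)\<close> variables.\<close>
  define ds where "ds = map (\<lambda>b. (b, 0::'b)) bs @ map (\<lambda>c. (0::'a, c)) cs"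
  have ds: "basis_list ds"
    using bs cs unfolding basis_list_def ds_def Basis_prod_def
    by (auto simp: distinct_map inj_on_def)
  have vec: "vec_of ds e = (vec_of bs e, vec_of cs (\<lambda>i. e (length bs + i)))" for e
  proof (rule vec_of_eqI[OF ds])
    fix j assume "j < length ds"
    then show "(vec_of bs e, vec_of cs (\<lambda>i. e (length bs + i))) \<bullet> ds ! j = e j"
      by (auto simp: ds_def nth_append vec_of_inner bs cs)
  qed
  have "level S (DIM('a) + DIM('b)) (\<lambda>e. vec_of ds e \<in> A)"
    using level_dset[OF assms ds] by simp
  from level_ex[OF this]
  have *: "level S DIM('a) (\<lambda>e. \<exists>e'. (\<forall>j<DIM('a). e' j = e j) \<and> vec_of ds e' \<in> A)" .
  have "(\<exists>e'. (\<forall>j<DIM('a). e' j = e j) \<and> vec_of ds e' \<in> A) \<longleftrightarrow> vec_of bs e \<in> fst ` A" for e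
  proof
    assume "\<exists>e'. (\<forall>j<DIM('a). e' j = e j) \<and> vec_of ds e' \<in> A"
    then obtain e' where e': "\<forall>j<DIM('a). e' j = e j" "vec_of ds e' \<in> A" by blast
    have "vec_of bs e' = vec_of bs e"
      unfolding vec_of_def by (rule sum.cong) (use e' len in auto)
    then show "vec_of bs e \<in> fst ` A" using e'(2) vec by (metis fst_conv imageI)
  next
    assume "vec_of bs e \<in> fst ` A"
    then obtain y where y: "(vec_of bs e, y) \<in> A" by auto
    define e' where "e' = (\<lambda>i. if i < length bs then e i else y \<bullet> cs ! (i - length bs))"
    have "vec_of bs e' = vec_of bs e"
      unfolding vec_of_def by (rule sum.cong) (auto simp: e'_def)
    moreover have "vec_of cs (\<lambda>i. e' (length bs + i)) = y"
      by (rule vec_of_eqI[OF cs]) (simp add: e'_def)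
    ultimately have "vec_of ds e' \<in> A" using y vec by simp
    then show "\<exists>e'. (\<forall>j<DIM('a). e' j = e j) \<and> vec_of ds e' \<in> A"
      by (intro exI[of _ e']) (auto simp: e'_def len)
  qed
  then have "level S DIM('a) (\<lambda>e. vec_of bs e \<in> fst ` A)" using * by simp
  with bs show ?thesis unfolding dset_level by (intro exI[of _ bs] conjI)
qed

lemma dset_ex: "dset {p. P (fst p) (snd p)} \<Longrightarrow> dset {x. \<exists>y. P x y}"
  for P :: "'a::euclidean_space \<Rightarrow> 'b::euclidean_space \<Rightarrow> bool"
proof -
  assume "dset {p. P (fst p) (snd p)}"
  moreover have "fst ` {p. P (fst p) (snd p)} = {x. \<exists>y. P x y}" by (auto simp: image_iff)
  ultimately show ?thesis using dset_fst_image by metis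
qed

lemma dset_all:
  fixes P :: "'a::euclidean_space \<Rightarrow> 'b::euclidean_space \<Rightarrow> bool"
  assumes "dset {p. P (fst p) (snd p)}"
  shows "dset {x. \<forall>y. P x y}"
  using dset_not[OF dset_ex[OF dset_not[OF assms]]] by simp

lemma dset_real: "dset A \<longleftrightarrow> (\<exists>I. finite I \<and> (\<forall>J\<in>I. is_interval J) \<and> A = \<Union>I)" for A :: "real set"
proof -
  have *: "distinct bs \<and> set bs = {1} \<longleftrightarrow> bs = [1]" for bs :: "real list"
  proof
    assume a: "distinct bs \<and> set bs = {1}"
    then have "length bs = 1" using distinct_card[of bs] by simp
    then show "bs = [1]" using a by (cases bs) auto
  qed simp
  have "dset A \<longleftrightarrow> (\<lambda>t. [t]) ` A \<in> S 1"
    unfolding definable_set_def Basis_real_def using * by (simp add: conj_assoc[symmetric])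
  then show ?thesis using S_1 by simp
qed

lemma dset_interval: "is_interval A \<Longrightarrow> dset A" for A :: "real set"
  unfolding dset_real by (rule exI[of _ "{A}"]) simp

definition dfun :: "('a::euclidean_space \<Rightarrow> real) \<Rightarrow> bool" where
  "dfun \<phi> \<longleftrightarrow> dset {p. snd p = \<phi> (fst p)}"

section \<open>A calculus of definable formulas\<close>

lemma linear_ident: "linear (\<lambda>x. x)"
  using linear_id by (simp add: id_def)

lemma linear_fst_comp: "linear f \<Longrightarrow> linear (\<lambda>x. fst (f x))"
  using linear_compose[OF _ linear_fst] by (simp add: o_def)

lemma linear_snd_comp: "linear f \<Longrightarrow> linear (\<lambda>x. snd (f x))"
  using linear_compose[OF _ linear_snd] by (simp add: o_def)

lemma linear_pair: "linear f \<Longrightarrow> linear g \<Longrightarrow> linear (\<lambda>x. (f x, g x))"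
  by (simp add: linear_iff)

lemma linear_inner_comp: "linear f \<Longrightarrow> linear (\<lambda>x. f x \<bullet> c)"
  by (simp add: linear_iff inner_add_left)

lemmas linear_rules = linear_ident linear_fst_comp linear_snd_comp linear_pair linear_compose_sub
  linear_compose_add

lemma dset_comp: "dset {x. P x} \<Longrightarrow> linear f \<Longrightarrow> dset {x. P (f x)}"
  for f :: "'a::euclidean_space \<Rightarrow> 'b::euclidean_space"
  using dset_vimage[of "{x. P x}" f] by simp

lemma dfun_comp: "dfun \<phi> \<Longrightarrow> linear L \<Longrightarrow> dfun (\<lambda>x. \<phi> (L x))"
  for L :: "'a::euclidean_space \<Rightarrow> 'b::euclidean_space"
proof -
  assume \<phi>: "dfun \<phi>" and L: "linear L"
  have "linear (\<lambda>p. (L (fst p), snd p))"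
    using L by (simp add: linear_iff)
  from dset_comp[OF \<phi>[unfolded dfun_def] this] show ?thesis unfolding dfun_def by simp
qed

text \<open>The value \<open>\<phi> x\<close> enters through an existential variable
  \<open>t\<close> with \<open>t = \<phi> x\<close>; the other argument is pulled back along a
  linear map.\<close>

lemma dset_subst:
  fixes L :: "'a::euclidean_space \<Rightarrow> 'b::euclidean_space"
  assumes "dset {p. Q (fst p) (snd p)}" "dfun \<phi>" "linear L"
  shows "dset {x. Q (\<phi> x) (L x)}"
proof -
  have "linear (\<lambda>p. (snd p, L (fst p)))"
    using assms(3) by (simp add: linear_iff)
  from dset_comp[OF assms(1) this] have "dset {p. Q (snd p) (L (fst p))}" by simp
  then have "dset {x. \<exists>t. t = \<phi> x \<and> Q t (L x)}"
    by (intro dset_ex dset_conj assms(2)[unfolded dfun_def])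
  then show ?thesis by simp
qed

lemma dset_subst2:
  assumes "dset {p. Q (fst p) (snd p)}" "dfun \<phi>" "dfun \<psi>"
  shows "dset {x. Q (\<phi> x) (\<psi> x)}"
proof -
  have "dset {p. Q (\<phi> (fst p)) (snd p)}"
    by (rule dset_subst[OF assms(1) dfun_comp[OF assms(2)]]) (intro linear_rules)+
  then have "dset {x. \<exists>t. t = \<psi> x \<and> Q (\<phi> x) t}"
    by (intro dset_ex dset_conj assms(3)[unfolded dfun_def])
  then show ?thesis by simp
qed

lemma dset_pos: "dset {t::real. 0 < t}"
  by (rule dset_interval) (auto simp: is_interval_1)

lemma dset_zero: "dset {t::real. t = 0}"
  by (rule dset_interval) (auto simp: is_interval_1)

lemma dset_less: "dfun \<phi> \<Longrightarrow> dfun \<psi> \<Longrightarrow> dset {x. \<phi> x < \<psi> x}"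
proof -
  assume *: "dfun \<phi>" "dfun \<psi>"
  have "linear (\<lambda>p::real\<times>real. snd p - fst p)" by (intro linear_rules)
  from dset_comp[OF dset_pos this] have "dset {p::real\<times>real. fst p < snd p}" by simp
  from dset_subst2[OF this *] show ?thesis .
qed

lemma dset_eq: "dfun \<phi> \<Longrightarrow> dfun \<psi> \<Longrightarrow> dset {x. \<phi> x = \<psi> x}"
proof -
  assume *: "dfun \<phi>" "dfun \<psi>"
  have "linear (\<lambda>p::real\<times>real. fst p - snd p)" by (intro linear_rules)
  from dset_comp[OF dset_zero this] have "dset {p::real\<times>real. fst p = snd p}" by simp
  from dset_subst2[OF this *] show ?thesis .
qed

lemma dset_le: "dfun \<phi> \<Longrightarrow> dfun \<psi> \<Longrightarrow> dset {x. \<phi> x \<le> \<psi> x}"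
  using dset_not[OF dset_less, of \<psi> \<phi>] by (simp add: not_less)

lemma dfun_linear: "linear \<phi> \<Longrightarrow> dfun \<phi>"
proof -
  assume "linear \<phi>"
  then have "linear (\<lambda>p. snd p - \<phi> (fst p))" by (simp add: linear_iff algebra_simps)
  from dset_comp[OF dset_zero this] show ?thesis unfolding dfun_def by simp
qed

lemma dfun_const: "dfun (\<lambda>x. c)"
proof -
  have "dset {c}" by (rule dset_interval) (auto simp: is_interval_1)
  from dset_vimage[OF this linear_snd] show ?thesis unfolding dfun_def by simp
qed

text \<open>The graph of \<open>h\<close> is stored as (first argument, (value, second argument)):
  \<open>dset_subst\<close> replaces the leading component, and an existential variable takes the
  last.\<close>

lemma dfun_subst2:
  assumes "dset {p. fst (snd p) = h (fst p) (snd (snd p))}" "dfun \<phi>" "dfun \<psi>"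
  shows "dfun (\<lambda>x. h (\<phi> x) (\<psi> x))"
proof -
  have lin: "linear (\<lambda>q::('a \<times> real) \<times> real. fst (fst q))"
    "linear (\<lambda>q::('a \<times> real) \<times> real. (snd (fst q), snd q))" "linear (\<lambda>q::('a \<times> real) \<times> real. snd q)"
    by (intro linear_rules)+
  have "dset {q::('a \<times> real) \<times> real. fst (snd (fst q), snd q) = h (\<phi> (fst (fst q))) (snd (snd (fst q), snd q))}"
    using dset_subst[OF assms(1) dfun_comp[OF assms(2) lin(1)] lin(2)] .
  moreover have "dset {q::('a \<times> real) \<times> real. snd q = \<psi> (fst (fst q))}"
    by (intro dset_eq dfun_comp[OF assms(3) lin(1)] dfun_linear[OF lin(3)])
  ultimately have "dset {p. \<exists>s. s = \<psi> (fst p) \<and> snd p = h (\<phi> (fst p)) s}"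
    by (intro dset_ex dset_conj) simp_all
  then show ?thesis unfolding dfun_def by simp
qed

lemma dfun_add: "dfun \<phi> \<Longrightarrow> dfun \<psi> \<Longrightarrow> dfun (\<lambda>x. \<phi> x + \<psi> x)"
proof (rule dfun_subst2[where h = "(+)"])
  have "linear (\<lambda>p::real\<times>real\<times>real. fst (snd p) - (fst p + snd (snd p)))" by (intro linear_rules)
  from dset_comp[OF dset_zero this] show "dset {p::real\<times>real\<times>real. fst (snd p) = fst p + snd (snd p)}"
    by simp
qed

lemma dfun_diff: "dfun \<phi> \<Longrightarrow> dfun \<psi> \<Longrightarrow> dfun (\<lambda>x. \<phi> x - \<psi> x)"
proof (rule dfun_subst2[where h = "(-)"])
  have "linear (\<lambda>p::real\<times>real\<times>real. fst (snd p) - (fst p - snd (snd p)))" by (intro linear_rules)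
  from dset_comp[OF dset_zero this] show "dset {p::real\<times>real\<times>real. fst (snd p) = fst p - snd (snd p)}"
    by simp
qed

lemma dset_mult: "dset {p::real\<times>real\<times>real. fst (snd p) = fst p * snd (snd p)}"
proof -
  \<comment> \<open>Listed as first argument, second argument, value, to match the coordinate order
    of the multiplication axiom.\<close>
  define bs where "bs = [(1,0,0), (0,0,1), (0,1,0::real) :: real \<times> real \<times> real]"
  have "(\<lambda>x. map ((\<bullet>) x) bs) ` {p::real\<times>real\<times>real. fst (snd p) = fst p * snd (snd p)}
      = {[x, y, x * y] |x y. True}"
    by (auto simp: bs_def image_iff)
  moreover have "DIM(real \<times> real \<times> real) = 3" by simp
  moreover have "distinct bs" "set bs = Basis" by (auto simp: bs_def Basis_prod_def zero_prod_def)
  ultimately show ?thesis unfolding definable_set_def using mult_S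
    by (intro exI[of _ bs]) (simp only: simp_thms)
qed

lemma dfun_mult: "dfun \<phi> \<Longrightarrow> dfun \<psi> \<Longrightarrow> dfun (\<lambda>x. \<phi> x * \<psi> x)"
  by (rule dfun_subst2[where h = "(*)", OF dset_mult])

lemma dfun_sum: "(\<And>i. i \<in> I \<Longrightarrow> dfun (\<phi> i)) \<Longrightarrow> dfun (\<lambda>x. \<Sum>i\<in>I. \<phi> i x)"
  by (induction I rule: infinite_finite_induct) (simp_all add: dfun_const dfun_add)

lemma dfun_norm:
  fixes L :: "'a::euclidean_space \<Rightarrow> 'b::euclidean_space"
  assumes "linear L"
  shows "dfun (\<lambda>x. norm (L x))"
proof -
  have lin: "linear (\<lambda>p. L (fst p) \<bullet> b)" for b :: 'b
    by (intro linear_inner_comp linear_compose[OF linear_fst assms, unfolded o_def])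
  have "dset {p. 0 \<le> snd p \<and> snd p * snd p = (\<Sum>b\<in>Basis. (L (fst p) \<bullet> b) * (L (fst p) \<bullet> b))}"
    by (intro dset_conj dset_le dset_eq dfun_const dfun_mult dfun_sum dfun_linear[OF linear_snd]
        dfun_linear[OF lin])
  moreover have "snd p = norm (L (fst p)) \<longleftrightarrow>
      0 \<le> snd p \<and> snd p * snd p = (\<Sum>b\<in>Basis. (L (fst p) \<bullet> b) * (L (fst p) \<bullet> b))" for p :: "'a \<times> real"
  proof -
    have "(\<Sum>b\<in>Basis. (L (fst p) \<bullet> b) * (L (fst p) \<bullet> b)) = (norm (L (fst p)))\<^sup>2"
      unfolding euclidean_inner[symmetric] by (rule dot_square_norm)
    then show ?thesis
      using power2_eq_iff_nonneg[of "snd p" "norm (L (fst p))"] by (auto simp: power2_eq_square)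
  qed
  ultimately show ?thesis unfolding dfun_def by simp
qed

text \<open>Definability by recursion on a first-order formula. Bound variables are components of
  nested pairs, hence linear functions of the point; \<open>dfun_var\<close> and
  \<open>linear_rules\<close> supply those.\<close>

lemmas dset_rules = dset_ex dset_all dset_conj dset_disj dset_imp dset_not dset_less dset_le dset_eq
  dfun_const dfun_add dfun_diff dfun_mult dfun_norm

lemma dfun_fst: "linear L \<Longrightarrow> dfun (\<lambda>p. fst (L p))"
  by (intro dfun_linear linear_fst_comp)

lemma dfun_snd: "linear L \<Longrightarrow> dfun (\<lambda>p. snd (L p))"
  by (intro dfun_linear linear_snd_comp)

lemma dfun_ident: "dfun (\<lambda>t. t)"
  by (intro dfun_linear linear_ident)

lemmas dfun_var = dfun_fst dfun_snd dfun_ident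

text \<open>An interval with points arbitrarily close to \<open>a\<close> on the right contains
  everything between \<open>a\<close> and any of its points beyond \<open>a\<close>; otherwise it
  misses a right neighbourhood. A finite union inherits the alternative.\<close>

lemma eventually_dichotomy:
  fixes A :: "real set"
  assumes "dset A"
  shows "(\<forall>\<^sub>F t in at_right a. t \<in> A) \<or> (\<forall>\<^sub>F t in at_right a. t \<notin> A)"
proof -
  obtain I where I: "finite I" "\<And>J. J \<in> I \<Longrightarrow> is_interval J" "A = \<Union>I"
    using assms unfolding dset_real by blast
  have J: "(\<forall>\<^sub>F t in at_right a. t \<in> J) \<or> (\<forall>\<^sub>F t in at_right a. t \<notin> J)" if "is_interval J" for J
  proof (cases "\<exists>p>a. p \<in> J \<and> (\<forall>q>a. \<exists>r>a. r < q \<and> r \<in> J)")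
    case True
    then obtain p where p: "a < p" "p \<in> J" "\<And>q. q > a \<Longrightarrow> \<exists>r>a. r < q \<and> r \<in> J" by blast
    have "t \<in> J" if t: "a < t" "t < p" for t
    proof -
      obtain r where "a < r" "r < t" "r \<in> J" using p(3)[OF t(1)] by blast
      then show ?thesis using \<open>is_interval J\<close> p t unfolding is_interval_1 by (meson less_imp_le)
    qed
    then show ?thesis unfolding eventually_at_right_field using p(1) by blast
  next
    case False
    then have "\<exists>q>a. \<forall>r>a. r < q \<longrightarrow> r \<notin> J"
      by (meson gt_ex)
    then show ?thesis unfolding eventually_at_right_field by blast
  qed
  show ?thesis
  proof (cases "\<exists>J\<in>I. \<forall>\<^sub>F t in at_right a. t \<in> J")
    case True
    then obtain J where "J \<in> I" "\<forall>\<^sub>F t in at_right a. t \<in> J" by blast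
    then have "\<forall>\<^sub>F t in at_right a. t \<in> A" by (elim eventually_mono) (use I in auto)
    then show ?thesis ..
  next
    case False
    then have "\<forall>J\<in>I. \<forall>\<^sub>F t in at_right a. t \<notin> J" using J[OF I(2)] by auto
    then have "\<forall>\<^sub>F t in at_right a. \<forall>J\<in>I. t \<notin> J" by (rule eventually_ball_finite[OF I(1)])
    then show ?thesis using I(3) by simp
  qed
qed

lemma eventually_dichotomy_left:
  fixes A :: "real set"
  assumes "dset A"
  shows "(\<forall>\<^sub>F t in at_left a. t \<in> A) \<or> (\<forall>\<^sub>F t in at_left a. t \<notin> A)"
proof -
  have "dset {t. - t \<in> A}"
    by (rule dset_vimage[OF assms]) (simp add: linear_iff)
  from eventually_dichotomy[OF this, of "- a"] show ?thesis
    unfolding at_left_minus[of a] by (simp add: eventually_filtermap)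
qed

end

text \<open>A strict local minimum is isolated by an interval with rational ends on which it is the
  strict minimum. Two points sharing an interval would each have the smaller value, so the choice of
  intervals is injective.\<close>

lemma countable_strict_local_min:
  fixes \<phi> :: "real \<Rightarrow> real"
  shows "countable {t. \<exists>\<delta>>0. \<forall>s. s \<noteq> t \<and> \<bar>s - t\<bar> < \<delta> \<longrightarrow> \<phi> t < \<phi> s}" (is "countable ?M")
proof -
  define isolates where "isolates = (\<lambda>t (w :: real \<times> real). w \<in> \<rat> \<times> \<rat> \<and> fst w < t \<and> t < snd w
      \<and> (\<forall>s. s \<noteq> t \<and> fst w < s \<and> s < snd w \<longrightarrow> \<phi> t < \<phi> s))"
  have "\<exists>w. isolates t w" if t: "t \<in> ?M" for t
  proof -
    from t obtain \<delta> where "\<delta> > 0 \<and> (\<forall>s. s \<noteq> t \<and> \<bar>s - t\<bar> < \<delta> \<longrightarrow> \<phi> t < \<phi> s)"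
      unfolding mem_Collect_eq by (elim exE)
    then have d: "\<delta> > 0" "\<And>s. s \<noteq> t \<Longrightarrow> \<bar>s - t\<bar> < \<delta> \<Longrightarrow> \<phi> t < \<phi> s" by simp_all
    obtain p where p: "p \<in> \<rat>" "t - \<delta> < p" "p < t" using Rats_dense_in_real[of "t - \<delta>" t] d by auto
    obtain q where q: "q \<in> \<rat>" "t < q" "q < t + \<delta>" using Rats_dense_in_real[of t "t + \<delta>"] d by auto
    have "\<phi> t < \<phi> s" if "s \<noteq> t" "p < s" "s < q" for s
      by (rule d(2)) (use that p q in linarith)+
    then have "isolates t (p, q)" unfolding isolates_def using p q by simp
    then show ?thesis ..
  qed
  then have "\<forall>t\<in>?M. \<exists>w. isolates t w" by blast
  from bchoice[OF this] obtain w where w: "\<And>t. t \<in> ?M \<Longrightarrow> isolates t (w t)" by blast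
  have inj: "inj_on w ?M"
  proof (rule inj_onI, rule ccontr)
    fix t s assume ts: "t \<in> ?M" "s \<in> ?M" "w t = w s" "t \<noteq> s"
    note iso = w[OF ts(1), unfolded isolates_def] w[OF ts(2), folded ts(3), unfolded isolates_def]
    have "\<phi> t < \<phi> s" "\<phi> s < \<phi> t" using iso ts(4) by metis+
    then show False by simp
  qed
  have rat: "w ` ?M \<subseteq> \<rat> \<times> \<rat>"
  proof (rule image_subsetI)
    show "w t \<in> \<rat> \<times> \<rat>" if "t \<in> ?M" for t
      using w[OF that] unfolding isolates_def by (elim conjE)
  qed
  have "countable (\<rat> \<times> \<rat> :: (real \<times> real) set)" using countable_rat by (intro countable_SIGMA)
  from countable_image_inj_on[OF countable_subset[OF rat this] inj] show ?thesis .
qed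

section \<open>Monotonicity and definable choice\<close>

text \<open>Near \<open>t\<close>, values on the two sides are compared through
  \<open>\<phi> t\<close>; Bolzano's bisection glues these local comparisons. Jumps of
  \<open>\<phi>\<close> are harmless.\<close>

lemma mono_of_local:
  fixes \<phi> :: "real \<Rightarrow> real"
  assumes right: "\<And>t. a \<le> t \<Longrightarrow> t \<le> b \<Longrightarrow> \<forall>\<^sub>F s in at_right t. \<phi> t \<le> \<phi> s"
    and left: "\<And>t. a \<le> t \<Longrightarrow> t \<le> b \<Longrightarrow> \<forall>\<^sub>F s in at_left t. \<phi> s \<le> \<phi> t"
    and "a \<le> b"
  shows "\<phi> a \<le> \<phi> b"
  using \<open>a \<le> b\<close>
proof (induction rule: Bolzano)
  case (trans a b c)
  then show ?case by simp
next
  case (local t)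
  obtain p where p: "p > t" "\<And>s. t < s \<Longrightarrow> s < p \<Longrightarrow> \<phi> t \<le> \<phi> s"
    using right[OF local] unfolding eventually_at_right_field by blast
  obtain q where q: "q < t" "\<And>s. q < s \<Longrightarrow> s < t \<Longrightarrow> \<phi> s \<le> \<phi> t"
    using left[OF local] unfolding eventually_at_left_field by blast
  have "\<phi> u \<le> \<phi> v" if "u \<le> t" "t \<le> v" "v - u < min (p - t) (t - q)" for u v
  proof -
    have "\<phi> u \<le> \<phi> t" using q(2)[of u] that by (cases "u = t") auto
    also have "\<phi> t \<le> \<phi> v" using p(2)[of v] that by (cases "v = t") auto
    finally show ?thesis .
  qed
  then show ?case using p(1) q(1) by (intro exI[of _ "min (p - t) (t - q)"]) auto
qed

context o_minimal_structure
begin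

section \<open>One-sided behaviour of a definable function\<close>

lemma trichotomy_right:
  fixes \<phi> :: "real \<Rightarrow> real"
  assumes "dfun \<phi>"
  shows "(\<forall>\<^sub>F s in at_right t. \<phi> t < \<phi> s) \<or> (\<forall>\<^sub>F s in at_right t. \<phi> s = \<phi> t) \<or> (\<forall>\<^sub>F s in at_right t. \<phi> s < \<phi> t)"
proof -
  have "dset {s. \<phi> t < \<phi> s}" "dset {s. \<phi> s < \<phi> t}"
    by (intro dset_less dfun_const assms)+
  from this[THEN eventually_dichotomy, of t] show ?thesis
    by (auto elim: eventually_elim2)
qed

lemma trichotomy_left:
  fixes \<phi> :: "real \<Rightarrow> real"
  assumes "dfun \<phi>"
  shows "(\<forall>\<^sub>F s in at_left t. \<phi> t < \<phi> s) \<or> (\<forall>\<^sub>F s in at_left t. \<phi> s = \<phi> t) \<or> (\<forall>\<^sub>F s in at_left t. \<phi> s < \<phi> t)"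
proof -
  have "dset {s. \<phi> t < \<phi> s}" "dset {s. \<phi> s < \<phi> t}"
    by (intro dset_less dfun_const assms)+
  from this[THEN eventually_dichotomy_left, of t] show ?thesis
    by (auto elim: eventually_elim2)
qed

lemma dset_eventually_right:
  fixes Q :: "real \<Rightarrow> real \<Rightarrow> bool"
  assumes "dset {p. Q (fst p) (snd p)}"
  shows "dset {t. \<forall>\<^sub>F s in at_right t. Q t s}"
proof -
  have "dset {q :: (real \<times> real) \<times> real. Q (fst (fst q)) (snd q)}"
    using dset_comp[OF assms, of "\<lambda>q::(real \<times> real) \<times> real. (fst (fst q), snd q)"]
    by (simp add: linear_iff)
  then have "dset {t. \<exists>p. t < p \<and> (\<forall>s. t < s \<and> s < p \<longrightarrow> Q t s)}"
    by (intro dset_rules dfun_var linear_rules)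
  then show ?thesis unfolding eventually_at_right_field by (simp add: conj_commute imp_conjL)
qed

lemma dset_eventually_left:
  fixes Q :: "real \<Rightarrow> real \<Rightarrow> bool"
  assumes "dset {p. Q (fst p) (snd p)}"
  shows "dset {t. \<forall>\<^sub>F s in at_left t. Q t s}"
proof -
  have "dset {q :: (real \<times> real) \<times> real. Q (fst (fst q)) (snd q)}"
    using dset_comp[OF assms, of "\<lambda>q::(real \<times> real) \<times> real. (fst (fst q), snd q)"]
    by (simp add: linear_iff)
  then have "dset {t. \<exists>p. p < t \<and> (\<forall>s. p < s \<and> s < t \<longrightarrow> Q t s)}"
    by (intro dset_rules dfun_var linear_rules)
  then show ?thesis unfolding eventually_at_left_field by (simp add: conj_commute imp_conjL)
qed

lemma not_eventually_strict_local_min: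
  assumes "\<forall>\<^sub>F t in at_right (0::real). \<forall>\<^sub>F s in at_right t. \<phi> t < (\<phi> s :: real)"
    and "\<forall>\<^sub>F t in at_right 0. \<forall>\<^sub>F s in at_left t. \<phi> t < \<phi> s"
  shows False
proof -
  obtain e where e: "e > 0" "\<And>t. 0 < t \<Longrightarrow> t < e \<Longrightarrow>
      (\<forall>\<^sub>F s in at_right t. \<phi> t < \<phi> s) \<and> (\<forall>\<^sub>F s in at_left t. \<phi> t < \<phi> s)"
    using eventually_conj[OF assms] unfolding eventually_at_right_field by blast
  have "{0<..<e} \<subseteq> {t. \<exists>\<delta>>0. \<forall>s. s \<noteq> t \<and> \<bar>s - t\<bar> < \<delta> \<longrightarrow> \<phi> t < \<phi> s}"
  proof
    fix t assume "t \<in> {0<..<e}"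
    then have t: "\<forall>\<^sub>F s in at_right t. \<phi> t < \<phi> s" "\<forall>\<^sub>F s in at_left t. \<phi> t < \<phi> s" using e(2) by auto
    obtain p where p: "p > t" "\<And>s. t < s \<Longrightarrow> s < p \<Longrightarrow> \<phi> t < \<phi> s"
      using t(1) unfolding eventually_at_right_field by blast
    obtain q where q: "q < t" "\<And>s. q < s \<Longrightarrow> s < t \<Longrightarrow> \<phi> t < \<phi> s"
      using t(2) unfolding eventually_at_left_field by blast
    have "\<phi> t < \<phi> s" if "s \<noteq> t" "\<bar>s - t\<bar> < min (p - t) (t - q)" for s
      using p(2)[of s] q(2)[of s] that by (cases "s < t") auto
    then show "t \<in> {t. \<exists>\<delta>>0. \<forall>s. s \<noteq> t \<and> \<bar>s - t\<bar> < \<delta> \<longrightarrow> \<phi> t < \<phi> s}"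
      using p(1) q(1) by (intro CollectI exI[of _ "min (p - t) (t - q)"]) auto
  qed
  then have "countable {0<..<e}" using countable_strict_local_min countable_subset by blast
  then show False using uncountable_open_interval[of 0 e] e(1) by simp
qed

text \<open>On each side of \<open>t\<close> the function is above, equal to or below
  \<open>\<phi> t\<close>, and by the dichotomy the same alternative holds for all small
  \<open>t\<close>. Of the nine combinations, above-above and below-below would make every point of
  an interval a strict local extremum, against countability; each of the other seven gives weak
  monotonicity through \<open>t\<close>.\<close>

lemma eventually_monotone:
  fixes \<phi> :: "real \<Rightarrow> real"
  assumes \<phi>: "dfun \<phi>"
  obtains e where "e > 0" "\<And>s t. 0 < s \<Longrightarrow> s \<le> t \<Longrightarrow> t < e \<Longrightarrow> \<phi> s \<le> \<phi> t"
    | e where "e > 0" "\<And>s t. 0 < s \<Longrightarrow> s \<le> t \<Longrightarrow> t < e \<Longrightarrow> \<phi> t \<le> \<phi> s"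
proof -
  note increasing = that(1) and decreasing = that(2)
  have \<phi>': "dfun (\<lambda>p. \<phi> (fst p))" "dfun (\<lambda>p. \<phi> (snd p))"
    by (rule dfun_comp[OF \<phi>], intro linear_rules)+
  have d: "dset {p. \<phi> (fst p) < \<phi> (snd p)}" "dset {p. \<phi> (snd p) = \<phi> (fst p)}" "dset {p. \<phi> (snd p) < \<phi> (fst p)}"
    by (intro dset_less dset_eq \<phi>')+
  have right: "(\<forall>\<^sub>F t in at_right 0. \<forall>\<^sub>F s in at_right t. \<phi> t < \<phi> s) \<or>
     (\<forall>\<^sub>F t in at_right 0. \<forall>\<^sub>F s in at_right t. \<phi> s = \<phi> t) \<or>
     (\<forall>\<^sub>F t in at_right 0. \<forall>\<^sub>F s in at_right t. \<phi> s < \<phi> t)" (is "?rl \<or> ?re \<or> ?rg")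
    using d[THEN dset_eventually_right, THEN eventually_dichotomy, of 0] trichotomy_right[OF \<phi>]
    by (smt (verit) eventually_elim2 eventually_happens mem_Collect_eq trivial_limit_at_right_real)
  have left: "(\<forall>\<^sub>F t in at_right 0. \<forall>\<^sub>F s in at_left t. \<phi> t < \<phi> s) \<or>
     (\<forall>\<^sub>F t in at_right 0. \<forall>\<^sub>F s in at_left t. \<phi> s = \<phi> t) \<or>
     (\<forall>\<^sub>F t in at_right 0. \<forall>\<^sub>F s in at_left t. \<phi> s < \<phi> t)" (is "?ll \<or> ?le \<or> ?lg")
    using d[THEN dset_eventually_left, THEN eventually_dichotomy, of 0] trichotomy_left[OF \<phi>]
    by (smt (verit) eventually_elim2 eventually_happens mem_Collect_eq trivial_limit_at_right_real)
  have weak_r: "\<forall>\<^sub>F t in at_right 0. \<forall>\<^sub>F s in at_right t. \<phi> t \<le> \<phi> s" if "?rl \<or> ?re"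
    using that by (elim disjE) (auto elim!: eventually_mono)
  have weak_l: "\<forall>\<^sub>F t in at_right 0. \<forall>\<^sub>F s in at_left t. \<phi> s \<le> \<phi> t" if "?le \<or> ?lg"
    using that by (elim disjE) (auto elim!: eventually_mono)
  have weak_r': "\<forall>\<^sub>F t in at_right 0. \<forall>\<^sub>F s in at_right t. \<phi> s \<le> \<phi> t" if "?re \<or> ?rg"
    using that by (elim disjE) (auto elim!: eventually_mono)
  have weak_l': "\<forall>\<^sub>F t in at_right 0. \<forall>\<^sub>F s in at_left t. \<phi> t \<le> \<phi> s" if "?ll \<or> ?le"
    using that by (elim disjE) (auto elim!: eventually_mono)
  have inc: thesis if r: "?rl \<or> ?re" and l: "?le \<or> ?lg"
  proof -
    obtain e where e: "e > 0" "\<And>t. 0 < t \<Longrightarrow> t < e \<Longrightarrow>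
        (\<forall>\<^sub>F s in at_right t. \<phi> t \<le> \<phi> s) \<and> (\<forall>\<^sub>F s in at_left t. \<phi> s \<le> \<phi> t)"
      using eventually_conj[OF weak_r[OF r] weak_l[OF l]] unfolding eventually_at_right_field by blast
    show thesis by (rule increasing[OF e(1)], rule mono_of_local) (use e(2) in auto)
  qed
  have dec: thesis if r: "?re \<or> ?rg" and l: "?ll \<or> ?le"
  proof -
    obtain e where e: "e > 0" "\<And>t. 0 < t \<Longrightarrow> t < e \<Longrightarrow>
        (\<forall>\<^sub>F s in at_right t. \<phi> s \<le> \<phi> t) \<and> (\<forall>\<^sub>F s in at_left t. \<phi> t \<le> \<phi> s)"
      using eventually_conj[OF weak_r'[OF r] weak_l'[OF l]] unfolding eventually_at_right_field by blast
    have "- \<phi> s \<le> - \<phi> t" if "0 < s" "s \<le> t" "t < e" for s t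
      by (rule mono_of_local[of s t "\<lambda>t. - \<phi> t"]) (use e(2) that in auto)
    then show thesis using decreasing[OF e(1)] by simp
  qed
  have no_min: False if "?rl" "?ll" using not_eventually_strict_local_min that by blast
  have no_max: False if "?rg" "?lg"
    using not_eventually_strict_local_min[of "\<lambda>t. - \<phi> t"] that by simp
  show thesis using right left inc dec no_min no_max by blast
qed

text \<open>The selected point is the least element of \<open>A\<close> if there is one, and otherwise the midpoint of the leftmost
  open interval of \<open>A\<close>.\<close>

definition selects :: "real set \<Rightarrow> real \<Rightarrow> bool" where
  "selects A r \<longleftrightarrow>
    (\<exists>a. (\<forall>y. y \<in> A \<longrightarrow> a \<le> y) \<and> (\<forall>c. a < c \<longrightarrow> (\<exists>y. y \<in> A \<and> y < c)) \<and>
      (a \<in> A \<and> r = a \<or>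
       a \<notin> A \<and> (\<exists>b. a < b \<and> (\<forall>y. a < y \<and> y < b \<longrightarrow> y \<in> A) \<and>
          (\<forall>c. b < c \<longrightarrow> (\<exists>y. a < y \<and> y < c \<and> y \<notin> A)) \<and> r + r = a + b)))
    \<or> \<not> (\<exists>y. y \<in> A) \<and> r = 0"

lemma selects_unique:
  assumes "selects A r" "selects A r'"
  shows "r = r'"
proof (cases "A = {}")
  case True
  then show ?thesis using assms gt_ex unfolding selects_def by blast
next
  case False
  define lower where "lower = (\<lambda>a. (\<forall>y. y \<in> A \<longrightarrow> a \<le> y) \<and> (\<forall>c. a < c \<longrightarrow> (\<exists>y. y \<in> A \<and> y < c)))"
  define right where "right = (\<lambda>a b. a < b \<and> (\<forall>y. a < y \<and> y < b \<longrightarrow> y \<in> A) \<and>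
          (\<forall>c. b < c \<longrightarrow> (\<exists>y. a < y \<and> y < c \<and> y \<notin> A)))"
  obtain a where a: "lower a" "a \<in> A \<and> r = a \<or> a \<notin> A \<and> (\<exists>b. right a b \<and> r + r = a + b)"
    using assms(1) False unfolding selects_def lower_def right_def by auto
  obtain a' where a': "lower a'" "a' \<in> A \<and> r' = a' \<or> a' \<notin> A \<and> (\<exists>b. right a' b \<and> r' + r' = a' + b)"
    using assms(2) False unfolding selects_def lower_def right_def by auto
  have "\<not> u < v" if "lower u" "lower v" for u v
    using that unfolding lower_def by (meson not_le)
  then have "a = a'" using a a' by (meson linorder_neqE_linordered_idom)
  moreover have "\<not> b < b'" if "right a b" "right a b'" for b b'
    using that unfolding right_def by blast
  then have "b = b'" if "right a b" "right a b'" for b b'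
    using that by (meson linorder_neqE_linordered_idom)
  ultimately have "r = a \<and> r' = a \<or> (\<exists>b. r + r = a + b \<and> r' + r' = a + b)"
    using a(2) a'(2) by metis
  then show ?thesis by auto
qed

text \<open>Boundedness makes the infimum \<open>a\<close> and the right end of the leftmost
  interval finite. If \<open>a\<close> is not attained, points of \<open>A\<close> accumulate at it
  from the right, and the dichotomy provides the interval.\<close>

lemma ex_selects:
  assumes A: "dset A" and R: "\<And>y. y \<in> A \<Longrightarrow> \<bar>y\<bar> \<le> R"
  shows "\<exists>r. selects A r \<and> (A \<noteq> {} \<longrightarrow> r \<in> A)"
proof (cases "A = {}")
  case True
  then show ?thesis unfolding selects_def by auto
next
  case False
  have bdd: "bdd_below A" using R by (intro bdd_belowI[of _ "- R"]) fastforce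
  define a where "a = Inf A"
  have a: "(\<forall>y. y \<in> A \<longrightarrow> a \<le> y)" "(\<forall>c. a < c \<longrightarrow> (\<exists>y. y \<in> A \<and> y < c))"
    using cInf_lower[OF _ bdd] cInf_less_iff[OF False bdd] unfolding a_def by auto
  show ?thesis
  proof (cases "a \<in> A")
    case True
    then show ?thesis using a unfolding selects_def by blast
  next
    case aA: False
    \<comment> \<open>Right ends of open intervals in \<open>A\<close> that start at
      \<open>a\<close>; the supremum is the \<open>b\<close> of \<open>selects\<close>.\<close>
    define B where "B = {b. a < b \<and> (\<forall>y. a < y \<and> y < b \<longrightarrow> y \<in> A)}"
    have "\<not> (\<forall>\<^sub>F t in at_right a. t \<notin> A)"
    proof
      assume "\<forall>\<^sub>F t in at_right a. t \<notin> A"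
      then obtain c where "a < c" "\<And>t. a < t \<Longrightarrow> t < c \<Longrightarrow> t \<notin> A"
        unfolding eventually_at_right_field by blast
      then show False using a aA by (metis order_le_less)
    qed
    then have "\<forall>\<^sub>F t in at_right a. t \<in> A" using eventually_dichotomy[OF A, of a] by blast
    then obtain b0 where b0: "b0 \<in> B"
      unfolding eventually_at_right_field B_def by blast
    have bB: "b \<le> R + 1" if "b \<in> B" for b
    proof (rule ccontr)
      assume "\<not> b \<le> R + 1"
      moreover have "a < b" using that unfolding B_def by simp
      ultimately have "max a (R + 1) < b" by simp
      then obtain y where "max a (R + 1) < y" "y < b" using dense by blast
      then have "y \<in> A" "R < y" using that unfolding B_def by auto
      then show False using R[of y] by simp
    qed
    then have bddB: "bdd_above B" by (rule bdd_aboveI)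
    define b where "b = Sup B"
    have "b0 \<le> b" unfolding b_def by (rule cSup_upper[OF b0 bddB])
    then have ab: "a < b" using b0 unfolding B_def by simp
    have inA: "y \<in> A" if y: "a < y" "y < b" for y
    proof -
      obtain b' where "b' \<in> B" "y < b'" using y(2) less_cSup_iff[OF _ bddB] b0 unfolding b_def by blast
      then show ?thesis using y unfolding B_def by blast
    qed
    have "\<exists>y. a < y \<and> y < c \<and> y \<notin> A" if "b < c" for c
    proof (rule ccontr)
      assume "\<nexists>y. a < y \<and> y < c \<and> y \<notin> A"
      then have "c \<in> B" using ab that unfolding B_def by auto
      then show False using cSup_upper[OF _ bddB, of c] that unfolding b_def by simp
    qed
    then have "selects A ((a + b) / 2)"
      unfolding selects_def
      by (intro disjI1 exI[of _ a] conjI a disjI2 exI[of _ b]) (use aA ab inA in auto)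
    moreover have "(a + b) / 2 \<in> A" by (rule inA) (use ab in auto)
    ultimately show ?thesis by blast
  qed
qed

text \<open>\<open>selects\<close> is first-order in the fibre and determines the selected point, so
  the graph of the choice function is definable.\<close>

lemma definable_choice:
  assumes G: "dset G" and R: "\<And>t y. (t, y) \<in> G \<Longrightarrow> \<bar>y\<bar> \<le> R"
  obtains \<phi> :: "real \<Rightarrow> real" where "dfun \<phi>" "\<And>t y. (t, y) \<in> G \<Longrightarrow> (t, \<phi> t) \<in> G"
proof -
  have G': "dset {p. (L p, M p) \<in> G}" if "linear L" "linear M" for L M :: "'b::euclidean_space \<Rightarrow> real"
    using dset_vimage[OF G linear_pair[OF that]] .
  have fib: "dset {y. (t, y) \<in> G}" for t
  proof -
    have "dset {p. (fst p, snd p) \<in> G}" by (intro G' linear_rules)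
    from dset_subst[of "\<lambda>t y. (t, y) \<in> G", OF this dfun_const linear_ident]
    show ?thesis .
  qed
  have ex: "\<exists>r. selects {y. (t, y) \<in> G} r \<and> ({y. (t, y) \<in> G} \<noteq> {} \<longrightarrow> r \<in> {y. (t, y) \<in> G})" for t
    by (rule ex_selects[OF fib]) (use R in auto)
  then obtain \<phi> where \<phi>: "\<And>t. selects {y. (t, y) \<in> G} (\<phi> t)"
      "\<And>t. {y. (t, y) \<in> G} \<noteq> {} \<Longrightarrow> \<phi> t \<in> {y. (t, y) \<in> G}"
    by metis
  have "snd p = \<phi> (fst p) \<longleftrightarrow> selects {y. (fst p, y) \<in> G} (snd p)" for p
    using selects_unique[OF \<phi>(1)] \<phi>(1) by metis
  moreover have "dset {p. selects {y. (fst p, y) \<in> G} (snd p)}"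
    unfolding selects_def mem_Collect_eq
    by (intro dset_rules G' linear_rules dfun_var)
  ultimately have "dfun \<phi>" unfolding dfun_def by simp
  then show thesis using that \<phi>(2) by blast
qed

text \<open>One coordinate at a time: \<open>definable_choice\<close> picks a value of the current
  coordinate in every nonempty fibre, and the set is cut down to it without losing a fibre. After
  all basis vectors each nonempty fibre is a single point.\<close>

lemma curve_selection:
  fixes A :: "(real \<times> 'a::euclidean_space) set"
  assumes A: "dset A" and R: "\<And>t y. (t, y) \<in> A \<Longrightarrow> norm y \<le> R"
  obtains z :: "real \<Rightarrow> 'a" where "\<And>b. b \<in> Basis \<Longrightarrow> dfun (\<lambda>t. z t \<bullet> b)"
    "\<And>t y. (t, y) \<in> A \<Longrightarrow> (t, z t) \<in> A"
proof -
  have "\<exists>A' w. dset A' \<and> A' \<subseteq> A \<and> fst ` A \<subseteq> fst ` A' \<and>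
      (\<forall>b\<in>B. dfun (w b) \<and> (\<forall>t y. (t, y) \<in> A' \<longrightarrow> y \<bullet> b = w b t))"
    if "finite B" "B \<subseteq> Basis" for B :: "'a set"
    using that
  proof (induction B rule: finite_induct)
    case empty
    then show ?case using A by blast
  next
    case (insert c B)
    then obtain A' and w :: "'a \<Rightarrow> real \<Rightarrow> real" where "dset A' \<and> A' \<subseteq> A \<and> fst ` A \<subseteq> fst ` A' \<and>
        (\<forall>b\<in>B. dfun (w b) \<and> (\<forall>t y. (t, y) \<in> A' \<longrightarrow> y \<bullet> b = w b t))"
      by (elim meta_impE exE) auto
    then have A': "dset A'" "A' \<subseteq> A" "fst ` A \<subseteq> fst ` A'"
        "\<And>b. b \<in> B \<Longrightarrow> dfun (w b)" "\<And>b t y. b \<in> B \<Longrightarrow> (t, y) \<in> A' \<Longrightarrow> y \<bullet> b = w b t"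
      by simp_all
    define G where "G = {p :: real \<times> real. \<exists>y. (fst p, y) \<in> A' \<and> snd p = y \<bullet> c}"
    have lin: "linear (\<lambda>p::(real \<times> real) \<times> 'a. (fst (fst p), snd p))" "linear (\<lambda>p::(real \<times> real) \<times> 'a. snd p \<bullet> c)"
      by (intro linear_rules linear_inner_comp)+
    have "dset G" unfolding G_def
      by (intro dset_rules dset_vimage[OF A'(1) lin(1)] dfun_var linear_rules dfun_linear[OF lin(2)])
    moreover have "\<bar>s\<bar> \<le> R" if ts: "(t, s) \<in> G" for t s
    proof -
      obtain y where y: "(t, y) \<in> A'" "s = y \<bullet> c" using ts unfolding G_def by auto
      then have "norm y \<le> R" using R A'(2) by blast
      then show ?thesis using Basis_le_norm[of c y] y insert.prems by simp
    qed
    ultimately obtain \<phi> where \<phi>: "dfun \<phi>" "\<And>t y. (t, y) \<in> G \<Longrightarrow> (t, \<phi> t) \<in> G"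
      using definable_choice[of G R] by metis
    define A'' where "A'' = {p. p \<in> A' \<and> snd p \<bullet> c = \<phi> (fst p)}"
    have "dset A''" unfolding A''_def
      by (intro dset_conj dset_eq dset_vimage[OF A'(1) linear_ident] dfun_comp[OF \<phi>(1)] dfun_linear
          linear_rules linear_inner_comp)
    moreover have "fst ` A' \<subseteq> fst ` A''"
    proof
      fix t assume "t \<in> fst ` A'"
      then obtain y where "(t, y) \<in> A'" by auto
      then have "(t, y \<bullet> c) \<in> G" unfolding G_def by auto
      then have "(t, \<phi> t) \<in> G" by (rule \<phi>(2))
      then obtain y' where "(t, y') \<in> A'" "\<phi> t = y' \<bullet> c" unfolding G_def by auto
      then have "(t, y') \<in> A''" unfolding A''_def by simp
      then show "t \<in> fst ` A''" by force
    qed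
    then have "fst ` A \<subseteq> fst ` A''" using A'(3) by (rule order_trans[rotated])
    moreover have "A'' \<subseteq> A'" unfolding A''_def by (rule Collect_restrict)
    moreover have "\<forall>b\<in>insert c B. dfun ((w(c := \<phi>)) b) \<and> (\<forall>t y. (t, y) \<in> A'' \<longrightarrow> y \<bullet> b = (w(c := \<phi>)) b t)"
      using A'(4,5) \<phi>(1) insert.hyps(2) by (auto simp: A''_def)
    ultimately show ?case using A'(2) by (intro exI[of _ A''] exI[of _ "w(c := \<phi>)"]) simp
  qed
  from this[OF finite_Basis order_refl] obtain A' and w :: "'a \<Rightarrow> real \<Rightarrow> real" where
    "dset A' \<and> A' \<subseteq> A \<and> fst ` A \<subseteq> fst ` A' \<and>
      (\<forall>b\<in>Basis. dfun (w b) \<and> (\<forall>t y. (t, y) \<in> A' \<longrightarrow> y \<bullet> b = w b t))"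
    by (elim exE)
  then have A': "A' \<subseteq> A" "fst ` A \<subseteq> fst ` A'"
        "\<And>b. b \<in> Basis \<Longrightarrow> dfun (w b)" "\<And>b t y. b \<in> Basis \<Longrightarrow> (t, y) \<in> A' \<Longrightarrow> y \<bullet> b = w b t"
    by simp_all
  define z where "z = (\<lambda>t. \<Sum>b\<in>Basis. w b t *\<^sub>R b)"
  have zb: "z t \<bullet> b = w b t" if "b \<in> Basis" for t b
    unfolding z_def using that by simp
  show thesis
  proof (rule that)
    show "dfun (\<lambda>t. z t \<bullet> b)" if "b \<in> Basis" for b
      using A'(3)[OF that] zb[OF that] by simp
    show "(t, z t) \<in> A" if ty: "(t, y) \<in> A" for t y
    proof -
      obtain y' where y': "(t, y') \<in> A'" using ty A'(2) by force
      have "z t = y'" by (rule euclidean_eqI) (use zb A'(4)[OF _ y'] in simp)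
      then show ?thesis using y' A'(1) by auto
    qed
  qed
qed

end

section \<open>The Kurdyka--Lojasiewicz inequality\<close>

text \<open>The infimum of the nonnegative \<open>r\<close> with this property is the strong slope
  of \<open>f\<close> on \<open>U\<close> at \<open>z\<close>. The predicate is first-order in
  \<open>f\<close> and \<open>U\<close>, hence definable with them.\<close>

definition slope_le :: "'a::real_normed_vector set \<Rightarrow> ('a \<Rightarrow> real) \<Rightarrow> 'a \<Rightarrow> real \<Rightarrow> bool" where
  "slope_le U f z r \<longleftrightarrow>
    (\<exists>\<delta>. 0 < \<delta> \<and> (\<forall>z'. z' \<in> U \<and> norm (z' - z) < \<delta> \<longrightarrow> f z - r * norm (z' - z) \<le> f z'))"

lemma slope_le_mono: "slope_le U f z r \<Longrightarrow> r \<le> r' \<Longrightarrow> slope_le U f z r'"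
  unfolding slope_le_def by (meson diff_left_mono mult_right_mono norm_ge_zero order_trans)

text \<open>A mean value inequality along a curve: the slope bound at \<open>z t\<close> is only used backwards, at points \<open>z s\<close>
  with \<open>s < t\<close>. A jump of the curve only helps, so \<open>z\<close> need not be continuous.\<close>

lemma slope_length:
  fixes z :: "real \<Rightarrow> 'a::real_normed_vector"
  assumes "a \<le> b" and \<Gamma>: "0 < \<Gamma>"
    and \<psi>: "\<And>s t. a \<le> s \<Longrightarrow> s \<le> t \<Longrightarrow> t \<le> b \<Longrightarrow> norm (z t - z s) \<le> \<psi> t - \<psi> s"
    and zU: "\<And>t. a \<le> t \<Longrightarrow> t \<le> b \<Longrightarrow> z t \<in> U"
    and fz: "\<And>t. a \<le> t \<Longrightarrow> t \<le> b \<Longrightarrow> f (z t) = c + t"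
    and slope: "\<And>t. a \<le> t \<Longrightarrow> t \<le> b \<Longrightarrow> slope_le U f (z t) \<Gamma>"
  shows "b - a \<le> \<Gamma> * (\<psi> b - \<psi> a)"
proof -
  define E where "E = {s. a \<le> s \<and> s \<le> b \<and> b - s \<le> \<Gamma> * (\<psi> b - \<psi> s)}"
  have mono: "\<psi> s \<le> \<psi> t" if "a \<le> s" "s \<le> t" "t \<le> b" for s t
    using \<psi>[OF that] norm_ge_zero[of "z t - z s"] by linarith
  have "b \<in> E" unfolding E_def using \<open>a \<le> b\<close> by simp
  have bdd: "bdd_below E" unfolding E_def by (rule bdd_belowI[of _ a]) simp
  define T where "T = Inf E"
  have "T \<le> b" unfolding T_def by (rule cInf_lower[OF \<open>b \<in> E\<close> bdd])
  have "a \<le> T" unfolding T_def using \<open>b \<in> E\<close> by (intro cInf_greatest) (auto simp: E_def)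
  have TE: "b - T \<le> \<Gamma> * (\<psi> b - \<psi> T)"
  proof (rule field_le_epsilon)
    fix \<eta> :: real assume "0 < \<eta>"
    then obtain s where s: "s \<in> E" "s < T + \<eta>"
      using cInf_less_iff[OF _ bdd, of "T + \<eta>"] \<open>b \<in> E\<close> unfolding T_def by auto
    have "T \<le> s" unfolding T_def by (rule cInf_lower[OF s(1) bdd])
    then have "\<psi> T \<le> \<psi> s" using mono[of T s] \<open>a \<le> T\<close> s(1) unfolding E_def by simp
    then have "\<Gamma> * (\<psi> b - \<psi> s) \<le> \<Gamma> * (\<psi> b - \<psi> T)" using \<Gamma> by simp
    then show "b - T \<le> \<Gamma> * (\<psi> b - \<psi> T) + \<eta>" using s unfolding E_def by simp
  qed
  have "T = a"
  proof (rule ccontr)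
    assume "T \<noteq> a"
    then have "a < T" using \<open>a \<le> T\<close> by simp
    obtain \<delta> where \<delta>: "0 < \<delta>" "\<And>z'. z' \<in> U \<Longrightarrow> norm (z' - z T) < \<delta> \<Longrightarrow> f (z T) - \<Gamma> * norm (z' - z T) \<le> f z'"
      using slope[OF \<open>a \<le> T\<close> \<open>T \<le> b\<close>] unfolding slope_le_def by metis
    \<comment> \<open>After a step back of at most \<open>\<Gamma> * \<delta>\<close> both outcomes
      suffice: either \<open>z s\<close> is in the ball where the slope bound applies, or the curve
      has already travelled \<open>\<delta>\<close>.\<close>
    define s where "s = max a (T - \<Gamma> * \<delta>)"
    have s: "a \<le> s" "s < T" "T - s \<le> \<Gamma> * \<delta>"
      unfolding s_def using \<open>a < T\<close> \<delta>(1) \<Gamma> by auto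
    have n: "norm (z s - z T) \<le> \<psi> T - \<psi> s"
      using \<psi>[of s T] s \<open>T \<le> b\<close> by (simp add: norm_minus_commute)
    have "T - s \<le> \<Gamma> * (\<psi> T - \<psi> s)"
    proof (cases "norm (z s - z T) < \<delta>")
      case True
      have "f (z T) - \<Gamma> * norm (z s - z T) \<le> f (z s)"
        by (rule \<delta>(2)[OF _ True]) (use zU s \<open>T \<le> b\<close> in simp)
      then have "T - s \<le> \<Gamma> * norm (z s - z T)"
        using fz[of T] fz[of s] s \<open>a \<le> T\<close> \<open>T \<le> b\<close> by simp
      also have "\<dots> \<le> \<Gamma> * (\<psi> T - \<psi> s)" using n \<Gamma> by simp
      finally show ?thesis .
    next
      case False
      then have "\<Gamma> * \<delta> \<le> \<Gamma> * (\<psi> T - \<psi> s)" using n \<Gamma> by simp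
      then show ?thesis using s by simp
    qed
    then have "b - s \<le> \<Gamma> * (\<psi> b - \<psi> s)" using TE by (simp add: algebra_simps)
    then have "s \<in> E" unfolding E_def using s \<open>T \<le> b\<close> by simp
    then have "T \<le> s" unfolding T_def by (rule cInf_lower[OF _ bdd])
    then show False using s by simp
  qed
  then show ?thesis using TE by simp
qed

context o_minimal_structure
begin

lemma dset_slope_le:
  fixes U :: "'a::euclidean_space set" and Z :: "'b::euclidean_space \<Rightarrow> 'a" 
  assumes U: "dset U" and f: "dfun f" and "dfun r" and Z: "linear Z"
  shows "dset {x. slope_le U f (Z x) (r x)}"
proof -
  have lin: "linear (\<lambda>x::('b \<times> real) \<times> 'a. Z (fst (fst x)))"
    using Z by (simp add: linear_iff)
  have r: "dfun (\<lambda>x::('b \<times> real) \<times> 'a. r (fst (fst x)))"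
    by (rule dfun_comp[OF assms(3)]) (intro linear_rules)
  show ?thesis
    unfolding slope_le_def
    by (intro dset_rules dset_vimage[OF U] dfun_comp[OF f] r lin dfun_var linear_rules)
qed

text \<open>The two defining properties of an infimum are first-order. Empty fibres get the fixed
  value \<open>Inf {}\<close>, which is the second alternative of the formula.\<close>

lemma dfun_Inf:
  fixes W :: "(real \<times> real) set"
  assumes "dset W" and pos: "\<And>t r. (t, r) \<in> W \<Longrightarrow> 0 \<le> r"
  shows "dfun (\<lambda>t. Inf {r. (t, r) \<in> W})"
proof -
  have W': "dset {p. (L p, M p) \<in> W}" if "linear L" "linear M" for L M :: "'b::euclidean_space \<Rightarrow> real"
    using dset_vimage[OF assms(1) linear_pair[OF that]] .
  have "snd p = Inf {r. (fst p, r) \<in> W} \<longleftrightarrow>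
     (\<exists>r. (fst p, r) \<in> W) \<and> (\<forall>r. (fst p, r) \<in> W \<longrightarrow> snd p \<le> r) \<and> (\<forall>c. snd p < c \<longrightarrow> (\<exists>r. (fst p, r) \<in> W \<and> r < c))
     \<or> \<not> (\<exists>r. (fst p, r) \<in> W) \<and> snd p = Inf {}" for p :: "real \<times> real"
  proof (cases "{r. (fst p, r) \<in> W} = {}")
    case True
    then show ?thesis by auto
  next
    case False
    have bdd: "bdd_below {r. (fst p, r) \<in> W}" using pos by (intro bdd_belowI[of _ 0]) auto
    have "snd p = Inf {r. (fst p, r) \<in> W} \<longleftrightarrow> (\<forall>r. (fst p, r) \<in> W \<longrightarrow> snd p \<le> r) \<and> (\<forall>c. snd p < c \<longrightarrow> (\<exists>r. (fst p, r) \<in> W \<and> r < c))"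
      (is "?l \<longleftrightarrow> ?r")
    proof
      assume ?l
      then show ?r using cInf_lower[OF _ bdd] cInf_less_iff[OF False bdd] by auto
    next
      assume r: ?r
      show ?l
      proof (rule antisym)
        show "snd p \<le> Inf {r. (fst p, r) \<in> W}" using r by (intro cInf_greatest[OF False]) auto
        show "Inf {r. (fst p, r) \<in> W} \<le> snd p"
        proof (rule dense_ge)
          fix c assume "snd p < c"
          then obtain r where "(fst p, r) \<in> W" "r < c" using r by blast
          then show "Inf {r. (fst p, r) \<in> W} \<le> c" using cInf_lower[OF _ bdd, of r] by simp
        qed
      qed
    qed
    then show ?thesis using False by auto
  qed
  moreover have "dset {p. (\<exists>r. (fst p, r) \<in> W) \<and> (\<forall>r. (fst p, r) \<in> W \<longrightarrow> snd p \<le> r) \<and> (\<forall>c. snd p < c \<longrightarrow> (\<exists>r. (fst p, r) \<in> W \<and> r < c))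
     \<or> \<not> (\<exists>r. (fst p, r) \<in> W) \<and> snd p = Inf {}}"
    by (intro dset_rules W' dfun_var linear_rules)
  ultimately show ?thesis unfolding dfun_def by presburger
qed

text \<open>The sign makes every coordinate of a curve nondecreasing, so that coordinates can be
  added up; \<open>eventually\<close> lets finitely many of them share one interval.\<close>

lemma eventually_monotone_sign:
  fixes \<phi> :: "real \<Rightarrow> real"
  assumes "dfun \<phi>"
  shows "\<exists>\<sigma>. \<bar>\<sigma>\<bar> = 1 \<and> (\<forall>\<^sub>F e in at_right (0::real). \<forall>s t. 0 < s \<and> s \<le> t \<and> t < e \<longrightarrow> \<sigma> * \<phi> s \<le> \<sigma> * \<phi> t)"
proof (rule eventually_monotone[OF assms])
  fix e :: real assume e: "e > 0" "\<And>s t. 0 < s \<Longrightarrow> s \<le> t \<Longrightarrow> t < e \<Longrightarrow> \<phi> s \<le> \<phi> t"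
  have "\<forall>\<^sub>F e in at_right (0::real). \<forall>s t. 0 < s \<and> s \<le> t \<and> t < e \<longrightarrow> 1 * \<phi> s \<le> 1 * \<phi> t"
    unfolding eventually_at_right_field by (rule exI[of _ e]) (use e in auto)
  then show ?thesis by (intro exI[of _ 1]) simp
next
  fix e :: real assume e: "e > 0" "\<And>s t. 0 < s \<Longrightarrow> s \<le> t \<Longrightarrow> t < e \<Longrightarrow> \<phi> t \<le> \<phi> s"
  have "\<forall>\<^sub>F e in at_right (0::real). \<forall>s t. 0 < s \<and> s \<le> t \<and> t < e \<longrightarrow> -1 * \<phi> s \<le> -1 * \<phi> t"
    unfolding eventually_at_right_field by (rule exI[of _ e]) (use e in auto)
  then show ?thesis by (intro exI[of _ "-1"]) simp
qed

text \<open>Here \<open>\<psi>\<close> plays the part of a concave desingularizing function and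
  \<open>\<gamma>\<close> that of the reciprocal of its derivative. The bound on
  \<open>t - s\<close> is then the tangent inequality of concavity, and the last conclusion says
  that the derivative at \<open>f z - c\<close> times the slope is at least 1.\<close>

theorem desingularization:
  fixes U :: "'a::euclidean_space set" and f :: "'a \<Rightarrow> real"
  assumes U: "dset U" and f: "dfun f"
  obtains e :: real and \<psi> \<gamma> :: "real \<Rightarrow> real" where "e > 0"
    "\<And>t. 0 < t \<Longrightarrow> t < e \<Longrightarrow> 0 < \<gamma> t"
    "\<And>s t. 0 < s \<Longrightarrow> s \<le> t \<Longrightarrow> t < e \<Longrightarrow> \<gamma> s \<le> \<gamma> t"
    "\<And>s t. 0 \<le> s \<Longrightarrow> s \<le> t \<Longrightarrow> t < e \<Longrightarrow> t - s \<le> \<gamma> t * (\<psi> t - \<psi> s)"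
    "\<And>z r. z \<in> U \<Longrightarrow> norm z \<le> R \<Longrightarrow> c < f z \<Longrightarrow> f z < c + e \<Longrightarrow> 0 < r \<Longrightarrow> slope_le U f z r
      \<Longrightarrow> \<gamma> (f z - c) \<le> r"
proof -
  define level_pt where "level_pt = (\<lambda>t z. z \<in> U \<and> norm z \<le> R \<and> f z = c + t)"
  define W where "W = {p. 0 < snd p \<and> (\<exists>z. level_pt (fst p) z \<and> slope_le U f z (snd p))}"
  have "dset W"
    unfolding W_def level_pt_def
    by (intro dset_rules dset_vimage[OF U] dfun_comp[OF f] dset_slope_le[OF U f] dfun_var linear_rules)
  have W: "(f z - c, r) \<in> W" if "z \<in> U" "norm z \<le> R" "0 < r" "slope_le U f z r" for z r
    unfolding W_def level_pt_def using that by auto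
  have W': "dset {p. (L p, M p) \<in> W}" if "linear L" "linear M" for L M :: "'b::euclidean_space \<Rightarrow> real"
    using dset_vimage[OF \<open>dset W\<close> linear_pair[OF that]] .
  have "dset {t. \<exists>r. (t, r) \<in> W}" by (intro dset_rules W' linear_rules)
  from eventually_dichotomy[OF this, of 0]
  consider "\<forall>\<^sub>F t in at_right 0. \<exists>r. (t, r) \<in> W" | "\<forall>\<^sub>F t in at_right 0. \<nexists>r. (t, r) \<in> W" by auto
  then show thesis
  proof cases
    \<comment> \<open>Small levels carry no slope bound at all, so the last conclusion is
      vacuous.\<close>
    case 2
    then obtain e :: real where e: "e > 0" "\<And>t. 0 < t \<Longrightarrow> t < e \<Longrightarrow> \<nexists>r. (t, r) \<in> W"
      unfolding eventually_at_right_field by blast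
    show thesis
    proof (rule that[of e "\<lambda>t. 1" "\<lambda>t. t"])
      show "1 \<le> r" if "z \<in> U" "norm z \<le> R" "c < f z" "f z < c + e" "0 < r" "slope_le U f z r" for z r
        using e(2)[of "f z - c"] W[OF that(1,2,5,6)] that(3,4) by auto
    qed (use e(1) in simp_all)
  next
    case 1
    then obtain e0 :: real where e0: "e0 > 0" "\<And>t. 0 < t \<Longrightarrow> t < e0 \<Longrightarrow> \<exists>r. (t, r) \<in> W"
      unfolding eventually_at_right_field by blast
    define g where "g = (\<lambda>t. Inf {r. (t, r) \<in> W})"
    have W_pos: "0 < r" if "(t, r) \<in> W" for t r using that unfolding W_def by simp
    have g: "dfun g" unfolding g_def by (rule dfun_Inf[OF \<open>dset W\<close>]) (use W_pos in \<open>simp add: less_imp_le\<close>)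
    have bdd: "bdd_below {r. (t, r) \<in> W}" for t
      by (rule bdd_belowI[of _ 0]) (use W_pos in \<open>simp add: less_imp_le\<close>)
    have g_le: "g t \<le> r" if "(t, r) \<in> W" for t r
      unfolding g_def by (rule cInf_lower[OF _ bdd]) (use that in simp)
    have g_nonneg: "0 \<le> g t" if "0 < t" "t < e0" for t
      unfolding g_def by (rule cInf_greatest) (use e0(2)[OF that] W_pos in \<open>auto simp: less_imp_le\<close>)
    \<comment> \<open>The summand \<open>t * t\<close> leaves room for an admissible slope below
      \<open>\<gamma> t\<close> even if the infimum \<open>g t\<close> is not attained, and it keeps
      \<open>\<gamma>\<close> positive. Its quadratic order is small enough to be absorbed
      later.\<close>
    define \<gamma> where "\<gamma> = (\<lambda>t. g t + t * t)"
    have \<gamma>: "dfun \<gamma>" unfolding \<gamma>_def by (intro dset_rules g dfun_var)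
    have \<gamma>_pos: "0 < \<gamma> t" if "0 < t" "t < e0" for t
      unfolding \<gamma>_def using g_nonneg[OF that] that by (simp add: add_nonneg_pos)
    define A where "A = {p. level_pt (fst p) (snd p) \<and> slope_le U f (snd p) (\<gamma> (fst p))}"
    have "dset A"
      unfolding A_def level_pt_def
      by (intro dset_rules dset_vimage[OF U] dfun_comp[OF f] dset_slope_le[OF U f] dfun_comp[OF \<gamma>]
          dfun_var linear_rules)
    moreover have "norm z \<le> R" if "(t, z) \<in> A" for t z using that unfolding A_def level_pt_def by simp
    ultimately obtain z where z: "\<And>b. b \<in> Basis \<Longrightarrow> dfun (\<lambda>t. z t \<bullet> b)" "\<And>t y. (t, y) \<in> A \<Longrightarrow> (t, z t) \<in> A"
      using curve_selection[of A R] by metis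
    have zA: "level_pt t (z t) \<and> slope_le U f (z t) (\<gamma> t)" if t: "0 < t" "t < e0" for t
    proof -
      have "Inf {r. (t, r) \<in> W} < \<gamma> t" unfolding \<gamma>_def g_def using t by simp
      then obtain r where r: "(t, r) \<in> W" "r < \<gamma> t"
        using cInf_less_iff[OF _ bdd] e0(2)[OF t] by auto
      then obtain y where "level_pt t y" "slope_le U f y r" unfolding W_def by auto
      then have "(t, y) \<in> A" unfolding A_def using slope_le_mono r(2) by fastforce
      then have "(t, z t) \<in> A" by (rule z(2))
      then show ?thesis unfolding A_def by simp
    qed
    have "\<forall>b\<in>Basis. \<exists>\<sigma>. \<bar>\<sigma>\<bar> = 1 \<and> (\<forall>\<^sub>F e in at_right (0::real). \<forall>s t. 0 < s \<and> s \<le> t \<and> t < e \<longrightarrow> \<sigma> * (z s \<bullet> b) \<le> \<sigma> * (z t \<bullet> b))"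
      using eventually_monotone_sign[OF z(1)] by simp
    from bchoice[OF this] obtain \<sigma> where \<sigma>: "\<And>b. b \<in> Basis \<Longrightarrow> \<bar>\<sigma> b\<bar> = 1"
      "\<And>b. b \<in> Basis \<Longrightarrow> \<forall>\<^sub>F e in at_right (0::real). \<forall>s t. 0 < s \<and> s \<le> t \<and> t < e \<longrightarrow> \<sigma> b * (z s \<bullet> b) \<le> \<sigma> b * (z t \<bullet> b)"
      by auto
    have "\<forall>\<^sub>F e in at_right (0::real). \<forall>b\<in>Basis. \<forall>s t. 0 < s \<and> s \<le> t \<and> t < e \<longrightarrow> \<sigma> b * (z s \<bullet> b) \<le> \<sigma> b * (z t \<bullet> b)"
      by (rule eventually_ball_finite[OF finite_Basis]) (use \<sigma>(2) in blast)
    then obtain e1 :: real where e1: "e1 > 0"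
        "\<And>e b s t. 0 < e \<Longrightarrow> e < e1 \<Longrightarrow> b \<in> Basis \<Longrightarrow> 0 < s \<Longrightarrow> s \<le> t \<Longrightarrow> t < e \<Longrightarrow> \<sigma> b * (z s \<bullet> b) \<le> \<sigma> b * (z t \<bullet> b)"
      unfolding eventually_at_right_field by (metis (no_types, lifting))
    have mono: "\<sigma> b * (z s \<bullet> b) \<le> \<sigma> b * (z t \<bullet> b)" if b: "b \<in> Basis" and st: "0 < s" "s \<le> t" "t < e1" for b s t
    proof -
      obtain e where "t < e" "e < e1" using dense[OF st(3)] by blast
      then show ?thesis using e1(2)[of e b s t] b st by simp
    qed
    \<comment> \<open>The l1 length of a curve with monotone coordinates telescopes into this signed
      sum.\<close>
    define \<psi> where "\<psi> = (\<lambda>t. \<Sum>b\<in>Basis. \<sigma> b * (z t \<bullet> b))"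
    have \<psi>: "norm (z t - z s) \<le> \<psi> t - \<psi> s" if "0 < s" "s \<le> t" "t < e1" for s t
    proof -
      have "norm (z t - z s) \<le> (\<Sum>b\<in>Basis. \<bar>(z t - z s) \<bullet> b\<bar>)" by (rule norm_le_l1)
      also have "\<dots> = (\<Sum>b\<in>Basis. \<bar>\<sigma> b * (z t \<bullet> b) - \<sigma> b * (z s \<bullet> b)\<bar>)"
      proof (rule sum.cong)
        fix b :: 'a assume "b \<in> Basis"
        have "\<sigma> b * (z t \<bullet> b) - \<sigma> b * (z s \<bullet> b) = \<sigma> b * ((z t - z s) \<bullet> b)"
          by (simp add: inner_diff_left right_diff_distrib)
        then show "\<bar>(z t - z s) \<bullet> b\<bar> = \<bar>\<sigma> b * (z t \<bullet> b) - \<sigma> b * (z s \<bullet> b)\<bar>"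
          using \<sigma>(1)[OF \<open>b \<in> Basis\<close>] by (simp add: abs_mult)
      qed simp
      also have "\<dots> = (\<Sum>b\<in>Basis. \<sigma> b * (z t \<bullet> b) - \<sigma> b * (z s \<bullet> b))"
        by (rule sum.cong) (use mono that in auto)
      finally show ?thesis by (simp add: \<psi>_def sum_subtractf)
    qed
    define K where "K = (\<Sum>b\<in>(Basis::'a set). R)"
    have \<psi>_bound: "\<bar>\<psi> t\<bar> \<le> K" if "0 < t" "t < e0" for t
    proof -
      have "\<bar>\<psi> t\<bar> \<le> (\<Sum>b\<in>Basis. \<bar>\<sigma> b * (z t \<bullet> b)\<bar>)" unfolding \<psi>_def by (rule sum_abs)
      also have "\<dots> \<le> K" unfolding K_def
      proof (rule sum_mono)
        fix b :: 'a assume "b \<in> Basis"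
        have "norm (z t) \<le> R" using zA[OF that] unfolding level_pt_def by simp
        then show "\<bar>\<sigma> b * (z t \<bullet> b)\<bar> \<le> R"
          using \<sigma>(1)[OF \<open>b \<in> Basis\<close>] Basis_le_norm[OF \<open>b \<in> Basis\<close>, of "z t"] by (simp add: abs_mult)
      qed
      finally show ?thesis .
    qed
    have K: "0 \<le> K" using \<psi>_bound[of "e0 / 2"] e0(1) by simp
    show thesis
    proof (rule eventually_monotone[OF \<gamma>])
      fix e2 assume e2: "e2 > 0" "\<And>s t. 0 < s \<Longrightarrow> s \<le> t \<Longrightarrow> t < e2 \<Longrightarrow> \<gamma> s \<le> \<gamma> t"
      define e3 where "e3 = min e0 (min e1 e2)"
      have e3: "e3 > 0" "e3 \<le> e0" "e3 \<le> e1" "e3 \<le> e2" unfolding e3_def using e0 e1 e2 by auto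
      \<comment> \<open>The constant bound \<open>\<gamma> t\<close> is valid at the earlier points
        because \<open>\<gamma>\<close> is nondecreasing.\<close>
      have length: "t - s \<le> \<gamma> t * (\<psi> t - \<psi> s)" if st: "0 < s" "s \<le> t" "t < e3" for s t
      proof (rule slope_length[of s t "\<gamma> t" z \<psi> U f c])
        show "0 < \<gamma> t" using \<gamma>_pos st e3 by simp
        show "norm (z v - z u) \<le> \<psi> v - \<psi> u" if "s \<le> u" "u \<le> v" "v \<le> t" for u v
          by (rule \<psi>) (use that st e3 in auto)
        fix v assume v: "s \<le> v" "v \<le> t"
        then have v0: "0 < v" "v < e0" using st e3 by auto
        show "z v \<in> U" "f (z v) = c + v" using zA[OF v0] unfolding level_pt_def by auto
        show "slope_le U f (z v) (\<gamma> t)"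
          by (rule slope_le_mono[OF conjunct2[OF zA[OF v0]]], rule e2(2)) (use v st e3 in auto)
      qed (use st in simp)
      \<comment> \<open>If \<open>g t < t * t\<close> held for all small \<open>t\<close>, then
        \<open>\<gamma> t < 2 * t * t\<close>, and the estimate between \<open>t / 2\<close> and
        \<open>t\<close> would give \<open>t / 2 \<le> 4 * K * t * t\<close>, which fails for small
        \<open>t\<close>.\<close>
      have "dset {t. t * t \<le> g t}" by (intro dset_rules g dfun_var)
      from eventually_dichotomy[OF this, of 0]
      have "\<forall>\<^sub>F t in at_right 0. t * t \<le> g t"
      proof
        assume "\<forall>\<^sub>F t in at_right 0. t \<notin> {t. t * t \<le> g t}"
        then obtain e4 :: real where e4: "e4 > 0" "\<And>t. 0 < t \<Longrightarrow> t < e4 \<Longrightarrow> g t < t * t"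
          unfolding eventually_at_right_field by (auto simp: not_le)
        obtain t where t: "0 < t" "t < min (min e3 e4) (1 / (16 * (K + 1)))"
          using dense[of 0 "min (min e3 e4) (1 / (16 * (K + 1)))"] e3 e4(1) K by auto
        have "t - t / 2 \<le> \<gamma> t * (\<psi> t - \<psi> (t / 2))" by (rule length) (use t in auto)
        also have "\<dots> \<le> \<gamma> t * (2 * K)"
          using \<psi>_bound[of t] \<psi>_bound[of "t / 2"] \<gamma>_pos[of t] t e3 by (intro mult_left_mono) auto
        also have "\<dots> \<le> (2 * (t * t)) * (2 * K)"
          using e4(2)[of t] t K unfolding \<gamma>_def by (intro mult_right_mono) auto
        finally have "t * 1 \<le> t * (8 * t * K)" by (simp add: algebra_simps)
        then have "1 \<le> 8 * t * K" using t(1) by (simp only: mult_le_cancel_left_pos)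
        moreover have "t * (16 * (K + 1)) < 1" using t(2) K by (simp add: field_simps)
        moreover have "8 * t * K \<le> t * (16 * (K + 1))" using t(1) K by (simp add: algebra_simps)
        ultimately show ?thesis by simp
      qed simp
      then obtain e5 :: real where e5: "e5 > 0" "\<And>t. 0 < t \<Longrightarrow> t < e5 \<Longrightarrow> t * t \<le> g t"
        unfolding eventually_at_right_field by blast
      define e where "e = min e3 e5"
      \<comment> \<open>Since \<open>\<gamma> \<le> 2 * g\<close>, half of \<open>\<gamma>\<close>
        is a lower bound for the slopes, paid for by doubling \<open>\<psi>\<close>. The value
        \<open>- 2 * K\<close> at 0 is a lower bound of the others, which extends the estimate to
        \<open>s = 0\<close> by a limit.\<close>
      define \<psi>' where "\<psi>' = (\<lambda>t. if t \<le> 0 then - 2 * K else 2 * \<psi> t)"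
      show thesis
      proof (rule that[of e "\<lambda>t. \<gamma> t / 2" \<psi>'])
        show "e > 0" unfolding e_def using e3 e5 by simp
        show "0 < \<gamma> t / 2" if "0 < t" "t < e" for t using \<gamma>_pos that e3 unfolding e_def by simp
        show "\<gamma> s / 2 \<le> \<gamma> t / 2" if "0 < s" "s \<le> t" "t < e" for s t
          using e2(2)[of s t] that e3 unfolding e_def by simp
        show "t - s \<le> \<gamma> t / 2 * (\<psi>' t - \<psi>' s)" if st: "0 \<le> s" "s \<le> t" "t < e" for s t
        proof (cases "t = 0")
          case True
          then show ?thesis using st by simp
        next
          case False
          then have t: "0 < t" "t < e0" "t < e3" using st e3 unfolding e_def by auto
          show ?thesis
          proof (cases "s = 0")
            case False
            then show ?thesis using length[of s t] st t unfolding \<psi>'_def by (simp add: algebra_simps)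
          next
            case True
            have "t \<le> \<gamma> t * (\<psi> t + K) + \<eta>" if "0 < \<eta>" for \<eta>
            proof -
              define u where "u = min \<eta> t"
              have u: "0 < u" "u \<le> t" "u \<le> \<eta>" "u < e0" unfolding u_def using t that by auto
              have "t - u \<le> \<gamma> t * (\<psi> t - \<psi> u)" by (rule length) (use u t in auto)
              also have "\<dots> \<le> \<gamma> t * (\<psi> t + K)"
                using \<psi>_bound[of u] u \<gamma>_pos[of t] t by (intro mult_left_mono) auto
              finally show ?thesis using u by simp
            qed
            then have "t \<le> \<gamma> t * (\<psi> t + K)" by (rule field_le_epsilon)
            then show ?thesis using True t unfolding \<psi>'_def by (simp add: algebra_simps)
          qed
        qed
        show "\<gamma> (f z - c) / 2 \<le> r"
          if "z \<in> U" "norm z \<le> R" "c < f z" "f z < c + e" "0 < r" "slope_le U f z r" for z r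
        proof -
          have "0 < f z - c" "f z - c < e5" using that(3,4) min.cobounded2[of e3 e5] unfolding e_def by linarith+
          from e5(2)[OF this] show ?thesis using g_le[OF W[OF that(1,2,5,6)]] unfolding \<gamma>_def by simp
        qed
      qed
    next
      fix e2 assume e2: "e2 > 0" "\<And>s t. 0 < s \<Longrightarrow> s \<le> t \<Longrightarrow> t < e2 \<Longrightarrow> \<gamma> t \<le> \<gamma> s"
      \<comment> \<open>A nonincreasing \<open>\<gamma>\<close> stays above \<open>c0\<close> near
        0, so slopes are bounded below and a linear \<open>\<psi>\<close> works;
        \<open>e \<le> 1\<close> and \<open>e \<le> c0 / 2\<close> keep \<open>t * t\<close> below
        \<open>c0 / 2\<close>.\<close>
      define t0 where "t0 = min e0 e2 / 2"
      have t0: "0 < t0" "t0 < e0" "t0 < e2" unfolding t0_def using e0(1) e2(1) by auto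
      define c0 where "c0 = \<gamma> t0"
      have c0: "0 < c0" unfolding c0_def using \<gamma>_pos t0 by simp
      define e where "e = min t0 (min 1 (c0 / 2))"
      have low: "c0 / 2 \<le> g t" if "0 < t" "t < e" for t
      proof -
        have "c0 \<le> \<gamma> t" unfolding c0_def by (rule e2(2)) (use that t0 in \<open>auto simp: e_def\<close>)
        moreover have "t * t \<le> t * 1" using that by (intro mult_left_mono) (auto simp: e_def)
        moreover have "t < c0 / 2" using that by (simp add: e_def)
        ultimately show ?thesis unfolding \<gamma>_def by simp
      qed
      show thesis
      proof (rule that[of e "\<lambda>t. c0 / 2" "\<lambda>t. 2 * t / c0"])
        show "e > 0" unfolding e_def using c0 t0 by simp
        show "t - s \<le> c0 / 2 * (2 * t / c0 - 2 * s / c0)" for s t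
          using c0 by (simp add: field_simps)
        show "c0 / 2 \<le> r"
          if "z \<in> U" "norm z \<le> R" "c < f z" "f z < c + e" "0 < r" "slope_le U f z r" for z r
          using g_le[OF W[OF that(1,2,5,6)]] low[of "f z - c"] that(3,4) by simp
      qed (use c0 in simp_all)
    qed
  qed
qed

end

section \<open>Sequences of finite length and openness of the domain\<close>

text \<open>Summing the step inequality moves half of the partial sum to the left; the rest
  telescopes to at most \<open>V 0 - L\<close>, independently of \<open>n\<close>.\<close>

lemma summable_recursive:
  fixes d V :: "nat \<Rightarrow> real"
  assumes d: "\<And>k. 0 \<le> d k"
    and step: "\<And>k. d (Suc k) \<le> d k / 2 + (V k - V (Suc k))"
    and L: "\<And>k. L \<le> V k"
  shows "summable d"
proof (rule summableI_nonneg_bounded[OF d])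
  fix n
  have "(\<Sum>k<n. d (Suc k)) \<le> (\<Sum>k<n. d k / 2 + (V k - V (Suc k)))"
    by (intro sum_mono step)
  also have "\<dots> = (\<Sum>k<n. d k) / 2 + (V 0 - V n)"
    by (simp add: sum.distrib sum_divide_distrib sum_lessThan_telescope')
  finally have "(\<Sum>k<n. d (Suc k)) \<le> (\<Sum>k<n. d k) / 2 + (V 0 - L)"
    using L[of n] by simp
  moreover have "(\<Sum>k<n. d k) \<le> (\<Sum>k<Suc n. d k)" using d by simp
  moreover have "(\<Sum>k<Suc n. d k) = d 0 + (\<Sum>k<n. d (Suc k))" by (rule sum.lessThan_Suc_shift)
  ultimately show "(\<Sum>k<n. d k) \<le> 2 * (d 0 + V 0 - L)" by simp
qed

text \<open>\<open>a k\<close> is the gap to the limit value, \<open>d k\<close> the step length and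
  \<open>b\<close> the gap at the proximal point. If \<open>b\<close> is at least half of
  \<open>a (Suc k)\<close>, the bound on \<open>\<gamma> b\<close> passes by monotonicity to
  \<open>a (Suc k) / 2\<close>. Otherwise \<open>a (Suc k) \<le> 2 * C * (d k)\<^sup>2\<close>, so
  the gap contracts at a fixed rate and its square root controls the steps. The potential
  \<open>V\<close> adds the contributions of both cases.\<close>

lemma finite_length:
  fixes a d :: "nat \<Rightarrow> real" and \<psi> \<gamma> :: "real \<Rightarrow> real"
  assumes "\<alpha> > 0" "C > 0"
    and d: "\<And>k. 0 \<le> d k" and a: "\<And>k. 0 \<le> a k" "\<And>k. a k < e"
    and descent: "\<And>k. \<alpha> * (d k)\<^sup>2 \<le> a k - a (Suc k)"
    and \<gamma>_pos: "\<And>t. 0 < t \<Longrightarrow> t < e \<Longrightarrow> 0 < \<gamma> t"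
    and \<gamma>_mono: "\<And>s t. 0 < s \<Longrightarrow> s \<le> t \<Longrightarrow> t < e \<Longrightarrow> \<gamma> s \<le> \<gamma> t"
    and \<psi>: "\<And>s t. 0 \<le> s \<Longrightarrow> s \<le> t \<Longrightarrow> t < e \<Longrightarrow> t - s \<le> \<gamma> t * (\<psi> t - \<psi> s)"
    and approx: "\<And>k. 0 < a (Suc k) \<Longrightarrow> \<exists>b. b \<le> a (Suc k) \<and> a (Suc k) - C * (d k)\<^sup>2 \<le> b \<and> (0 < b \<longrightarrow> \<gamma> b \<le> C * d k)"
  shows "summable d"
proof -
  have am_gm: "4 * (p * q) \<le> (p + q)\<^sup>2" for p q :: real
    using zero_le_power2[of "p - q"] by (simp add: power2_eq_square algebra_simps)
  define \<beta> where "\<beta> = 2 * C / \<alpha>"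
  have \<beta>: "0 < \<beta>" unfolding \<beta>_def using assms(1,2) by simp
  define \<Psi> where "\<Psi> = (\<lambda>k. \<psi> (a k / 2))"
  define C2 where "C2 = (3 * \<beta> + 1) / sqrt \<alpha>"
  have C2: "0 \<le> C2" unfolding C2_def using \<beta> assms(1) by simp
  \<comment> \<open>The index of \<open>\<Psi>\<close> is one ahead: the bound for
    \<open>d (Suc k)\<close> uses its drop from \<open>Suc k\<close> to \<open>Suc (Suc k)\<close>,
    but the drop of the root from \<open>k\<close> to \<open>Suc k\<close>.\<close>
  define V where "V = (\<lambda>k. C / \<alpha> * \<Psi> (Suc k) + C2 * sqrt (a k))"
  have a_dec: "a (Suc k) \<le> a k" for k
  proof -
    have "0 \<le> \<alpha> * (d k)\<^sup>2" using assms(1) by simp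
    then show ?thesis using descent[of k] by simp
  qed
  have \<psi>_mono: "\<psi> s \<le> \<psi> t" if "0 \<le> s" "s \<le> t" "t < e" for s t
  proof (cases "t = 0")
    case False
    then have "0 < \<gamma> t" using \<gamma>_pos that by simp
    moreover have "0 \<le> \<gamma> t * (\<psi> t - \<psi> s)" using \<psi>[OF that] that by simp
    ultimately show ?thesis by (simp add: zero_le_mult_iff)
  qed (use that in simp)
  have half: "a k / 2 < e" for k using a[of k] by simp
  have \<Psi>_mono: "\<Psi> (Suc k) \<le> \<Psi> k" for k
    unfolding \<Psi>_def by (rule \<psi>_mono) (use a a_dec half in auto)
  have sqrt_mono: "sqrt (a (Suc k)) \<le> sqrt (a k)" for k using a_dec by simp
  have "d (Suc k) \<le> d k / 2 + (V k - V (Suc k))" for k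
  proof -
    define \<Delta> where "\<Delta> = \<Psi> (Suc k) - \<Psi> (Suc (Suc k))"
    have V: "V k - V (Suc k) = C / \<alpha> * \<Delta> + C2 * (sqrt (a k) - sqrt (a (Suc k)))"
      unfolding V_def \<Delta>_def by (simp add: algebra_simps)
    have "0 \<le> \<Delta>" unfolding \<Delta>_def using \<Psi>_mono by simp
    then have V1: "0 \<le> C / \<alpha> * \<Delta>" using assms(1,2) by simp
    have V2: "0 \<le> C2 * (sqrt (a k) - sqrt (a (Suc k)))" using C2 sqrt_mono[of k] by simp
    show ?thesis
    proof (cases "a (Suc k) = 0")
      case True
      then have "\<alpha> * (d (Suc k))\<^sup>2 \<le> 0" using descent[of "Suc k"] a(1)[of "Suc (Suc k)"] by simp
      then have "d (Suc k) = 0" using assms(1) by (simp add: mult_le_0_iff)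
      then show ?thesis using V V1 V2 d[of k] by simp
    next
      case False
      then have a1: "0 < a (Suc k)" using a(1)[of "Suc k"] by simp
      from approx[OF this] obtain b where b: "b \<le> a (Suc k)" "a (Suc k) - C * (d k)\<^sup>2 \<le> b" "0 < b \<longrightarrow> \<gamma> b \<le> C * d k"
        by blast
      show ?thesis
      proof (cases "a (Suc k) / 2 \<le> b")
        case True
        then have "\<gamma> (a (Suc k) / 2) \<le> \<gamma> b"
          using \<gamma>_mono[of "a (Suc k) / 2" b] a1 b(1) a(2)[of "Suc k"] by simp
        also have "\<dots> \<le> C * d k" using b(3) True a1 by simp
        finally have \<gamma>: "\<gamma> (a (Suc k) / 2) \<le> C * d k" .
        have "(a (Suc k) - a (Suc (Suc k))) / 2 \<le> \<gamma> (a (Suc k) / 2) * \<Delta>"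
          using \<psi>[of "a (Suc (Suc k)) / 2" "a (Suc k) / 2"] a(1)[of "Suc (Suc k)"] a_dec[of "Suc k"] half[of "Suc k"]
          unfolding \<Delta>_def \<Psi>_def by (simp add: diff_divide_distrib)
        also have "\<dots> \<le> C * d k * \<Delta>" using \<gamma> \<open>0 \<le> \<Delta>\<close> by (rule mult_right_mono)
        finally have "\<alpha> * (d (Suc k))\<^sup>2 \<le> 2 * (C * d k * \<Delta>)" using descent[of "Suc k"] by simp
        then have "(d (Suc k))\<^sup>2 \<le> 2 * (C * d k * \<Delta>) / \<alpha>"
          using assms(1) by (simp add: pos_le_divide_eq mult.commute)
        \<comment> \<open>Weighted so that the arithmetic-geometric mean inequality leaves only half
          of \<open>d k\<close>.\<close>
        also have "\<dots> = 4 * ((d k / 2) * (C / \<alpha> * \<Delta>))" by simp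
        also have "\<dots> \<le> (d k / 2 + C / \<alpha> * \<Delta>)\<^sup>2"
          by (rule am_gm)
        finally have "d (Suc k) \<le> d k / 2 + C / \<alpha> * \<Delta>"
          by (rule power2_le_imp_le) (use d V1 in simp)
        then show ?thesis using V V2 by simp
      next
        case False
        then have "a (Suc k) \<le> 2 * (C * (d k)\<^sup>2)" using b(2) by simp
        also have "\<dots> = \<beta> * (\<alpha> * (d k)\<^sup>2)" unfolding \<beta>_def using assms(1) by simp
        also have "\<dots> \<le> \<beta> * (a k - a (Suc k))" using descent[of k] \<beta> by simp
        finally have le: "a (Suc k) \<le> \<beta> * (a k - a (Suc k))" .
        define u w where "u = sqrt (a k)" and "w = sqrt (a (Suc k))"
        have uw: "0 < w" "w \<le> u" "a k = u\<^sup>2" "a (Suc k) = w\<^sup>2"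
          unfolding u_def w_def using a1 a sqrt_mono by auto
        \<comment> \<open>If \<open>u \<le> 2 * w\<close>, the factor
          \<open>u + w \<le> 3 * w\<close> gives \<open>3 * \<beta>\<close>; otherwise
          \<open>w \<le> u - w\<close>. The constant covers both.\<close>
        have "w \<le> (3 * \<beta> + 1) * (u - w)"
        proof (cases "u \<le> 2 * w")
          case True
          have "w * w \<le> \<beta> * (u - w) * (u + w)"
            using le unfolding uw(3,4) by (simp add: algebra_simps power2_eq_square)
          also have "\<dots> \<le> \<beta> * (u - w) * (3 * w)" using True uw \<beta> by (intro mult_left_mono) auto
          finally have "w * w \<le> w * (3 * \<beta> * (u - w))" by (simp add: algebra_simps)
          then have "w \<le> 3 * \<beta> * (u - w)" using uw(1) by (simp only: mult_le_cancel_left_pos)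
          then show ?thesis using uw(2) by (simp add: algebra_simps)
        next
          case False
          then have "w \<le> 1 * (u - w)" by simp
          also have "\<dots> \<le> (3 * \<beta> + 1) * (u - w)" using uw(2) \<beta> by (intro mult_right_mono) auto
          finally show ?thesis .
        qed
        moreover have "\<alpha> * (d (Suc k))\<^sup>2 \<le> w\<^sup>2" using descent[of "Suc k"] a(1)[of "Suc (Suc k)"] uw(4) by simp
        then have "(sqrt \<alpha> * d (Suc k))\<^sup>2 \<le> w\<^sup>2" using assms(1) by (simp add: power_mult_distrib)
        then have "sqrt \<alpha> * d (Suc k) \<le> w" by (rule power2_le_imp_le) (use uw in simp)
        ultimately have "sqrt \<alpha> * d (Suc k) \<le> (3 * \<beta> + 1) * (u - w)" by simp
        then have "d (Suc k) \<le> C2 * (u - w)"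
          unfolding C2_def using assms(1) by (simp add: pos_le_divide_eq mult.commute)
        then show ?thesis using V V1 d[of k] unfolding u_def w_def by simp
      qed
    qed
  qed
  moreover have "C / \<alpha> * \<psi> 0 \<le> V k" for k
  proof -
    have "\<psi> 0 \<le> \<Psi> (Suc k)" unfolding \<Psi>_def by (rule \<psi>_mono) (use a half in auto)
    then have "C / \<alpha> * \<psi> 0 \<le> C / \<alpha> * \<Psi> (Suc k)" using assms(1,2) by (intro mult_left_mono) auto
    moreover have "0 \<le> C2 * sqrt (a k)" using C2 a by simp
    ultimately show ?thesis unfolding V_def by simp
  qed
  ultimately show ?thesis by (rule summable_recursive[OF d])
qed

lemma lsc_closed_sublevel:
  assumes "lsc f"
  shows "closed {x. f x \<le> c}"
proof -
  have "open {x. c < f x}"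
  proof (rule Topological_Spaces.openI)
    fix x assume "x \<in> {x. c < f x}"
    then have "c < Liminf (at x) f" using assms unfolding lsc_def by (auto intro: less_le_trans)
    from less_LiminfD[OF this] obtain T where "open T" "x \<in> T" "\<forall>y\<in>T. y \<noteq> x \<longrightarrow> c < f y"
      unfolding eventually_at_topological by auto
    then show "\<exists>T. open T \<and> x \<in> T \<and> T \<subseteq> {x. c < f x}"
      using \<open>x \<in> {x. c < f x}\<close> by (intro exI[of _ T]) auto
  qed
  moreover have "{x. f x \<le> c} = - {x. c < f x}" by auto
  ultimately show ?thesis by (simp add: closed_def)
qed

text \<open>Fermat's rule for \<open>f + \<phi>\<close>. With \<open>\<phi>\<close> moved to the
  left, points where \<open>f\<close> is infinite satisfy the comparison trivially.\<close>

lemma regular_subdiff_of_local_min: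
  fixes f :: "'a::euclidean_space \<Rightarrow> ereal"
  assumes fx: "f x = ereal a"
    and \<phi>: "(\<phi> has_derivative (\<lambda>h. w \<bullet> h)) (at x)"
    and min: "\<forall>\<^sub>F z in at x. ereal (a + \<phi> x - \<phi> z) \<le> f z"
  shows "- w \<in> regular_subdiff f x"
proof -
  have "0 \<le> Liminf (at x) (\<lambda>z. (f z - f x - ereal (- w \<bullet> (z - x))) / ereal (norm (z - x)))"
    unfolding le_Liminf_iff
  proof (intro allI impI)
    fix y :: ereal assume "y < 0"
    obtain \<epsilon> :: real where \<epsilon>: "0 < \<epsilon>" "y < ereal (- \<epsilon>)"
    proof (cases y)
      case (real r)
      then show thesis using that[of "- r / 2"] \<open>y < 0\<close> by simp
    next
      case MInf
      then show thesis using that[of 1] by simp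
    qed (use \<open>y < 0\<close> in simp)
    have "\<forall>\<^sub>F z in at x. \<bar>\<phi> z - \<phi> x - w \<bullet> (z - x)\<bar> \<le> \<epsilon> * norm (z - x)"
    proof -
      obtain \<delta> where "\<delta> > 0" "\<And>z. norm (z - x) < \<delta> \<Longrightarrow> norm (\<phi> z - \<phi> x - w \<bullet> (z - x)) \<le> \<epsilon> * norm (z - x)"
        using \<phi>[unfolded has_derivative_at_alt] \<epsilon>(1) by metis
      then show ?thesis unfolding eventually_at by (intro exI[of _ \<delta>]) (simp add: dist_norm)
    qed
    moreover have "\<forall>\<^sub>F z in at x. z \<noteq> x" by (simp add: eventually_at_filter)
    ultimately show "\<forall>\<^sub>F z in at x. y < (f z - f x - ereal (- w \<bullet> (z - x))) / ereal (norm (z - x))"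
      using min
    proof eventually_elim
      case (elim z)
      then have n: "0 < norm (z - x)" by simp
      show ?case
      proof (cases "f z")
        case (real b)
        have "- \<epsilon> * norm (z - x) \<le> b - a - (- w \<bullet> (z - x))"
          using elim(1,3) real by (simp add: abs_le_iff)
        then have "- \<epsilon> \<le> (b - a - (- w \<bullet> (z - x))) / norm (z - x)"
          using n by (simp add: pos_le_divide_eq)
        then show ?thesis using \<epsilon>(2) real fx n by (simp add: less_le_trans)
      next
        case PInf
        then show ?thesis using fx n \<open>y < 0\<close> by auto
      next
        case MInf
        then show ?thesis using elim(3) by simp
      qed
    qed
  qed
  then show ?thesis unfolding regular_subdiff_def using fx by simp
qed

text \<open>Minimising \<open>G(x, y) + k|x - z|\<^sup>2 + C|y - x\<^sub>0|\<^sup>2\<close> for a point \<open>z\<close> outside \<open>D\<close> produces, as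
  \<open>k\<close> grows, regular subgradients whose first component dominates; their normalised limit is a forbidden
  horizon subgradient.\<close>

lemma open_domain:
  fixes G :: "'a::euclidean_space \<times> 'a \<Rightarrow> ereal" and D :: "'a set"
  assumes fin: "\<And>p. \<bar>G p\<bar> \<noteq> \<infinity> \<longleftrightarrow> p \<in> D \<times> D" and minf: "\<And>p. G p \<noteq> - \<infinity>"
    and "lsc G" and cont: "continuous_on (D \<times> D) G"
    and horizon: "\<And>x y v. x \<in> D \<Longrightarrow> y \<in> D \<Longrightarrow> (v, 0) \<in> horizon_subdiff G (x, y) \<Longrightarrow> v = 0"
  shows "open D"
proof (rule Topological_Spaces.openI)
  fix x0 assume x0: "x0 \<in> D"
  define g where "g = (\<lambda>p. real_of_ereal (G p))"
  have Gg: "G p = ereal (g p)" if "p \<in> D \<times> D" for p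
    using fin[of p] that unfolding g_def by (simp add: ereal_real)
  have contg: "continuous_on (D \<times> D) g"
  proof -
    have "\<And>p. p \<in> D \<times> D \<Longrightarrow> \<bar>G p\<bar> \<noteq> \<infinity>" by (rule fin[THEN iffD2])
    from continuous_on_iff_real[of "D \<times> D" G, OF this] cont show ?thesis unfolding g_def o_def by blast
  qed
  obtain \<delta> where \<delta>: "0 < \<delta>" "\<And>p. p \<in> D \<times> D \<Longrightarrow> dist p (x0, x0) < \<delta> \<Longrightarrow> dist (g p) (g (x0, x0)) < 1"
    using contg[unfolded continuous_on_iff, rule_format, of "(x0, x0)" 1] x0 by auto
  define r where "r = \<delta> / 3"
  have r: "0 < r" unfolding r_def using \<delta>(1) by simp
  define K where "K = D \<inter> cball x0 r"
  have KD: "K \<times> K \<subseteq> D \<times> D" unfolding K_def by auto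
  have g_bound: "\<bar>g p - g (x0, x0)\<bar> < 1" if "p \<in> K \<times> K" for p
  proof -
    have "dist (fst p) x0 \<le> r" "dist (snd p) x0 \<le> r" using that unfolding K_def by (auto simp: dist_commute)
    moreover have "dist p (x0, x0) \<le> dist (fst p) x0 + dist (snd p) x0"
      unfolding dist_prod_def by (rule order_trans[OF sqrt_sum_squares_le_sum]) auto
    ultimately have "dist p (x0, x0) < \<delta>" using r unfolding r_def by linarith
    then show ?thesis using \<delta>(2)[of p] that KD by (auto simp: dist_real_def)
  qed
  have x0K: "x0 \<in> K" unfolding K_def using x0 r by simp
  \<comment> \<open>Inside the ball, finiteness of \<open>G (x, x0)\<close> is the same as the bound
    by \<open>g (x0, x0) + 1\<close>, so lower semicontinuity makes \<open>K\<close> closed.\<close>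
  have "K = {x. G (x, x0) \<le> ereal (g (x0, x0) + 1)} \<inter> cball x0 r"
  proof (intro set_eqI iffI)
    fix x assume "x \<in> K"
    then show "x \<in> {x. G (x, x0) \<le> ereal (g (x0, x0) + 1)} \<inter> cball x0 r"
      using g_bound[of "(x, x0)"] Gg[of "(x, x0)"] x0K unfolding K_def by auto
  next
    fix x assume x: "x \<in> {x. G (x, x0) \<le> ereal (g (x0, x0) + 1)} \<inter> cball x0 r"
    then have "\<bar>G (x, x0)\<bar> \<noteq> \<infinity>" using minf[of "(x, x0)"] by auto
    then show "x \<in> K" using x fin[of "(x, x0)"] unfolding K_def by auto
  qed
  moreover have "closed {x. G (x, x0) \<le> ereal (g (x0, x0) + 1)}"
    using closed_vimage[OF lsc_closed_sublevel[OF \<open>lsc G\<close>], of "\<lambda>x. (x, x0)"]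
    by (simp add: vimage_def continuous_on_Pair)
  ultimately have "compact K" by (simp add: closed_Int_compact)
  have "ball x0 (r / 4) \<subseteq> D"
  proof (rule subsetI, rule ccontr)
    fix z assume z: "z \<in> ball x0 (r / 4)" "z \<notin> D"
    \<comment> \<open>Values of \<open>g\<close> on \<open>K \<times> K\<close> differ by at most 2,
      so this penalty keeps the second component within \<open>r / 2\<close> of
      \<open>x0\<close>.\<close>
    define C where "C = 8 / r\<^sup>2"
    have C: "0 < C" unfolding C_def using r by simp
    define \<phi> where "\<phi> = (\<lambda>(k::nat) p. real k * ((fst p - z) \<bullet> (fst p - z)) + C * ((snd p - x0) \<bullet> (snd p - x0)))"
    have \<phi>_cont: "continuous_on UNIV (\<phi> k)" for k unfolding \<phi>_def by (intro continuous_intros)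
    have "\<exists>p\<in>K \<times> K. \<forall>q\<in>K \<times> K. g p + \<phi> k p \<le> g q + \<phi> k q" for k
    proof (rule continuous_attains_inf)
      show "compact (K \<times> K)" using \<open>compact K\<close> by (intro compact_Times)
      show "K \<times> K \<noteq> {}" using x0K by auto
      show "continuous_on (K \<times> K) (\<lambda>p. g p + \<phi> k p)"
        by (intro continuous_on_add continuous_on_subset[OF contg KD] continuous_on_subset[OF \<phi>_cont]) simp
    qed
    then have "\<forall>k. \<exists>p. p \<in> K \<times> K \<and> (\<forall>q\<in>K \<times> K. g p + \<phi> k p \<le> g q + \<phi> k q)" by blast
    from choice[OF this] obtain P where P: "\<And>k. P k \<in> K \<times> K"
      "\<And>k q. q \<in> K \<times> K \<Longrightarrow> g (P k) + \<phi> k (P k) \<le> g q + \<phi> k q"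
      by blast
    \<comment> \<open>From \<open>k0\<close> on, \<open>|x - z|\<^sup>2\<close> is at most
      \<open>r\<^sup>2 / 32 + r\<^sup>2 / 16\<close>, which is below \<open>r\<^sup>2 / 4\<close>.
      With the distance of \<open>z\<close> from \<open>x0\<close> this keeps the first component of
      the minimizer inside the open ball.\<close>
    define k0 where "k0 = nat \<lceil>32 / r\<^sup>2\<rceil> + 1"
    define w where "w = (\<lambda>k. ((2 * real k) *\<^sub>R (fst (P k) - z), (2 * C) *\<^sub>R (snd (P k) - x0)))"
    have subg: "- w k \<in> regular_subdiff G (P k)" if k: "k0 \<le> k" for k
    proof (rule regular_subdiff_of_local_min)
      obtain x y where xy: "P k = (x, y)" "x \<in> K" "y \<in> K" using P(1)[of k] by auto
      show "G (P k) = ereal (g (P k))" by (rule Gg) (use P(1) KD in blast)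
      show "(\<phi> k has_derivative (\<lambda>h. w k \<bullet> h)) (at (P k))"
        unfolding \<phi>_def w_def
        by (rule derivative_eq_intros refl)+
          (auto simp: fun_eq_iff inner_prod_def inner_commute algebra_simps)
      have k32: "32 / r\<^sup>2 < real k"
        using k unfolding k0_def by linarith
      have "g (x, y) + \<phi> k (x, y) \<le> g (x0, x0) + \<phi> k (x0, x0)" using P(2)[of "(x0, x0)" k] x0K xy by simp
      then have "real k * ((x - z) \<bullet> (x - z)) \<le> 1 + real k * ((x0 - z) \<bullet> (x0 - z))"
      proof -
        have "0 \<le> C * ((y - x0) \<bullet> (y - x0))" using C by simp
        moreover have "\<bar>g (x, y) - g (x0, x0)\<bar> < 1" using g_bound xy by simp
        ultimately show ?thesis
          using \<open>g (x, y) + \<phi> k (x, y) \<le> g (x0, x0) + \<phi> k (x0, x0)\<close> unfolding \<phi>_def by simp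
      qed
      then have "real k * (norm (x - z))\<^sup>2 \<le> 1 + real k * (norm (x0 - z))\<^sup>2" by (simp add: dot_square_norm)
      also have "\<dots> \<le> real k * (r\<^sup>2 / 32) + real k * (r / 4)\<^sup>2"
      proof (rule add_mono)
        show "1 \<le> real k * (r\<^sup>2 / 32)" using k32 r by (simp add: field_simps)
        have "norm (x0 - z) \<le> r / 4" using z(1) by (simp add: dist_norm)
        then show "real k * (norm (x0 - z))\<^sup>2 \<le> real k * (r / 4)\<^sup>2" by (intro mult_left_mono power_mono) auto
      qed
      also have "\<dots> \<le> real k * (r / 2)\<^sup>2"
        using r by (simp add: power2_eq_square algebra_simps)
      finally have "(norm (x - z))\<^sup>2 \<le> (r / 2)\<^sup>2"
        using k unfolding k0_def by (simp add: mult_le_cancel_left)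
      then have "norm (x - z) \<le> r / 2" by (rule power2_le_imp_le) (use r in simp)
      then have xr: "dist x0 x < r" using z(1) dist_triangle[of x0 x z] r by (simp add: dist_norm norm_minus_commute)
      have "g (x, y) + \<phi> k (x, y) \<le> g (x, x0) + \<phi> k (x, x0)" using P(2)[of "(x, x0)" k] x0K xy by simp
      then have "C * (norm (y - x0))\<^sup>2 \<le> g (x, x0) - g (x, y)" unfolding \<phi>_def by (simp add: dot_square_norm)
      also have "\<dots> \<le> 2" using g_bound[of "(x, y)"] g_bound[of "(x, x0)"] xy x0K by simp
      finally have "(norm (y - x0))\<^sup>2 \<le> (r / 2)\<^sup>2" unfolding C_def using r by (simp add: field_simps)
      then have "norm (y - x0) \<le> r / 2" by (rule power2_le_imp_le) (use r in simp)
      then have yr: "dist x0 y < r" using r by (simp add: dist_norm norm_minus_commute)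
      have "open (ball x0 r \<times> ball x0 r)" by (intro open_Times) auto
      then have "\<forall>\<^sub>F q in at (P k). q \<in> ball x0 r \<times> ball x0 r"
        by (rule topological_tendstoD[OF tendsto_ident_at]) (use xy xr yr in simp)
      then show "\<forall>\<^sub>F q in at (P k). ereal (g (P k) + \<phi> k (P k) - \<phi> k q) \<le> G q"
      proof eventually_elim
        case (elim q)
        show ?case
        proof (cases "q \<in> D \<times> D")
          case True
          then have "q \<in> K \<times> K" using elim unfolding K_def by auto
          then show ?thesis using P(2)[of q k] Gg[OF True] by simp
        next
          case False
          then have "G q = \<infinity>" using fin[of q] minf[of q] by auto
          then show ?thesis by simp
        qed
      qed
    qed
    obtain l s where l: "l \<in> K \<times> K" "strict_mono s" "(P \<circ> s) \<longlonglongrightarrow> l"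
      using compact_Times[OF \<open>compact K\<close> \<open>compact K\<close>, unfolded compact_def, rule_format, of P] P(1)
      by (elim meta_impE bexE exE conjE) auto
    obtain lx ly where lxy: "l = (lx, ly)" "lx \<in> D" "ly \<in> D" using l(1) unfolding K_def by auto
    define s' where "s' = (\<lambda>j. s (j + k0))"
    have s'_ge: "k0 \<le> s' j" "j < s' j" for j
      using seq_suble[OF l(2), of "j + k0"] unfolding s'_def k0_def by auto
    have lim: "(\<lambda>j. P (s' j)) \<longlonglongrightarrow> (lx, ly)"
      using LIMSEQ_ignore_initial_segment[OF l(3), of k0] lxy unfolding s'_def by (simp add: o_def)
    have inv: "(\<lambda>j. inverse (real (s' j))) \<longlonglongrightarrow> 0"
      using LIMSEQ_ignore_initial_segment[OF LIMSEQ_subseq_LIMSEQ[OF lim_inverse_n l(2)], of k0]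
      unfolding s'_def by (simp add: o_def)
    have "(- (2 *\<^sub>R (lx - z)), 0) \<in> horizon_subdiff G (lx, ly)"
      unfolding horizon_subdiff_def
    proof (rule CollectI, rule conjI)
      show "\<bar>G (lx, ly)\<bar> \<noteq> \<infinity>" using fin lxy by simp
    next
      show "\<exists>xs vs (r :: nat \<Rightarrow> real). xs \<longlonglongrightarrow> (lx, ly) \<and> (\<lambda>k. G (xs k)) \<longlonglongrightarrow> G (lx, ly)
            \<and> (\<forall>k. vs k \<in> regular_subdiff G (xs k))
            \<and> (\<forall>k. r k > 0) \<and> r \<longlonglongrightarrow> 0 \<and> (\<lambda>k. r k *\<^sub>R vs k) \<longlonglongrightarrow> (- (2 *\<^sub>R (lx - z)), 0)"
      proof (rule exI[of _ "\<lambda>j. P (s' j)"], rule exI[of _ "\<lambda>j. - w (s' j)"],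
          rule exI[of _ "\<lambda>j. inverse (real (s' j))"], intro conjI allI)
      show "(\<lambda>j. G (P (s' j))) \<longlonglongrightarrow> G (lx, ly)"
      proof (rule continuous_on_tendsto_compose[OF cont lim])
        show "\<forall>\<^sub>F j in sequentially. P (s' j) \<in> D \<times> D" using P(1) KD by (intro always_eventually) blast
      qed (use lxy in simp)
      have "(\<lambda>j. (- (2 *\<^sub>R (fst (P (s' j)) - z)), - ((inverse (real (s' j)) * (2 * C)) *\<^sub>R (snd (P (s' j)) - x0))))
          \<longlonglongrightarrow> (- (2 *\<^sub>R (fst (lx, ly) - z)), - ((0 * (2 * C)) *\<^sub>R (snd (lx, ly) - x0)))"
        by (intro tendsto_intros inv lim)
      moreover have "inverse (real (s' j)) *\<^sub>R - w (s' j)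
          = (- (2 *\<^sub>R (fst (P (s' j)) - z)), - ((inverse (real (s' j)) * (2 * C)) *\<^sub>R (snd (P (s' j)) - x0)))" for j
        using s'_ge(2)[of j] unfolding w_def by (simp add: field_simps)
      ultimately show "(\<lambda>j. inverse (real (s' j)) *\<^sub>R - w (s' j)) \<longlonglongrightarrow> (- (2 *\<^sub>R (lx - z)), 0)" by simp
      show "0 < inverse (real (s' j))" for j using s'_ge(2)[of j] by simp
      qed (use lim inv subg s'_ge in auto)
    qed
    then have "- (2 *\<^sub>R (lx - z)) = 0" by (rule horizon[OF lxy(2,3)])
    then show False using z(2) lxy(2) by simp
  qed
  then show "\<exists>T. open T \<and> x0 \<in> T \<and> T \<subseteq> D" using r by (intro exI[of _ "ball x0 (r / 4)"]) auto
qed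

section \<open>Convergence from proximal points\<close>

text \<open>The proximal weight exceeds \<open>P\<close> by 1, so comparing \<open>w\<close> with
  \<open>y\<close> leaves \<open>|w - y|\<^sup>2 \<le> Q * d\<^sup>2\<close> once the quadratic loss
  is cancelled. Hence \<open>w\<close> is interior to the ball and minimizes on a full
  neighbourhood.\<close>

lemma prox_point:
  fixes f :: "'a::euclidean_space \<Rightarrow> real"
  assumes "open U" and f: "continuous_on U f" and ball: "cball y \<delta> \<subseteq> U"
    and "0 \<le> P" "0 \<le> Q" "0 \<le> d" "sqrt Q * d < \<delta>"
    and lower: "\<And>z. z \<in> cball y \<delta> \<Longrightarrow> f y - Q * d\<^sup>2 - P * (norm (z - y))\<^sup>2 \<le> f z"
  obtains w where "w \<in> cball y \<delta>" "norm (w - y) \<le> sqrt Q * d" "f w \<le> f y" "f y - (Q + P * Q) * d\<^sup>2 \<le> f w"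
    "\<forall>\<^sub>F z in nhds w. z \<in> U \<and> f w + (P + 1) * (norm (w - y))\<^sup>2 \<le> f z + (P + 1) * (norm (z - y))\<^sup>2"
proof -
  have "0 \<le> sqrt Q * d" using assms by simp
  then have \<delta>: "0 < \<delta>" using assms by linarith
  have "\<exists>w\<in>cball y \<delta>. \<forall>z\<in>cball y \<delta>. f w + (P + 1) * (norm (w - y))\<^sup>2 \<le> f z + (P + 1) * (norm (z - y))\<^sup>2"
    by (intro continuous_attains_inf continuous_intros continuous_on_subset[OF f ball]) (use \<delta> in auto)
  then obtain w where w: "w \<in> cball y \<delta>"
    "\<And>z. z \<in> cball y \<delta> \<Longrightarrow> f w + (P + 1) * (norm (w - y))\<^sup>2 \<le> f z + (P + 1) * (norm (z - y))\<^sup>2"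
    by blast
  have le: "f w + (P + 1) * (norm (w - y))\<^sup>2 \<le> f y" using w(2)[of y] \<delta> by simp
  have "(norm (w - y))\<^sup>2 \<le> Q * d\<^sup>2" using le lower[OF w(1)] by (simp add: algebra_simps)
  also have "\<dots> = (sqrt Q * d)\<^sup>2" using assms by (simp add: power_mult_distrib)
  finally have n: "norm (w - y) \<le> sqrt Q * d" by (rule power2_le_imp_le) (use assms in simp)
  show thesis
  proof (rule that[of w])
    show "w \<in> cball y \<delta>" by (rule w(1))
    show "norm (w - y) \<le> sqrt Q * d" by (rule n)
    have "0 \<le> (P + 1) * (norm (w - y))\<^sup>2" using assms by simp
    then show "f w \<le> f y" using le by linarith
    have "P * (norm (w - y))\<^sup>2 \<le> P * (Q * d\<^sup>2)"
      using \<open>(norm (w - y))\<^sup>2 \<le> Q * d\<^sup>2\<close> assms by (intro mult_left_mono)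
    then show "f y - (Q + P * Q) * d\<^sup>2 \<le> f w" using lower[OF w(1)] by (simp add: algebra_simps)
    have "w \<in> ball y \<delta>" using n assms by (simp add: dist_norm norm_minus_commute)
    then have "\<forall>\<^sub>F z in nhds w. z \<in> ball y \<delta>" by (intro eventually_nhds_in_open) auto
    then show "\<forall>\<^sub>F z in nhds w. z \<in> U \<and> f w + (P + 1) * (norm (w - y))\<^sup>2 \<le> f z + (P + 1) * (norm (z - y))\<^sup>2"
    proof eventually_elim
      case (elim z)
      then show ?case using w(2)[of z] ball by auto
    qed
  qed
qed

text \<open>Expanding the square gives the slope \<open>2 * N * norm (w - y)\<close> up to a term of
  second order in \<open>z - w\<close>, which \<open>\<eta>\<close> absorbs on a small ball.\<close>

lemma slope_le_of_prox:
  fixes f :: "'a::euclidean_space \<Rightarrow> real"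
  assumes ev: "\<forall>\<^sub>F z in nhds w. z \<in> U \<and> f w + N * (norm (w - y))\<^sup>2 \<le> f z + N * (norm (z - y))\<^sup>2"
    and "0 < N" "0 < \<eta>"
  shows "slope_le U f w (2 * N * norm (w - y) + \<eta>)"
proof -
  obtain \<rho> where \<rho>: "0 < \<rho>" "\<And>z. dist z w < \<rho> \<Longrightarrow> f w + N * (norm (w - y))\<^sup>2 \<le> f z + N * (norm (z - y))\<^sup>2"
    using ev unfolding eventually_nhds_metric by blast
  have "f w - (2 * N * norm (w - y) + \<eta>) * norm (z - w) \<le> f z" if z: "norm (z - w) < min \<rho> (\<eta> / N)" for z
  proof -
    have "norm (z - y) \<le> norm (z - w) + norm (w - y)" using norm_triangle_ineq[of "z - w" "w - y"] by simp
    then have "(norm (z - y))\<^sup>2 \<le> (norm (z - w) + norm (w - y))\<^sup>2" by (intro power_mono) auto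
    then have "N * (norm (z - y))\<^sup>2 \<le> N * (norm (z - w) + norm (w - y))\<^sup>2" using assms(2) by simp
    moreover have "f w + N * (norm (w - y))\<^sup>2 \<le> f z + N * (norm (z - y))\<^sup>2"
      using \<rho>(2)[of z] z by (simp add: dist_norm)
    ultimately have "f w - f z \<le> N * (norm (z - w) + 2 * norm (w - y)) * norm (z - w)"
      by (simp add: power2_eq_square algebra_simps)
    also have "\<dots> \<le> (2 * N * norm (w - y) + \<eta>) * norm (z - w)"
    proof (rule mult_right_mono)
      have "N * norm (z - w) \<le> \<eta>" using z assms(2) by (simp add: pos_less_divide_eq mult.commute less_imp_le)
      then show "N * (norm (z - w) + 2 * norm (w - y)) \<le> 2 * N * norm (w - y) + \<eta>" by (simp add: algebra_simps)
    qed simp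
    finally show ?thesis by simp
  qed
  then show ?thesis unfolding slope_le_def
    by (intro exI[of _ "min \<rho> (\<eta> / N)"]) (use \<rho>(1) assms in simp)
qed

lemma regular_subdiff_of_prox:
  fixes f :: "'a::euclidean_space \<Rightarrow> ereal"
  assumes ev: "\<forall>\<^sub>F z in nhds w. z \<in> U \<and> g w + N * (norm (w - y))\<^sup>2 \<le> g z + N * (norm (z - y))\<^sup>2"
    and fg: "\<And>z. z \<in> U \<Longrightarrow> f z = ereal (g z)"
  shows "- ((2 * N) *\<^sub>R (w - y)) \<in> regular_subdiff f w"
proof (rule regular_subdiff_of_local_min)
  show "f w = ereal (g w)" using eventually_nhds_x_imp_x[OF ev] fg by simp
  have "((\<lambda>z. N * ((z - y) \<bullet> (z - y))) has_derivative (\<lambda>h. ((2 * N) *\<^sub>R (w - y)) \<bullet> h)) (at w)"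
    by (rule derivative_eq_intros refl)+ (auto simp: fun_eq_iff inner_commute algebra_simps)
  then show "((\<lambda>z. N * (norm (z - y))\<^sup>2) has_derivative (\<lambda>h. ((2 * N) *\<^sub>R (w - y)) \<bullet> h)) (at w)"
    by (simp add: dot_square_norm)
  have "\<forall>\<^sub>F z in at w. z \<in> U \<and> g w + N * (norm (w - y))\<^sup>2 \<le> g z + N * (norm (z - y))\<^sup>2"
    unfolding eventually_at_filter using ev by (rule eventually_mono) blast
  then show "\<forall>\<^sub>F z in at w. ereal (g w + N * (norm (w - y))\<^sup>2 - N * (norm (z - y))\<^sup>2) \<le> f z"
    by eventually_elim (use fg in auto)
qed

text \<open>No subgradient of \<open>f\<close> at the iterates \<open>y k\<close> is available; the assumption \<open>lower\<close> replaces it by one at a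
  nearby proximal point.\<close>

lemma (in o_minimal_structure) convergence:
  fixes f :: "'a::euclidean_space \<Rightarrow> ereal" and g :: "'a \<Rightarrow> real" and y :: "nat \<Rightarrow> 'a"
  assumes U: "dset U" and g: "dfun g" and "open U" and fg: "\<And>z. z \<in> U \<Longrightarrow> f z = ereal (g z)"
    and cont: "continuous_on U g"
    and K: "compact K" "K \<subseteq> U" "range y \<subseteq> K"
    and "0 < \<alpha>" "0 \<le> P" "0 \<le> Q" "0 < \<delta>" "\<And>k. cball (y k) \<delta> \<subseteq> U"
    and descent: "\<And>k. \<alpha> * (norm (y (Suc k) - y k))\<^sup>2 \<le> g (y k) - g (y (Suc k))"
    and lower: "\<And>k z. z \<in> cball (y (Suc k)) \<delta> \<Longrightarrow>
      g (y (Suc k)) - Q * (norm (y (Suc k) - y k))\<^sup>2 - P * (norm (z - y (Suc k)))\<^sup>2 \<le> g z"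
  shows "\<exists>l. y \<longlonglongrightarrow> l \<and> l \<in> crit f"
proof -
  define d where "d = (\<lambda>k. norm (y (Suc k) - y k))"
  have "decseq (\<lambda>k. g (y k))"
  proof (rule decseq_SucI)
    show "g (y (Suc k)) \<le> g (y k)" for k
    proof -
      have "0 \<le> \<alpha> * (norm (y (Suc k) - y k))\<^sup>2" using \<open>0 < \<alpha>\<close> by simp
      then show ?thesis using descent[of k] by linarith
    qed
  qed
  moreover have "compact (g ` K)" by (rule compact_continuous_image[OF continuous_on_subset[OF cont K(2)] K(1)])
  then have "bdd_below (g ` K)" by (rule bounded_imp_bdd_below[OF compact_imp_bounded])
  then obtain L where "\<And>z. z \<in> K \<Longrightarrow> L \<le> g z" unfolding bdd_below_def by auto
  then have "\<forall>k. L \<le> g (y k)" using K(3) by auto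
  ultimately obtain c where c: "(\<lambda>k. g (y k)) \<longlonglongrightarrow> c" "\<And>k. c \<le> g (y k)"
    by (rule decseq_convergent) blast
  define a where "a = (\<lambda>k. g (y k) - c)"
  have a_lim: "a \<longlonglongrightarrow> 0" unfolding a_def using tendsto_diff[OF c(1) tendsto_const[of c]] by simp
  have a: "0 \<le> a k" for k unfolding a_def using c(2) by simp
  have desc: "\<alpha> * (d k)\<^sup>2 \<le> a k - a (Suc k)" for k unfolding a_def d_def using descent by simp
  have "(\<lambda>k. d k) \<longlonglongrightarrow> 0"
  proof -
    have "(\<lambda>k. (a k - a (Suc k)) / \<alpha>) \<longlonglongrightarrow> (0 - 0) / \<alpha>"
      by (intro tendsto_intros a_lim LIMSEQ_Suc) (use \<open>0 < \<alpha>\<close> in simp)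
    then have lim: "(\<lambda>k. (a k - a (Suc k)) / \<alpha>) \<longlonglongrightarrow> 0" by simp
    have "(\<lambda>k. (d k)\<^sup>2) \<longlonglongrightarrow> 0"
    proof (rule tendsto_sandwich[OF _ _ tendsto_const lim])
      show "\<forall>\<^sub>F k in sequentially. (d k)\<^sup>2 \<le> (a k - a (Suc k)) / \<alpha>"
        using desc \<open>0 < \<alpha>\<close> by (intro always_eventually) (simp add: pos_le_divide_eq mult.commute)
    qed simp
    from tendsto_real_sqrt[OF this] show ?thesis by (simp add: d_def)
  qed
  obtain R where R: "\<And>z. z \<in> K \<Longrightarrow> norm z \<le> R"
    using compact_imp_bounded[OF K(1)] unfolding bounded_iff by blast
  \<comment> \<open>The radius \<open>R + \<delta>\<close> covers the proximal points, which may
    leave \<open>K\<close> by at most \<open>\<delta>\<close>.\<close>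
  obtain e :: real and \<psi> \<gamma> :: "real \<Rightarrow> real"
    where e: "e > 0"
    and \<gamma>_pos: "\<And>t. 0 < t \<Longrightarrow> t < e \<Longrightarrow> 0 < \<gamma> t"
    and \<gamma>_mono: "\<And>s t. 0 < s \<Longrightarrow> s \<le> t \<Longrightarrow> t < e \<Longrightarrow> \<gamma> s \<le> \<gamma> t"
    and \<psi>: "\<And>s t. 0 \<le> s \<Longrightarrow> s \<le> t \<Longrightarrow> t < e \<Longrightarrow> t - s \<le> \<gamma> t * (\<psi> t - \<psi> s)"
    and KL: "\<And>z r. z \<in> U \<Longrightarrow> norm z \<le> R + \<delta> \<Longrightarrow> c < g z \<Longrightarrow> g z < c + e \<Longrightarrow> 0 < r \<Longrightarrow> slope_le U g z r
      \<Longrightarrow> \<gamma> (g z - c) \<le> r"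
    by (rule desingularization[OF U g, where R = "R + \<delta>" and c = c]) (rule that)
  have "\<forall>\<^sub>F k in sequentially. a k < e \<and> sqrt Q * d k < \<delta>"
  proof (rule eventually_conj)
    show "\<forall>\<^sub>F k in sequentially. a k < e" by (rule order_tendstoD(2)[OF a_lim e])
    have "(\<lambda>k. sqrt Q * d k) \<longlonglongrightarrow> sqrt Q * 0" by (intro tendsto_intros \<open>d \<longlonglongrightarrow> 0\<close>)
    then show "\<forall>\<^sub>F k in sequentially. sqrt Q * d k < \<delta>" using \<open>0 < \<delta>\<close> by (intro order_tendstoD(2)) auto
  qed
  then obtain k0 where k0: "\<And>k. k0 \<le> k \<Longrightarrow> a k < e \<and> sqrt Q * d k < \<delta>"
    unfolding eventually_sequentially by blast
  define N where "N = P + 1"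
  have N: "0 < N" unfolding N_def using \<open>0 \<le> P\<close> by simp
  \<comment> \<open>One constant for the loss of value \<open>(Q + P * Q) * d\<^sup>2\<close> and
    the slope \<open>2 * N * sqrt Q * d\<close>; the 1 makes it positive.\<close>
  define C where "C = Q + P * Q + 2 * N * sqrt Q + 1"
  have C: "0 < C" "Q + P * Q \<le> C" "2 * N * sqrt Q \<le> C"
    unfolding C_def using \<open>0 \<le> P\<close> \<open>0 \<le> Q\<close> N by (auto intro: add_nonneg_nonneg add_nonneg_pos)
  \<comment> \<open>Indices start at \<open>k0\<close>, where the gap is below \<open>e\<close> and
    the proximal displacement below \<open>\<delta>\<close>.\<close>
  have "\<forall>k. \<exists>w. w \<in> cball (y (Suc (k + k0))) \<delta> \<and> norm (w - y (Suc (k + k0))) \<le> sqrt Q * d (k + k0) \<and> g w \<le> g (y (Suc (k + k0)))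
      \<and> g (y (Suc (k + k0))) - (Q + P * Q) * (d (k + k0))\<^sup>2 \<le> g w
      \<and> (\<forall>\<^sub>F z in nhds w. z \<in> U \<and> g w + N * (norm (w - y (Suc (k + k0))))\<^sup>2 \<le> g z + N * (norm (z - y (Suc (k + k0))))\<^sup>2)"
  proof
    fix k
    have 1: "sqrt Q * d (k + k0) < \<delta>" using k0[of "k + k0"] by simp
    have 2: "0 \<le> d (k + k0)" unfolding d_def by simp
    have 3: "g (y (Suc (k + k0))) - Q * (d (k + k0))\<^sup>2 - P * (norm (z - y (Suc (k + k0))))\<^sup>2 \<le> g z"
      if "z \<in> cball (y (Suc (k + k0))) \<delta>" for z
      using lower[OF that] unfolding d_def .
    show "\<exists>w. w \<in> cball (y (Suc (k + k0))) \<delta> \<and> norm (w - y (Suc (k + k0))) \<le> sqrt Q * d (k + k0) \<and> g w \<le> g (y (Suc (k + k0)))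
      \<and> g (y (Suc (k + k0))) - (Q + P * Q) * (d (k + k0))\<^sup>2 \<le> g w
      \<and> (\<forall>\<^sub>F z in nhds w. z \<in> U \<and> g w + N * (norm (w - y (Suc (k + k0))))\<^sup>2 \<le> g z + N * (norm (z - y (Suc (k + k0))))\<^sup>2)"
      by (rule prox_point[OF \<open>open U\<close> cont assms(13) \<open>0 \<le> P\<close> \<open>0 \<le> Q\<close> 2 1 3], assumption)
        (unfold N_def, blast)
  qed
  from choice[OF this] obtain w where w: "\<And>k. w k \<in> cball (y (Suc (k + k0))) \<delta>"
      "\<And>k. norm (w k - y (Suc (k + k0))) \<le> sqrt Q * d (k + k0)" "\<And>k. g (w k) \<le> g (y (Suc (k + k0)))"
      "\<And>k. g (y (Suc (k + k0))) - (Q + P * Q) * (d (k + k0))\<^sup>2 \<le> g (w k)"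
      "\<And>k. \<forall>\<^sub>F z in nhds (w k). z \<in> U \<and> g (w k) + N * (norm (w k - y (Suc (k + k0))))\<^sup>2 \<le> g z + N * (norm (z - y (Suc (k + k0))))\<^sup>2"
    by auto
  have wU: "w k \<in> U" for k using w(1)[of k] assms(13) by blast
  have "summable (\<lambda>k. d (k + k0))"
  proof (rule finite_length[of \<alpha> C "\<lambda>k. d (k + k0)" "\<lambda>k. a (k + k0)" e \<gamma> \<psi>])
    show "\<exists>b\<le>a (Suc k + k0). a (Suc k + k0) - C * (d (k + k0))\<^sup>2 \<le> b \<and> (0 < b \<longrightarrow> \<gamma> b \<le> C * d (k + k0))" for k
    proof (rule exI[of _ "g (w k) - c"], intro conjI impI)
      show "g (w k) - c \<le> a (Suc k + k0)" using w(3)[of k] unfolding a_def by simp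
      have "(Q + P * Q) * (d (k + k0))\<^sup>2 \<le> C * (d (k + k0))\<^sup>2" using C(2) by (rule mult_right_mono) simp
      then show "a (Suc k + k0) - C * (d (k + k0))\<^sup>2 \<le> g (w k) - c" using w(4)[of k] unfolding a_def by simp
      assume "0 < g (w k) - c"
      show "\<gamma> (g (w k) - c) \<le> C * d (k + k0)"
      proof (rule field_le_epsilon)
        fix \<eta> :: real assume \<eta>: "0 < \<eta>"
        have "0 \<le> 2 * N * norm (w k - y (Suc (k + k0)))" using N by simp
        have "\<gamma> (g (w k) - c) \<le> 2 * N * norm (w k - y (Suc (k + k0))) + \<eta>"
        proof (rule KL[OF wU _ _ _ _ slope_le_of_prox[OF w(5) N \<eta>]])
          have "norm (y (Suc (k + k0))) \<le> R" using R K(3) by blast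
          moreover have "norm (w k) \<le> norm (y (Suc (k + k0))) + \<delta>"
            using w(1)[of k] norm_triangle_ineq2[of "w k" "y (Suc (k + k0))"] by (simp add: dist_norm norm_minus_commute)
          ultimately show "norm (w k) \<le> R + \<delta>" by simp
          show "c < g (w k)" using \<open>0 < g (w k) - c\<close> by simp
          show "g (w k) < c + e" using w(3)[of k] k0[of "Suc (k + k0)"] unfolding a_def by simp
        qed (use \<open>0 \<le> 2 * N * norm (w k - y (Suc (k + k0)))\<close> \<eta> in simp)
        also have "2 * N * norm (w k - y (Suc (k + k0))) \<le> 2 * N * (sqrt Q * d (k + k0))"
          using w(2) N by (intro mult_left_mono) auto
        also have "2 * N * (sqrt Q * d (k + k0)) = 2 * N * sqrt Q * d (k + k0)" by simp
        also have "\<dots> \<le> C * d (k + k0)" using C(3) by (rule mult_right_mono) (simp add: d_def)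
        finally show "\<gamma> (g (w k) - c) \<le> C * d (k + k0) + \<eta>" by simp
      qed
    qed
    show "0 \<le> d (k + k0)" for k by (simp add: d_def)
    show "a (k + k0) < e" for k using k0[of "k + k0"] by simp
    show "\<alpha> * (d (k + k0))\<^sup>2 \<le> a (k + k0) - a (Suc k + k0)" for k using desc[of "k + k0"] by simp
  qed (fact | rule a)+
  then have "summable d" by (simp add: summable_iff_shift)
  then have "summable (\<lambda>k. y (Suc k) - y k)" unfolding d_def by (rule summable_norm_cancel)
  then have "(\<lambda>n. \<Sum>k<n. y (Suc k) - y k) \<longlonglongrightarrow> (\<Sum>k. y (Suc k) - y k)" by (rule summable_LIMSEQ)
  then have "(\<lambda>n. (\<Sum>k<n. y (Suc k) - y k) + y 0) \<longlonglongrightarrow> (\<Sum>k. y (Suc k) - y k) + y 0"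
    by (intro tendsto_intros)
  then obtain l where l: "y \<longlonglongrightarrow> l" by (auto simp: sum_lessThan_telescope)
  have "l \<in> K" by (rule closed_sequentially[OF compact_imp_closed[OF K(1)] _ l]) (use K(3) in blast)
  then have lU: "l \<in> U" using K(2) by blast
  have y_lim: "(\<lambda>k. y (Suc (k + k0))) \<longlonglongrightarrow> l"
    using LIMSEQ_ignore_initial_segment[OF LIMSEQ_Suc[OF l], of k0] by simp
  have wy: "(\<lambda>k. w k - y (Suc (k + k0))) \<longlonglongrightarrow> 0"
  proof (rule Lim_null_comparison)
    show "\<forall>\<^sub>F k in sequentially. norm (w k - y (Suc (k + k0))) \<le> sqrt Q * d (k + k0)"
      using w(2) by (intro always_eventually) blast
    have "(\<lambda>k. sqrt Q * d (k + k0)) \<longlonglongrightarrow> sqrt Q * 0"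
      by (intro tendsto_intros LIMSEQ_ignore_initial_segment \<open>d \<longlonglongrightarrow> 0\<close>)
    then show "(\<lambda>k. sqrt Q * d (k + k0)) \<longlonglongrightarrow> 0" by simp
  qed
  from tendsto_add[OF wy y_lim] have w_lim: "w \<longlonglongrightarrow> l" by simp
  have "(\<lambda>k. g (w k)) \<longlonglongrightarrow> g l"
    by (rule continuous_on_tendsto_compose[OF cont w_lim lU]) (use wU in \<open>simp add: always_eventually\<close>)
  then have f_lim: "(\<lambda>k. f (w k)) \<longlonglongrightarrow> f l" using fg wU lU by simp
  have "(\<lambda>k. - ((2 * N) *\<^sub>R (w k - y (Suc (k + k0))))) \<longlonglongrightarrow> - ((2 * N) *\<^sub>R 0)"
    by (intro tendsto_intros wy)
  then have v_lim: "(\<lambda>k. - ((2 * N) *\<^sub>R (w k - y (Suc (k + k0))))) \<longlonglongrightarrow> 0" by simp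
  have "0 \<in> subdiff f l"
    unfolding subdiff_def mem_Collect_eq
  proof (rule conjI, goal_cases)
    case 1
    show ?case using fg lU by simp
  next
    case 2
    show ?case
      by (rule exI[of _ w], rule exI[of _ "\<lambda>k. - ((2 * N) *\<^sub>R (w k - y (Suc (k + k0))))"])
        (intro conjI allI w_lim f_lim v_lim regular_subdiff_of_prox[OF w(5) fg])
  qed
  then show ?thesis unfolding crit_def using l by blast
qed

theorem theorem28:
  fixes f :: "real ^ 'n \<Rightarrow> ereal"
    and m :: "real ^ 'n \<Rightarrow> real ^ 'n \<Rightarrow> ereal"
    and h :: "real ^ 'n \<Rightarrow> ereal"
    and Lb Lu \<tau>' :: real
    and \<tau> :: "nat \<Rightarrow> real"
    and x :: "nat \<Rightarrow> real ^ 'n"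
  assumes "objective_assumption f"
    and "\<And>xb. xb \<in> edom f \<Longrightarrow> model_function f xb (\<lambda>z. m z xb)"
    and "model_assumption f m h Lb Lu"
    and "relative_error_assumption f m h"
    and "definability_assumption f m h"
    and "local_strong_convexity_assumption h"
    and "model_BPG f m h Lb \<tau> x"
    and "\<tau>' > 0" and "\<tau> \<longlonglongrightarrow> \<tau>'"
    and "\<And>l r. strict_mono r \<Longrightarrow> (x \<circ> r) \<longlonglongrightarrow> l \<Longrightarrow> l \<in> interior (edom h)"
  shows "\<exists>xs. x \<longlonglongrightarrow> xs \<and> xs \<in> crit f"
proof -

  \<comment> \<open>Real-valued data and openness of the domain\<close>
  define U I J where "U = edom f" and "I = interior (edom h)" and "J = joint_model f m"
  have f_minf: "f z \<noteq> - \<infinity>" for z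
    using assms(1) unfolding objective_assumption_def proper_def by simp
  have "lsc f" and coercive: "(f \<longlongrightarrow> \<infinity>) at_infinity"
    using assms(1) unfolding objective_assumption_def by simp_all
  have m_minf: "m z y \<noteq> - \<infinity>" and m_dom: "m z y < \<infinity> \<longleftrightarrow> z \<in> U" if "y \<in> U" for z y
  proof -
    have "(\<forall>z. m z y \<noteq> - \<infinity>) \<and> edom (\<lambda>z. m z y) = edom f"
      using assms(2)[OF that[unfolded U_def]] unfolding model_function_def by simp
    then show "m z y \<noteq> - \<infinity>" "m z y < \<infinity> \<longleftrightarrow> z \<in> U" unfolding U_def edom_def by auto
  qed
  define g where "g = (\<lambda>z. real_of_ereal (f z))"
  define mr where "mr = (\<lambda>z y. real_of_ereal (m z y))"
  have fg: "f z = ereal (g z)" if "z \<in> U" for z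
    using that f_minf[of z] unfolding U_def edom_def g_def by (cases "f z") auto
  have mm: "m z y = ereal (mr z y)" if "z \<in> U" "y \<in> U" for z y
    using m_minf[OF that(2), of z] m_dom[OF that(2), of z] that(1) unfolding mr_def by (cases "m z y") auto
  \<comment> \<open>A growth function vanishes at 0, so the model around \<open>z\<close> is exact
    at \<open>z\<close>.\<close>
  have diag: "mr z z = g z" if z: "z \<in> U" for z
  proof -
    obtain \<omega> where "growth_function \<omega>" "\<forall>v\<in>edom f. \<bar>f v - m v z\<bar> \<le> ereal (\<omega> (norm (v - z)))"
      using assms(2)[OF z[unfolded U_def]] unfolding model_function_def by (elim conjE exE)
    then have "\<bar>ereal (g z) - ereal (mr z z)\<bar> \<le> ereal 0"
      using z fg[OF z] mm[OF z z] unfolding growth_function_def U_def by fastforce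
    then show ?thesis by simp
  qed
  have J: "J (z, y) = (if y \<in> U then m z y else \<infinity>)" for z y
    unfolding J_def joint_model_def U_def by simp
  have "lsc J" and J_cont: "continuous_on (U \<times> U) J"
    using assms(3) unfolding model_assumption_def J_def U_def by - (elim conjE, assumption)+
  have hz: "\<forall>z\<in>U. \<forall>y\<in>U. (\<forall>v. (0, v) \<in> horizon_subdiff J (z, y) \<longrightarrow> v = 0)
          \<and> (\<forall>v. (v, 0) \<in> horizon_subdiff J (z, y) \<longrightarrow> v = 0) \<and> subdiff_regular_at J (z, y)"
    using assms(3) unfolding model_assumption_def J_def U_def by (elim conjE)
  have "open U"
  proof (rule open_domain[of J U])
    show "\<bar>J p\<bar> \<noteq> \<infinity> \<longleftrightarrow> p \<in> U \<times> U" for p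
    proof (cases p)
      case (Pair z y)
      then show ?thesis using J[of z y] m_minf[of y z] m_dom[of y z] by (cases "m z y") auto
    qed
    show "J p \<noteq> - \<infinity>" for p
    proof (cases p)
      case (Pair z y)
      then show ?thesis using J[of z y] m_minf[of y z] by simp
    qed
    show "v = 0" if "z \<in> U" "y \<in> U" "(v, 0) \<in> horizon_subdiff J (z, y)" for z y v
      using bspec[OF bspec[OF hz that(1)] that(2)] that(3) by simp
  qed fact+
  \<comment> \<open>The joint model restricted to the diagonal is \<open>f\<close>.\<close>
  have g_cont: "continuous_on U g"
  proof -
    have "continuous_on U (\<lambda>z. J (z, z))"
      by (rule continuous_on_compose2[OF J_cont, of U "\<lambda>z. (z, z)"]) (auto intro!: continuous_intros)
    then have "continuous_on U (\<lambda>z. ereal (g z))"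
      by (rule continuous_on_cong[THEN iffD1, rotated -1]) (use J mm diag in auto)
    then show ?thesis
      using continuous_on_iff_real[of U "\<lambda>z. ereal (g z)"] by (simp add: o_def)
  qed

  \<comment> \<open>The domain of the objective lies in the interior of the domain of
    \<open>h\<close>\<close>
  have leg: "legendre h" and C2: "C2_on_interior h" and dom: "edom f \<subseteq> closure (edom h)"
    and "Lb > 0" and MAP: "MAP_property f m h Lb Lu"
    using assms(3) unfolding model_assumption_def by - (elim conjE, assumption)+
  have h_minf: "h z \<noteq> - \<infinity>" for z
    using leg unfolding legendre_def proper_def by simp
  define hr where "hr = (\<lambda>z. real_of_ereal (h z))"
  have hh: "h z = ereal (hr z)" if "z \<in> edom h" for z
    using that h_minf[of z] unfolding edom_def hr_def by (cases "h z") auto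
  have "edom h = fst ` epi h"
  proof (intro set_eqI iffI)
    fix z assume "z \<in> edom h"
    then have "(z, hr z) \<in> epi h" unfolding epi_def using hh by simp
    then show "z \<in> fst ` epi h" by force
  next
    fix z assume "z \<in> fst ` epi h"
    then obtain t where "h z \<le> ereal t" unfolding epi_def by auto
    then show "z \<in> edom h" unfolding edom_def by auto
  qed
  moreover have "convex (epi h)" using leg unfolding legendre_def by (elim conjE)
  ultimately have "convex (edom h)" using convex_linear_image[OF linear_fst] by metis
  then have "convex I" unfolding I_def by (rule convex_interior)
  \<comment> \<open>A convex set with nonempty interior has the same interior as its closure; if its
    interior is empty, so is that of its closure. An open subset of the closure is thus inside
    \<open>I\<close>.\<close>
  have "U \<subseteq> interior (closure (edom h))"
    by (rule interior_maximal[OF _ \<open>open U\<close>]) (use dom in \<open>simp add: U_def\<close>)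
  then have UI: "U \<subseteq> I" unfolding I_def convex_interior_closure[OF \<open>convex (edom h)\<close>] .
  have "open I" unfolding I_def by simp
  have I_dom: "I \<subseteq> edom h" unfolding I_def by (rule interior_subset)

  \<comment> \<open>Real-valued Bregman distances\<close>
  define D where "D = (\<lambda>u v. hr u - hr v - egrad h v \<bullet> (u - v))"
  have breg: "bregman h u v = ereal (D u v)" if "u \<in> I" "v \<in> I" for u v
    using that I_dom hh[of u] hh[of v] unfolding bregman_def D_def I_def by auto
  have D_self: "D u u = 0" for u unfolding D_def by simp
  have strong: "\<exists>\<sigma>>0. \<forall>u\<in>B. \<forall>v\<in>B. \<sigma> / 2 * (norm (u - v))\<^sup>2 \<le> D u v"
    if B: "compact B" "convex B" "B \<subseteq> I" for B
  proof -
    obtain \<sigma> where \<sigma>: "\<sigma> > 0" "\<forall>u\<in>B. \<forall>v\<in>B. ereal (\<sigma> / 2 * (norm (u - v))\<^sup>2) \<le> bregman h u v"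
      using assms(6) B unfolding local_strong_convexity_assumption_def I_def by metis
    have "\<sigma> / 2 * (norm (u - v))\<^sup>2 \<le> D u v" if "u \<in> B" "v \<in> B" for u v
      using bspec[OF bspec[OF \<sigma>(2) that(1)] that(2)]
      unfolding breg[OF subsetD[OF B(3) that(1)] subsetD[OF B(3) that(2)]] by simp
    then show ?thesis using \<sigma>(1) by blast
  qed
  have D_nonneg: "0 \<le> D u v" if "u \<in> I" "v \<in> I" for u v
  proof -
    have "closed_segment u v \<subseteq> I" by (rule closed_segment_subset[OF that \<open>convex I\<close>])
    from strong[OF compact_segment convex_closed_segment this] obtain \<sigma>
      where \<sigma>: "\<sigma> > 0" "\<forall>a\<in>closed_segment u v. \<forall>b\<in>closed_segment u v. \<sigma> / 2 * (norm (a - b))\<^sup>2 \<le> D a b"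
      by (elim exE conjE)
    have "0 \<le> \<sigma> / 2 * (norm (u - v))\<^sup>2" using \<sigma>(1) by simp
    also have "\<dots> \<le> D u v" using \<sigma>(2) by simp
    finally show ?thesis .
  qed

  \<comment> \<open>Shifted iterates, sufficient decrease and the initial sublevel set\<close>
  define y where "y = (\<lambda>k. x (Suc k))"
  define t where "t = (\<lambda>k. \<tau> (Suc k))"
  have argmin: "y (Suc k) \<in> Argmin (\<lambda>z. m z (y k) + ereal (1 / t k) * bregman h z (y k))" for k
    using assms(7) unfolding model_BPG_def y_def t_def by simp
  have "y 0 \<in> U" using assms(7) unfolding model_BPG_def y_def U_def by simp
  have yU: "y k \<in> U" for k
  proof (induction k)
    case (Suc k)
    have "m (y (Suc k)) (y k) + ereal (1 / t k) * bregman h (y (Suc k)) (y k) < \<infinity>"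
      using argmin[of k] unfolding Argmin_def by simp
    then have "m (y (Suc k)) (y k) < \<infinity>" by (cases "m (y (Suc k)) (y k)") auto
    then show ?case using m_dom[OF Suc] by simp
  qed fact
  have yI: "y k \<in> I" for k using yU UI by blast
  obtain \<tau>l \<tau>u where \<tau>: "0 < \<tau>l" "\<tau>l < \<tau>u" "\<tau>u < 1 / Lb" "\<forall>k\<ge>1. \<tau> k \<in> {\<tau>l..\<tau>u}"
    using assms(7) unfolding model_BPG_def by (elim conjE exE)
  have t: "\<tau>l \<le> t k" "t k \<le> \<tau>u" for k using \<tau>(4) unfolding t_def by auto
  have t_inv: "1 / \<tau>u \<le> 1 / t k" "1 / t k \<le> 1 / \<tau>l" for k
    using t[of k] \<tau>(1,2) by (auto intro!: divide_left_mono)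
  have opt: "mr (y (Suc k)) (y k) + 1 / t k * D (y (Suc k)) (y k) \<le> mr z (y k) + 1 / t k * D z (y k)"
    if "z \<in> U" for z k
  proof -
    have "m (y (Suc k)) (y k) + ereal (1 / t k) * bregman h (y (Suc k)) (y k) \<le> m z (y k) + ereal (1 / t k) * bregman h z (y k)"
      using argmin[of k] unfolding Argmin_def by simp
    then show ?thesis using mm[OF yU yU] mm[OF that yU] breg[OF yI yI] breg[OF _ yI] that UI by auto
  qed
  have MAP_r: "- Lu * D z v \<le> g z - mr z v" "g z - mr z v \<le> Lb * D z v" if "z \<in> U" "v \<in> U" for z v
  proof -
    have "ereal (- Lu) * bregman h z v \<le> f z - m z v \<and> f z - m z v \<le> ereal Lb * bregman h z v"
    proof -
      have "v \<in> edom f \<inter> interior (edom h)" "z \<in> edom f \<inter> edom h"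
        using that UI I_dom unfolding U_def I_def by auto
      from bspec[OF bspec[OF MAP[unfolded MAP_property_def] this(1)] this(2)] show ?thesis .
    qed
    moreover have "bregman h z v = ereal (D z v)" using breg that UI by blast
    ultimately show "- Lu * D z v \<le> g z - mr z v" "g z - mr z v \<le> Lb * D z v"
      using fg[OF that(1)] mm[OF that] by simp_all
  qed
  \<comment> \<open>The Bregman term has weight at least \<open>1 / \<tau>u\<close>, and passing
    from the model to \<open>f\<close> costs \<open>Lb\<close>; the step size restriction makes the
    difference positive.\<close>
  define \<kappa> where "\<kappa> = 1 / \<tau>u - Lb"
  have \<kappa>: "0 < \<kappa>" unfolding \<kappa>_def using \<tau> \<open>Lb > 0\<close> by (simp add: field_simps)
  have decrease: "\<kappa> * D (y (Suc k)) (y k) \<le> g (y k) - g (y (Suc k))" for k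
  proof -
    have "(1 / \<tau>u) * D (y (Suc k)) (y k) \<le> 1 / t k * D (y (Suc k)) (y k)"
      using t_inv(1) D_nonneg[OF yI yI] by (rule mult_right_mono)
    \<comment> \<open>Comparison with the previous iterate, where the model is exact and the Bregman
      distance is 0.\<close>
    then show ?thesis
      using opt[OF yU, of k k] MAP_r(2)[OF yU yU, of "Suc k" k] D_self diag[OF yU]
      unfolding \<kappa>_def by (simp add: algebra_simps)
  qed
  define K where "K = {z. f z \<le> f (y 0)}"
  have "K \<subseteq> U" unfolding K_def U_def edom_def using fg[OF \<open>y 0 \<in> U\<close>] by auto
  have "compact K"
  proof -
    have "\<forall>\<^sub>F z in at_infinity. f (y 0) < f z"
      using coercive[unfolded tendsto_PInfty] fg[OF \<open>y 0 \<in> U\<close>] by simp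
    then obtain b where b: "\<And>z. b \<le> norm z \<Longrightarrow> f (y 0) < f z" unfolding eventually_at_infinity by blast
    have "bounded K" unfolding bounded_iff
    proof (intro exI ballI)
      fix z assume "z \<in> K"
      then have "\<not> f (y 0) < f z" unfolding K_def by (simp add: not_less)
      then show "norm z \<le> b" using b[of z] by (cases "b \<le> norm z") simp_all
    qed
    moreover have "closed K" unfolding K_def by (rule lsc_closed_sublevel[OF \<open>lsc f\<close>])
    ultimately show ?thesis by (simp add: compact_eq_bounded_closed)
  qed
  have g_le: "g (y k) \<le> g (y 0)" for k
  proof (induction k)
    case (Suc k)
    have "0 \<le> \<kappa> * D (y (Suc k)) (y k)" using \<kappa> D_nonneg[OF yI yI] by simp
    then show ?case using decrease[of k] Suc by linarith
  qed simp
  have yK: "y k \<in> K" for k unfolding K_def using g_le[of k] fg[OF yU] by simp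

  \<comment> \<open>A compact convex neighbourhood with two-sided quadratic bounds\<close>
  have "convex hull K \<subseteq> I" by (rule hull_minimal[of K I convex, OF subset_trans[OF \<open>K \<subseteq> U\<close> UI] \<open>convex I\<close>])
  then obtain \<epsilon>1 where \<epsilon>1: "\<epsilon>1 > 0" "(\<Union>z\<in>convex hull K. ball z \<epsilon>1) \<subseteq> I"
    by (rule compact_subset_open_imp_ball_epsilon_subset[OF compact_convex_hull[OF \<open>compact K\<close>] \<open>open I\<close>])
  obtain \<epsilon>2 where \<epsilon>2: "\<epsilon>2 > 0" "(\<Union>z\<in>K. ball z \<epsilon>2) \<subseteq> U"
    by (rule compact_subset_open_imp_ball_epsilon_subset[OF \<open>compact K\<close> \<open>open U\<close> \<open>K \<subseteq> U\<close>])
  define \<delta> where "\<delta> = min \<epsilon>1 \<epsilon>2 / 2"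
  have \<delta>: "0 < \<delta>" "\<delta> < \<epsilon>1" "\<delta> < \<epsilon>2" unfolding \<delta>_def using \<epsilon>1(1) \<epsilon>2(1) by auto
  have ballU: "cball (y k) \<delta> \<subseteq> U" for k
  proof
    fix z assume "z \<in> cball (y k) \<delta>"
    then have "z \<in> ball (y k) \<epsilon>2" using \<delta> by simp
    then show "z \<in> U" using \<epsilon>2(2) yK by blast
  qed
  \<comment> \<open>Convexity serves both local strong convexity and the mean value inequality for
    the gradient, hence the convex hull of \<open>K\<close>, thickened by
    \<open>\<delta>\<close>.\<close>
  define B where "B = (\<Union>u\<in>convex hull K. \<Union>v\<in>cball 0 \<delta>. {u + v})"
  have "compact B" unfolding B_def by (intro compact_sums' compact_convex_hull \<open>compact K\<close> compact_cball)
  have "convex B" unfolding B_def by (intro convex_sums convex_convex_hull convex_cball)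
  have "B \<subseteq> I"
  proof
    fix z assume "z \<in> B"
    then obtain u v where uv: "u \<in> convex hull K" "norm v \<le> \<delta>" "z = u + v" unfolding B_def by auto
    then have "z \<in> ball u \<epsilon>1" using \<delta> by (simp add: dist_norm)
    then show "z \<in> I" using \<epsilon>1(2) uv(1) by blast
  qed
  have ballB: "cball (y k) \<delta> \<subseteq> B" for k
  proof
    fix z assume z: "z \<in> cball (y k) \<delta>"
    have "y k \<in> convex hull K" by (rule hull_inc[OF yK])
    moreover have "z - y k \<in> cball 0 \<delta>" using z by (simp add: dist_norm norm_minus_commute)
    moreover have "z \<in> {y k + (z - y k)}" by simp
    ultimately show "z \<in> B" unfolding B_def by (intro UN_I)
  qed
  have yB: "y k \<in> B" for k using ballB[of k] \<delta>(1) by auto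
  obtain \<sigma> where \<sigma>: "\<sigma> > 0" "\<And>u v. u \<in> B \<Longrightarrow> v \<in> B \<Longrightarrow> \<sigma> / 2 * (norm (u - v))\<^sup>2 \<le> D u v"
    using strong[OF \<open>compact B\<close> \<open>convex B\<close> \<open>B \<subseteq> I\<close>] by (elim exE conjE) blast
  obtain H :: "real ^ 'n \<Rightarrow> (real ^ 'n) \<Rightarrow>\<^sub>L (real ^ 'n)" where H: "continuous_on I H"
      "\<And>v. v \<in> I \<Longrightarrow> (egrad h has_derivative blinfun_apply (H v)) (at v)"
    using C2 unfolding C2_on_interior_def I_def by (elim conjE exE) blast
  obtain M where M: "M > 0" "\<And>v. v \<in> B \<Longrightarrow> norm (H v) \<le> M"
  proof -
    have "compact (H ` B)" by (rule compact_continuous_image[OF continuous_on_subset[OF H(1) \<open>B \<subseteq> I\<close>] \<open>compact B\<close>])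
    then have "bounded (H ` B)" by (rule compact_imp_bounded)
    then show thesis using that unfolding bounded_pos by auto
  qed
  have lipschitz: "norm (egrad h u - egrad h v) \<le> M * norm (u - v)" if "u \<in> B" "v \<in> B" for u v
  proof (rule differentiable_bound[OF \<open>convex B\<close> _ _ that])
    show "(egrad h has_derivative blinfun_apply (H v)) (at v within B)" if "v \<in> B" for v
      using H(2) that \<open>B \<subseteq> I\<close> by (auto intro: has_derivative_at_withinI)
    show "onorm (blinfun_apply (H v)) \<le> M" if "v \<in> B" for v
      using M(2)[OF that] by (simp add: norm_blinfun.rep_eq)
  qed
  have D_upper: "D u v \<le> M * (norm (u - v))\<^sup>2" if uv: "u \<in> B" "v \<in> B" for u v
  proof -
    \<comment> \<open>In the symmetrized distance the values of \<open>h\<close> cancel; the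
      nonnegative term \<open>D v u\<close> is then dropped.\<close>
    have "D u v + D v u = (egrad h u - egrad h v) \<bullet> (u - v)"
      unfolding D_def by (simp add: inner_diff_left inner_diff_right)
    also have "\<dots> \<le> norm (egrad h u - egrad h v) * norm (u - v)" by (rule norm_cauchy_schwarz)
    also have "\<dots> \<le> M * norm (u - v) * norm (u - v)" using lipschitz[OF uv] by (rule mult_right_mono) simp
    finally have "D u v + D v u \<le> M * (norm (u - v))\<^sup>2" by (simp add: power2_eq_square)
    moreover have "0 \<le> D v u" using D_nonneg uv \<open>B \<subseteq> I\<close> by blast
    ultimately show ?thesis by simp
  qed

  \<comment> \<open>Quadratic minorant at the iterates\<close>
  define q where "q = 1 / \<tau>l + \<bar>Lu\<bar>"
  have q: "0 \<le> q" unfolding q_def using \<tau>(1) by simp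
  \<comment> \<open>The 2 comes from \<open>|z - y k|\<^sup>2 \<le> 2 * |z - y (Suc k)|\<^sup>2 + 2
    * d\<^sup>2\<close>. Its second term contributes \<open>P\<close> to \<open>Q\<close>, and the
    upper MAP bound at \<open>y (Suc k)\<close> contributes \<open>Lb * M\<close>.\<close>
  define P where "P = 2 * M * q"
  define Q where "Q = Lb * M + P"
  have PQ: "0 \<le> P" "0 \<le> Q" unfolding P_def Q_def using M(1) q \<open>Lb > 0\<close> by simp_all
  have lower: "g (y (Suc k)) - Q * (norm (y (Suc k) - y k))\<^sup>2 - P * (norm (z - y (Suc k)))\<^sup>2 \<le> g z"
    if z: "z \<in> cball (y (Suc k)) \<delta>" for k z
  proof -
    define d where "d = norm (y (Suc k) - y k)"
    have zU: "z \<in> U" and zB: "z \<in> B" using z ballU ballB by blast+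
    have Dz: "0 \<le> D z (y k)" using D_nonneg zU UI yI by blast
    have D1: "0 \<le> 1 / t k * D (y (Suc k)) (y k)" using D_nonneg[OF yI yI] t[of k] \<tau>(1) by simp
    \<comment> \<open>Optimality costs \<open>1 / t k\<close> and the lower MAP bound
      \<open>Lu\<close>; \<open>q\<close> bounds their sum uniformly in \<open>k\<close> and for
      either sign of \<open>Lu\<close>.\<close>
    have "(1 / t k + Lu) * D z (y k) \<le> q * D z (y k)"
      unfolding q_def using t_inv(2)[of k] Dz by (intro mult_right_mono) auto
    then have "g (y (Suc k)) - Lb * D (y (Suc k)) (y k) - q * D z (y k) \<le> g z"
      using opt[OF zU, of k] MAP_r(1)[OF zU yU, of k] MAP_r(2)[OF yU yU, of "Suc k" k] D1
      by (simp add: algebra_simps)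
    moreover have "Lb * D (y (Suc k)) (y k) \<le> Lb * (M * d\<^sup>2)"
      unfolding d_def using D_upper[OF yB yB] \<open>Lb > 0\<close> by (intro mult_left_mono) auto
    moreover have "q * D z (y k) \<le> P * (norm (z - y (Suc k)))\<^sup>2 + P * d\<^sup>2"
    proof -
      have "norm (z - y k) \<le> norm (z - y (Suc k)) + d"
        unfolding d_def using norm_triangle_ineq[of "z - y (Suc k)" "y (Suc k) - y k"] by simp
      then have "(norm (z - y k))\<^sup>2 \<le> (norm (z - y (Suc k)) + d)\<^sup>2" by (intro power_mono) auto
      also have "\<dots> \<le> 2 * (norm (z - y (Suc k)))\<^sup>2 + 2 * d\<^sup>2"
        using zero_le_power2[of "norm (z - y (Suc k)) - d"] by (simp add: power2_eq_square algebra_simps)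
      finally have "M * (norm (z - y k))\<^sup>2 \<le> M * (2 * (norm (z - y (Suc k)))\<^sup>2 + 2 * d\<^sup>2)"
        using M(1) by simp
      then have "D z (y k) \<le> M * (2 * (norm (z - y (Suc k)))\<^sup>2 + 2 * d\<^sup>2)" using D_upper[OF zB yB, of k] by linarith
      then have "q * D z (y k) \<le> q * (M * (2 * (norm (z - y (Suc k)))\<^sup>2 + 2 * d\<^sup>2))"
        using q by (rule mult_left_mono)
      then show ?thesis unfolding P_def by (simp add: algebra_simps)
    qed
    ultimately show ?thesis unfolding Q_def d_def by (simp add: algebra_simps)
  qed

  \<comment> \<open>Definability of the objective\<close>
  obtain S where S: "o_minimal S" "definable_fun S (U \<times> U) J"
    using assms(5) unfolding definability_assumption_def U_def J_def by (elim exE conjE)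
  interpret o_minimal_structure S by (rule o_minimal_structure.intro) (rule S(1))
  have graph: "dset {(p, s). p \<in> U \<times> U \<and> J p = ereal s}" using S(2) unfolding definable_fun_def .
  have graph_iff: "((z, z), s) \<in> {(p, s). p \<in> U \<times> U \<and> J p = ereal s} \<longleftrightarrow> z \<in> U \<and> s = g z" for z s
    using J[of z z] mm[of z z] diag[of z] by auto
  \<comment> \<open>The diagonal embedding is linear, so the graph of \<open>f\<close> is a linear
    preimage of that of the joint model.\<close>
  have lin: "linear (\<lambda>p::(real ^ 'n) \<times> real. ((fst p, fst p), snd p))" by (intro linear_rules)
  from dset_vimage[OF graph lin] have graph_g: "dset {p. fst p \<in> U \<and> snd p = g (fst p)}"
    unfolding graph_iff .
  have "dset {z. \<exists>s. z \<in> U \<and> s = g z}" by (rule dset_ex[OF graph_g])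
  then have dset_U: "dset U" by simp
  \<comment> \<open>Off the domain \<open>f\<close> is infinite and \<open>real_of_ereal\<close>
    returns 0, so \<open>g\<close> is total with a definable graph.\<close>
  have "snd p = g (fst p) \<longleftrightarrow> (fst p \<in> U \<and> snd p = g (fst p)) \<or> (\<not> fst p \<in> U \<and> snd p = 0)" for p :: "(real ^ 'n) \<times> real"
    unfolding U_def edom_def g_def by (cases "f (fst p)") auto
  moreover have "dset {p :: (real ^ 'n) \<times> real. (fst p \<in> U \<and> snd p = g (fst p)) \<or> (\<not> fst p \<in> U \<and> snd p = 0)}"
    by (intro dset_disj graph_g dset_conj dset_not dset_vimage[OF dset_U] dset_eq dfun_var dfun_const linear_rules)
  ultimately have "dfun g" unfolding dfun_def by simp

  \<comment> \<open>Convergence of the shifted sequence\<close>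
  have "\<exists>l. y \<longlonglongrightarrow> l \<and> l \<in> crit f"
  proof (rule convergence[where U = U and g = g and K = K and y = y and \<delta> = \<delta> and P = P and Q = Q
          and \<alpha> = "\<kappa> * \<sigma> / 2"])
    show "range y \<subseteq> K" using yK by blast
    show "0 < \<kappa> * \<sigma> / 2" using \<kappa> \<sigma>(1) by simp
    show "\<kappa> * \<sigma> / 2 * (norm (y (Suc k) - y k))\<^sup>2 \<le> g (y k) - g (y (Suc k))" for k
    proof -
      have "\<kappa> * (\<sigma> / 2 * (norm (y (Suc k) - y k))\<^sup>2) \<le> \<kappa> * D (y (Suc k)) (y k)"
        using \<sigma>(2)[OF yB yB] \<kappa> by (intro mult_left_mono) auto
      then show ?thesis using decrease[of k] by simp
    qed
  qed (fact dset_U \<open>dfun g\<close> \<open>open U\<close> fg g_cont \<open>compact K\<close> \<open>K \<subseteq> U\<close> PQ \<delta>(1) ballU lower)+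
  then show ?thesis unfolding y_def using filterlim_sequentially_Suc by blast
qed

end
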